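(* Let $R(A,P_0)$ be a trinomial algebra (of type 1 or type 2) with its $K_0$-grading. Then every $K_0$-homogeneous locally nilpotent derivation of $R(A,P_0)$ is elementary.
   Context: Ground field: $\mathbb K$ is an algebraically closed field of characteristic zero. Derivations: a derivation of a commutative $\mathbb K$-algebra $R$ is a $\mathbb K$-linear map $\delta:R\to R$ with $\delta(ab)=\delta(a)b+a\delta(b)$; it is locally nilpotent if for every $a\in R$ there is $n\ge 0$ with $\delta^n(a)=0$. If $R=\bigoplus_{g\in G}R_g$ is graded by an abelian group $G$, $\delta$ is $G$-homogeneous if there is $d\in G$ with $\delta(R_g)\subseteq R_{g+d}$ for all $g\in G$. Trinomial algebras: fix integers $r,n>0$, $m\ge 0$, $\iota\in\{0,1\}$, a partition $n=n_\iota+\dots+n_r$ with $n_i>0$, and for each $i=\iota,\dots,r$ a tuple of positive integers $l_i=(l_{i1},\dots,l_{in_i})$. Put $T_i^{l_i}=T_{i1}^{l_{i1}}\cdots T_{in_i}^{l_{in_i}}$ in the polynomial ring $\mathbb K[T_{ij},S_k]$ ($\iota\le i\le r$, $1\le j\le n_i$, $1\le k\le m$). Type 1: $\iota=1$, $I=\{1,\dots,r-1\}$, $A=(a_1,\dots,a_r)\in\mathbb K^r$ with pairwise different entries, $\mathfrak g_i=T_i^{l_i}-T_{i+1}^{l_{i+1}}-(a_{i+1}-a_i)$ for $i\in I$; $P_0$ is the integer $r\times(n+m)$ matrix (columns indexed by the variables $T_{ij}$, then $S_k$) whose $i$-th row ($1\le i\le r$) has $l_i$ in the block of columns $T_{i1},\dots,T_{in_i}$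 and $0$ elsewhere. Type 2: $\iota=0$, $I=\{0,\dots,r-2\}$, $A=(a_0,\dots,a_r)$ is a $2\times(r+1)$ matrix over $\mathbb K$ with pairwise linearly independent columns, $\mathfrak g_i=\det\begin{pmatrix}T_i^{l_i}&T_{i+1}^{l_{i+1}}&T_{i+2}^{l_{i+2}}\\ a_i&a_{i+1}&a_{i+2}\end{pmatrix}$ for $i\in I$; $P_0$ is the $r\times(n+m)$ matrix whose $i$-th row ($1\le i\le r$) has $-l_0$ in the block of $T_{01},\dots,T_{0n_0}$, $l_i$ in the block of $T_{i1},\dots,T_{in_i}$, and $0$ elsewhere. The trinomial algebra is $R(A,P_0)=\mathbb K[T_{ij},S_k]/(\mathfrak g_i\mid i\in I)$. Let $K_0=\mathbb Z^{n+m}/\mathrm{im}(P_0^T)$ with quotient map $Q:\mathbb Z^{n+m}\to K_0$, and let $v_{ij},v_k$ be the standard basis vectors. The $K_0$-grading of $R(A,P_0)$ is induced by $\deg T_{ij}=Q(v_{ij})$, $\deg S_k=Q(v_k)$ (the $\mathfrak g_i$ are homogeneous). Basic derivations of $R(A,P_0)$ (each is given on generators and is well defined on the quotient; empty products equal 1): (0) For $1\le p\le m$: $\frac{\partial}{\partial S_p}(T_{ij})=0$ for all $(i,j)$; $\frac{\partial}{\partial S_p}(S_k)=1$ if $k=p$ and $0$ if $k\ne p$. (1) In type 1, for a tuple $C=(c_1,\dots,c_r)$ with $1\le c_i\le n_i$ and $l_{ic_i}=1$ for all $i$ except at most one: $\delta_C(T_{ic_i})=\prod_{k\ne i}\frac{\partial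 T_k^{l_k}}{\partial T_{kc_k}}$, $\delta_C(T_{ij})=0$ for $j\neq c_i$, $\delta_C(S_k)=0$ for all $k$. (2) In type 2, let $\beta=(\beta_0,\dots,\beta_r)\in\mathbb K^{r+1}$ be a nonzero vector in the row space of $A$ (so at most one $\beta_i$ is zero). (2.1) If all $\beta_i\ne0$ and $C=(c_0,\dots,c_r)$ satisfies $1\le c_i\le n_i$ and $l_{ic_i}=1$ for all $i$ except at most one: $\delta_{C,\beta}(T_{ic_i})=\beta_i\prod_{k\ne i}\frac{\partial T_k^{l_k}}{\partial T_{kc_k}}$, $\delta_{C,\beta}(T_{ij})=0$ for $j\ne c_i$, $\delta_{C,\beta}(S_k)=0$ for all $k$. (2.2) If $\beta_{i_0}=0$ for exactly one $i_0$ and $C=(c_0,\dots,c_r)$ satisfies $1\le c_i\le n_i$ and $l_{ic_i}=1$ for all $i\ne i_0$ except at most one: $\delta_{C,\beta}(T_{ic_i})=\beta_i\prod_{k\ne i,i_0}\frac{\partial T_k^{l_k}}{\partial T_{kc_k}}$, $\delta_{C,\beta}(T_{ij})=0$ for $j\ne c_i$, $\delta_{C,\beta}(S_k)=0$ for all $k$. A derivation $\widehat\delta$ of $R(A,P_0)$ is elementary if either $\widehat\delta=0$ or $\widehat\delta=h\delta$, where $\delta$ is one of the basic derivations in (0), (1), (2.1), (2.2) and $h\in\ker\delta$ is a $K_0$-homogeneous element. *)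

theory Defs
  imports
    "HOL-Algebra.QuotRing"
    "HOL-Algebra.Module"
    "HOL-Algebra.Free_Abelian_Groups"
    "HOL-Algebra.Algebraic_Closure_Type"
    "HOL-Analysis.Determinants"
begin

section \<open>Derivations of algebras\<close>

definition derivation ::
    "('c, 'd) ring_scheme \<Rightarrow> ('c, 'a, 'e) module_scheme \<Rightarrow> ('a \<Rightarrow> 'a) \<Rightarrow> bool" where
  "derivation K R \<delta> \<longleftrightarrow>
     \<delta> \<in> carrier R \<rightarrow> carrier R \<and>
     (\<forall>a\<in>carrier R. \<forall>b\<in>carrier R. \<delta> (a \<oplus>\<^bsub>R\<^esub> b) = \<delta> a \<oplus>\<^bsub>R\<^esub> \<delta> b) \<and>
     (\<forall>c\<in>carrier K. \<forall>a\<in>carrier R. \<delta> (c \<odot>\<^bsub>R\<^esub> a) = c \<odot>\<^bsub>R\<^esub> \<delta> a) \<and>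
     (\<forall>a\<in>carrier R. \<forall>b\<in>carrier R.
        \<delta> (a \<otimes>\<^bsub>R\<^esub> b) = (\<delta> a \<otimes>\<^bsub>R\<^esub> b) \<oplus>\<^bsub>R\<^esub> (a \<otimes>\<^bsub>R\<^esub> \<delta> b))"

definition locally_nilpotent :: "('a, 'e) ring_scheme \<Rightarrow> ('a \<Rightarrow> 'a) \<Rightarrow> bool" where
  "locally_nilpotent R \<delta> \<longleftrightarrow> (\<forall>a\<in>carrier R. \<exists>n. (\<delta> ^^ n) a = \<zero>\<^bsub>R\<^esub>)"

text \<open>The grading group is written multiplicatively, as everywhere in HOL-Algebra; a grading
  is given by its family of homogeneous components.\<close>

definition homogeneous_element :: "('g, 'h) monoid_scheme \<Rightarrow> ('g \<Rightarrow> 'a set) \<Rightarrow> 'a \<Rightarrow> bool" where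
  "homogeneous_element G grad a \<longleftrightarrow> (\<exists>g\<in>carrier G. a \<in> grad g)"

definition homogeneous_derivation ::
    "('g, 'h) monoid_scheme \<Rightarrow> ('g \<Rightarrow> 'a set) \<Rightarrow> ('a \<Rightarrow> 'a) \<Rightarrow> bool" where
  "homogeneous_derivation G grad \<delta> \<longleftrightarrow>
     (\<exists>d\<in>carrier G. \<forall>g\<in>carrier G. \<delta> ` grad g \<subseteq> grad (g \<otimes>\<^bsub>G\<^esub> d))"


section \<open>Polynomial rings\<close>

type_synonym ('v, 'k) mpoly = "('v \<Rightarrow>\<^sub>0 nat) \<Rightarrow>\<^sub>0 'k"

definition Const :: "'k \<Rightarrow> ('v, 'k::zero) mpoly" where
  "Const c = Poly_Mapping.single 0 c"

definition Var :: "'v \<Rightarrow> ('v, 'k::zero_neq_one) mpoly" where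
  "Var v = Poly_Mapping.single (Poly_Mapping.single v 1) 1"

definition pdiff :: "'v \<Rightarrow> ('v, 'k::comm_ring_1) mpoly \<Rightarrow> ('v, 'k) mpoly" where
  "pdiff v p =
     (\<Sum>\<mu>\<in>Poly_Mapping.keys p.
        Poly_Mapping.single (\<mu> - Poly_Mapping.single v 1)
          (of_nat (Poly_Mapping.lookup \<mu> v) * Poly_Mapping.lookup p \<mu>))"

definition mpoly_ring :: "'v set \<Rightarrow> ('v, 'k::comm_ring_1) mpoly ring" where
  "mpoly_ring V =
     \<lparr>carrier = {p. \<forall>\<mu>\<in>Poly_Mapping.keys p. Poly_Mapping.keys \<mu> \<subseteq> V},
      monoid.mult = (*), one = 1, zero = 0, add = (+)\<rparr>"


section \<open>Trinomial algebras\<close>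

text \<open>The matrix \<open>A\<close> is given by its columns \<open>a i\<close>, and its shape determines the type.\<close>

datatype 'k coeff_matrix = Type1 "nat \<Rightarrow> 'k" | Type2 "nat \<Rightarrow> 'k^2"

text \<open>\<open>tri_n D i\<close> is $n_i$ and \<open>tri_l D i j\<close> is $l_{ij}$. Values at
  indices outside the ranges \<open>{tri_iota D..tri_r D}\<close> and \<open>{1..tri_n D i}\<close> are irrelevant.\<close>

record 'k trinomial_data =
  tri_A :: "'k coeff_matrix"
  tri_r :: nat
  tri_n :: "nat \<Rightarrow> nat"
  tri_l :: "nat \<Rightarrow> nat \<Rightarrow> nat"
  tri_m :: nat

definition tri_iota :: "'k trinomial_data \<Rightarrow> nat" where
  "tri_iota D = (case tri_A D of Type1 _ \<Rightarrow> 1 | Type2 _ \<Rightarrow> 0)"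

abbreviation tri_idx :: "'k trinomial_data \<Rightarrow> nat set" where
  "tri_idx D \<equiv> {tri_iota D..tri_r D}"

definition trinomial_data :: "'k::field trinomial_data \<Rightarrow> bool" where
  "trinomial_data D \<longleftrightarrow>
     tri_r D > 0 \<and>
     (\<forall>i\<in>tri_idx D. tri_n D i > 0 \<and> (\<forall>j\<in>{1..tri_n D i}. tri_l D i j > 0)) \<and>
     (case tri_A D of
        Type1 a \<Rightarrow> inj_on a {1..tri_r D}
      | Type2 a \<Rightarrow> (\<forall>i\<in>{0..tri_r D}. \<forall>j\<in>{0..tri_r D}.
                     i \<noteq> j \<longrightarrow> a i \<noteq> a j \<and> vec.independent {a i, a j}))"

datatype trinomial_var = Tv nat nat | Sv nat

definition tri_vars :: "'k trinomial_data \<Rightarrow> trinomial_var set" where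
  "tri_vars D =
     {Tv i j | i j. i \<in> tri_idx D \<and> j \<in> {1..tri_n D i}} \<union> {Sv k | k. k \<in> {1..tri_m D}}"

abbreviation tri_poly_ring ::
    "'k::comm_ring_1 trinomial_data \<Rightarrow> (trinomial_var, 'k) mpoly ring" where
  "tri_poly_ring D \<equiv> mpoly_ring (tri_vars D)"

definition T_monomial ::
    "'k::comm_ring_1 trinomial_data \<Rightarrow> nat \<Rightarrow> (trinomial_var, 'k) mpoly" where
  "T_monomial D i = (\<Prod>j\<in>{1..tri_n D i}. Var (Tv i j) ^ tri_l D i j)"

definition tri_relations ::
    "'k::comm_ring_1 trinomial_data \<Rightarrow> (trinomial_var, 'k) mpoly set" where
  "tri_relations D =
     (case tri_A D of
        Type1 a \<Rightarrow>
          {T_monomial D i - T_monomial D (i+1) - Const (a (i+1) - a i) | i.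
             1 \<le> i \<and> i + 1 \<le> tri_r D}
      | Type2 a \<Rightarrow>
          {det (vector [vector [T_monomial D i, T_monomial D (i+1), T_monomial D (i+2)],
                        vector [Const (a i $ 1), Const (a (i+1) $ 1), Const (a (i+2) $ 1)],
                        vector [Const (a i $ 2), Const (a (i+1) $ 2), Const (a (i+2) $ 2)]]
                  :: (trinomial_var, 'k) mpoly^3^3) | i.
             i + 2 \<le> tri_r D})"

definition tri_ideal ::
    "'k::comm_ring_1 trinomial_data \<Rightarrow> (trinomial_var, 'k) mpoly set" where
  "tri_ideal D = Idl\<^bsub>tri_poly_ring D\<^esub> (tri_relations D)"

definition tri_class ::
    "'k::comm_ring_1 trinomial_data \<Rightarrow> (trinomial_var, 'k) mpoly
       \<Rightarrow> (trinomial_var, 'k) mpoly set" where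
  "tri_class D p = tri_ideal D +>\<^bsub>tri_poly_ring D\<^esub> p"

definition trinomial_algebra ::
    "'k::comm_ring_1 trinomial_data \<Rightarrow> ('k, (trinomial_var, 'k) mpoly set) module" where
  "trinomial_algebra D =
     (let Q = tri_poly_ring D Quot tri_ideal D in
      \<lparr>carrier = carrier Q, monoid.mult = monoid.mult Q, one = one Q, zero = zero Q, add = add Q,
       module.smult = (\<lambda>c x. monoid.mult Q (tri_class D (Const c)) x)\<rparr>)"


section \<open>The grading\<close>

fun tri_P0 :: "'k trinomial_data \<Rightarrow> nat \<Rightarrow> trinomial_var \<Rightarrow> int" where
  "tri_P0 D i (Tv i' j) =
     (if i' = i then int (tri_l D i j)
      else if i' = 0 then - int (tri_l D 0 j)
      else 0)"
| "tri_P0 D i (Sv k) = 0"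

text \<open>Only the rows \<open>1, \<dots>, r\<close> of \<open>tri_P0\<close> are used. In type 1 no variable \<open>Tv 0 j\<close> belongs to
  \<open>tri_vars D\<close>, so one formula covers both types.\<close>

definition tri_lattice :: "'k trinomial_data \<Rightarrow> (trinomial_var \<Rightarrow>\<^sub>0 int) monoid" where
  "tri_lattice D = free_Abelian_group (tri_vars D)"

definition im_P0_transpose :: "'k trinomial_data \<Rightarrow> (trinomial_var \<Rightarrow>\<^sub>0 int) set" where
  "im_P0_transpose D =
     {u \<in> carrier (tri_lattice D). \<exists>z :: nat \<Rightarrow> int.
        \<forall>v\<in>tri_vars D. Poly_Mapping.lookup u v = (\<Sum>i=1..tri_r D. tri_P0 D i v * z i)}"

definition tri_K0 :: "'k trinomial_data \<Rightarrow> (trinomial_var \<Rightarrow>\<^sub>0 int) set monoid" where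
  "tri_K0 D = tri_lattice D Mod im_P0_transpose D"

definition tri_Q ::
    "'k trinomial_data \<Rightarrow> (trinomial_var \<Rightarrow>\<^sub>0 int) \<Rightarrow> (trinomial_var \<Rightarrow>\<^sub>0 int) set" where
  "tri_Q D u = im_P0_transpose D #>\<^bsub>tri_lattice D\<^esub> u"

text \<open>A monomial with exponent vector \<open>\<mu>\<close> has degree \<open>tri_Q D \<mu>\<close>.\<close>

definition tri_component ::
    "'k::comm_ring_1 trinomial_data \<Rightarrow> (trinomial_var \<Rightarrow>\<^sub>0 int) set
       \<Rightarrow> (trinomial_var, 'k) mpoly set set" where
  "tri_component D g =
     {tri_class D p | p. p \<in> carrier (tri_poly_ring D) \<and>
        (\<forall>\<mu>\<in>Poly_Mapping.keys p. tri_Q D (Poly_Mapping.map int \<mu>) = g)}"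


section \<open>Elementary derivations\<close>

definition values_on_generators ::
    "'k::comm_ring_1 trinomial_data
       \<Rightarrow> ((trinomial_var, 'k) mpoly set \<Rightarrow> (trinomial_var, 'k) mpoly set)
       \<Rightarrow> (trinomial_var \<Rightarrow> (trinomial_var, 'k) mpoly) \<Rightarrow> bool" where
  "values_on_generators D \<delta> f \<longleftrightarrow>
     (\<forall>v\<in>tri_vars D. \<delta> (tri_class D (Var v)) = tri_class D (f v))"

fun S_values :: "nat \<Rightarrow> trinomial_var \<Rightarrow> (trinomial_var, 'k::comm_ring_1) mpoly" where
  "S_values p (Tv i j) = 0"
| "S_values p (Sv k) = (if k = p then 1 else 0)"

text \<open>\<open>J\<close> is the set of indices over which the products (with the own index \<open>i\<close> removed) range:
  all of them, or all but the index with $\beta_{i_0} = 0$.\<close>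

fun T_values ::
    "'k::comm_ring_1 trinomial_data \<Rightarrow> nat set \<Rightarrow> (nat \<Rightarrow> nat) \<Rightarrow> (nat \<Rightarrow> 'k)
       \<Rightarrow> trinomial_var \<Rightarrow> (trinomial_var, 'k) mpoly" where
  "T_values D J C \<beta> (Tv i j) =
     (if j = C i
      then Const (\<beta> i) * (\<Prod>k\<in>J - {i}. pdiff (Tv k (C k)) (T_monomial D k))
      else 0)"
| "T_values D J C \<beta> (Sv k) = 0"

definition index_tuple :: "'k trinomial_data \<Rightarrow> (nat \<Rightarrow> nat) \<Rightarrow> bool" where
  "index_tuple D C \<longleftrightarrow> (\<forall>i\<in>tri_idx D. C i \<in> {1..tri_n D i})"

definition exponents_one_but_one :: "'k trinomial_data \<Rightarrow> nat set \<Rightarrow> (nat \<Rightarrow> nat) \<Rightarrow> bool" where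
  "exponents_one_but_one D J C \<longleftrightarrow> card {i \<in> J. tri_l D i (C i) \<noteq> 1} \<le> 1"

definition in_row_space :: "nat \<Rightarrow> (nat \<Rightarrow> 'k::comm_ring_1^2) \<Rightarrow> (nat \<Rightarrow> 'k) \<Rightarrow> bool" where
  "in_row_space r a \<beta> \<longleftrightarrow> (\<exists>x y. \<forall>i\<in>{0..r}. \<beta> i = x * a i $ 1 + y * a i $ 2)"

definition basic_derivation ::
    "'k::field trinomial_data
       \<Rightarrow> ((trinomial_var, 'k) mpoly set \<Rightarrow> (trinomial_var, 'k) mpoly set) \<Rightarrow> bool" where
  "basic_derivation D \<delta> \<longleftrightarrow>
     derivation ring_of_type_algebra (trinomial_algebra D) \<delta> \<and>
     ((\<exists>p\<in>{1..tri_m D}. values_on_generators D \<delta> (S_values p)) \<or>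
      (case tri_A D of
         Type1 _ \<Rightarrow>
           \<exists>C. index_tuple D C \<and> exponents_one_but_one D (tri_idx D) C \<and>
             values_on_generators D \<delta> (T_values D (tri_idx D) C (\<lambda>_. 1))
       | Type2 a \<Rightarrow>
           \<exists>C \<beta>. index_tuple D C \<and> in_row_space (tri_r D) a \<beta> \<and> (\<exists>i\<in>tri_idx D. \<beta> i \<noteq> 0) \<and>
             ((\<forall>i\<in>tri_idx D. \<beta> i \<noteq> 0) \<and>
                exponents_one_but_one D (tri_idx D) C \<and>
                values_on_generators D \<delta> (T_values D (tri_idx D) C \<beta>)
              \<or>
              (\<exists>i\<^sub>0\<in>tri_idx D. \<beta> i\<^sub>0 = 0 \<and> (\<forall>i\<in>tri_idx D - {i\<^sub>0}. \<beta> i \<noteq> 0) \<and>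
                exponents_one_but_one D (tri_idx D - {i\<^sub>0}) C \<and>
                values_on_generators D \<delta> (T_values D (tri_idx D - {i\<^sub>0}) C \<beta>)))))"

definition elementary_derivation ::
    "'k::field trinomial_data
       \<Rightarrow> ((trinomial_var, 'k) mpoly set \<Rightarrow> (trinomial_var, 'k) mpoly set) \<Rightarrow> bool" where
  "elementary_derivation D \<delta> \<longleftrightarrow>
     derivation ring_of_type_algebra (trinomial_algebra D) \<delta> \<and>
     ((\<forall>x\<in>carrier (trinomial_algebra D). \<delta> x = \<zero>\<^bsub>trinomial_algebra D\<^esub>) \<or>
      (\<exists>\<delta>' h. basic_derivation D \<delta>' \<and>
         h \<in> carrier (trinomial_algebra D) \<and> \<delta>' h = \<zero>\<^bsub>trinomial_algebra D\<^esub> \<and>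
         homogeneous_element (tri_K0 D) (tri_component D) h \<and>
         (\<forall>x\<in>carrier (trinomial_algebra D). \<delta> x = h \<otimes>\<^bsub>trinomial_algebra D\<^esub> \<delta>' x)))"

end

theory Submission
  imports Defs "HOL-Library.Function_Algebras"
begin

text \<open>
  A homogeneous element of the trinomial algebra is a monomial, divisible by no $T_i^{l_i}$, times
  a form in a pencil containing all the $T_i^{l_i}$. Hence products of nonzero
  homogeneous elements are nonzero, and the degree function of a homogeneous locally nilpotent
  derivation $\delta$ is additive on them; in particular, $\delta(x) = 0$ if $x$ divides $\delta(x)$.

  If $\delta$ kills the pencil, it kills all $T_{ij}$ and, by the degrees in the $S_k$, all but one $S_p$.
  Otherwise the divisibility argument yields a member $\lambda$ of the pencil with
  $\delta(\lambda) = 0$ and shows $\delta(\mu) = c M \lambda^e$ for a complementary member $\mu$ and a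
  monomial $M$ as above. A variable $x$ with $\delta(x) \neq 0$ must complete $M$ to a multiple of
  some $T_i^{l_i}$, since otherwise $x$ divides $\delta(x)$. So each block contains at most one such
  variable, $M$ contains the product of the corresponding $T_i^{l_i} / T_{ic_i}$, and the
  remaining factor of $M$ times $\lambda^e$ is the multiplier $h$.
\<close>

section \<open>Polynomials\<close>

text \<open>Neither integrality nor factoriality of the algebra is established. Their substitute is
  that homogeneous polynomials outside the ideal have a product outside it, seen by evaluating at
  points of the zero set with all coordinates nonzero. Every cancellation therefore has to involve
  homogeneous factors only, and computations use polynomial vector fields and congruences modulo the
  ideal instead of the quotient. Type 1 is treated as a dehomogenized pencil: one basis member is
  the constant 1, which every derivation kills, and the T_i^{l_i} have degree zero. In type 2 the
  killed member comes from a root of a polynomial, which is where algebraic closedness enters a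
  second time after the choice of points. The coefficients of the T_i^{l_i} at the complementary
  member form the vector \<beta>; independence of the columns leaves at most one zero among them.
  The condition that at most one exponent differs from 1 is again a degree argument: two exceptional
  variables would divide each other's derivatives.\<close>

abbreviation lookup where "lookup \<equiv> Poly_Mapping.lookup"
abbreviation keys where "keys \<equiv> Poly_Mapping.keys"
abbreviation single where "single \<equiv> Poly_Mapping.single"

abbreviation mon :: "('v \<Rightarrow>\<^sub>0 nat) \<Rightarrow> ('v, 'k::zero_neq_one) mpoly" where
  "mon \<mu> \<equiv> single \<mu> 1"

lemma sum_keys_single: "(\<Sum>\<mu>\<in>keys p. single \<mu> (lookup p \<mu>)) = p"
proof (rule poly_mapping_eqI)
  fix k
  show "lookup (\<Sum>\<mu>\<in>keys p. single \<mu> (lookup p \<mu>)) k = lookup p k"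
    by (simp add: lookup_sum lookup_single when_def sum.delta in_keys_iff)
qed

lemma additive_induct [case_names zero single add]:
  fixes p :: "'a \<Rightarrow>\<^sub>0 'b::comm_monoid_add"
  assumes "P 0" "\<And>\<mu> c. P (single \<mu> c)" "\<And>p q. P p \<Longrightarrow> P q \<Longrightarrow> P (p + q)"
  shows "P p"
proof -
  have "P (\<Sum>\<mu>\<in>A. single \<mu> (lookup p \<mu>))" for A
    by (induction A rule: infinite_finite_induct) (auto intro: assms)
  then show ?thesis
    using sum_keys_single by metis
qed

lemma Const_add: "Const (a + b) = Const a + Const b"
  by (simp add: Const_def single_add)

lemma Const_uminus: "Const (- a) = - Const a"
  by (simp add: Const_def single_uminus)

lemma Const_diff: "Const (a - b) = Const a - Const b"
  by (simp add: Const_def single_diff)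

lemma Const_mult: "Const (a * b) = Const a * Const b"
  by (simp add: Const_def mult_single)

lemma Const_0 [simp]: "Const 0 = 0"
  by (simp add: Const_def)

lemma Const_1 [simp]: "Const 1 = 1"
  by (simp add: Const_def)

lemma Const_prod: "Const (prod f A) = (\<Prod>i\<in>A. Const (f i))"
  by (induction A rule: infinite_finite_induct) (simp_all add: Const_mult)

lemma Const_of_nat: "Const (of_nat n) = of_nat n"
  by (simp add: Const_def)

lemma single_eq_Const_mon: "single \<mu> c = (Const c * mon \<mu> :: ('v, 'k::comm_ring_1) mpoly)"
  by (simp add: Const_def mult_single)

lemma mon_add: "mon (\<mu> + \<nu>) = (mon \<mu> * mon \<nu> :: ('v, 'k::comm_ring_1) mpoly)"
  by (simp add: mult_single)

lemma mon_sum: "mon (\<Sum>i\<in>A. f i) = (\<Prod>i\<in>A. mon (f i) :: ('v, 'k::comm_ring_1) mpoly)"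
  by (induction A rule: infinite_finite_induct) (simp_all add: mon_add)

lemma Var_power: "Var v ^ n = (mon (single v n) :: ('v, 'k::comm_ring_1) mpoly)"
proof (induction n)
  case (Suc n)
  have "single v (Suc n) = single v 1 + single v n"
    by (simp flip: single_add)
  then show ?case
    using Suc by (simp add: Var_def mon_add)
qed simp

subsection \<open>Polynomials in a given set of variables\<close>

text \<open>The carrier of \<open>mpoly_ring V\<close> as a plain set, so that arithmetic takes
  place in the type \<open>mpoly\<close> with membership as a side condition.\<close>

definition polys :: "'v set \<Rightarrow> ('v, 'k::comm_ring_1) mpoly set" where
  "polys V = {p. \<forall>\<mu>\<in>keys p. keys \<mu> \<subseteq> V}"

lemma polys_single: "c = 0 \<or> keys \<mu> \<subseteq> V \<Longrightarrow> single \<mu> c \<in> polys V"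
  by (auto simp: polys_def)

lemma polys_Const [simp]: "Const c \<in> polys V"
  by (auto simp: polys_def Const_def)

lemma polys_Var [simp]: "v \<in> V \<Longrightarrow> Var v \<in> polys V"
  by (auto simp: polys_def Var_def)

lemma polys_0 [simp]: "0 \<in> polys V"
  by (simp add: polys_def)

lemma polys_1 [simp]: "1 \<in> polys V"
  by (simp add: polys_def)

lemma polys_add [simp]: "p \<in> polys V \<Longrightarrow> q \<in> polys V \<Longrightarrow> p + q \<in> polys V"
  unfolding polys_def using Poly_Mapping.keys_add[of p q] by blast

lemma polys_mult [simp]: "p \<in> polys V \<Longrightarrow> q \<in> polys V \<Longrightarrow> p * q \<in> polys V"
proof -
  assume *: "p \<in> polys V" "q \<in> polys V"
  show "p * q \<in> polys V"
    unfolding polys_def mem_Collect_eq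
  proof
    fix \<mu> assume "\<mu> \<in> keys (p * q)"
    then obtain a b where "\<mu> = a + b" "a \<in> keys p" "b \<in> keys q"
      using keys_mult[of p q] by blast
    then show "keys \<mu> \<subseteq> V"
      using * Poly_Mapping.keys_add[of a b] unfolding polys_def by blast
  qed
qed

lemma keys_uminus_mpoly: "keys (- p) = keys (p :: ('v, 'k::comm_ring_1) mpoly)"
  by (auto simp: in_keys_iff)

lemma polys_uminus [simp]: "p \<in> polys V \<Longrightarrow> - p \<in> polys V"
  by (simp add: polys_def keys_uminus_mpoly)

lemma polys_diff [simp]: "p \<in> polys V \<Longrightarrow> q \<in> polys V \<Longrightarrow> p - q \<in> polys V"
  by (metis diff_conv_add_uminus polys_add polys_uminus)

lemma polys_power [simp]: "p \<in> polys V \<Longrightarrow> p ^ n \<in> polys V"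
  by (induction n) simp_all

lemma polys_sum [simp]: "(\<And>i. i \<in> A \<Longrightarrow> f i \<in> polys V) \<Longrightarrow> sum f A \<in> polys V"
  by (induction A rule: infinite_finite_induct) simp_all

lemma polys_prod [simp]: "(\<And>i. i \<in> A \<Longrightarrow> f i \<in> polys V) \<Longrightarrow> prod f A \<in> polys V"
  by (induction A rule: infinite_finite_induct) simp_all

lemma polys_of_nat [simp]: "of_nat n \<in> polys V"
  by (induction n) simp_all

lemma mon_eq_prod_Var: "mon \<mu> = (\<Prod>v\<in>keys \<mu>. Var v ^ lookup \<mu> v :: ('v, 'k::comm_ring_1) mpoly)"
proof -
  have "mon \<mu> = (mon (\<Sum>v\<in>keys \<mu>. single v (lookup \<mu> v)) :: ('v, 'k) mpoly)"
    by (simp add: sum_keys_single)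
  then show ?thesis
    by (simp only: mon_sum Var_power)
qed

lemma polys_induct [consumes 1, case_names Const Var add mult]:
  fixes p :: "('v, 'k::comm_ring_1) mpoly"
  assumes "p \<in> polys V"
    and Const: "\<And>c. P (Const c)" and Var: "\<And>v. v \<in> V \<Longrightarrow> P (Var v)"
    and add: "\<And>p q. p \<in> polys V \<Longrightarrow> q \<in> polys V \<Longrightarrow> P p \<Longrightarrow> P q \<Longrightarrow> P (p + q)"
    and mult: "\<And>p q. p \<in> polys V \<Longrightarrow> q \<in> polys V \<Longrightarrow> P p \<Longrightarrow> P q \<Longrightarrow> P (p * q)"
  shows "P p"
proof -
  have one: "P 1"
    using Const[of 1] by simp
  have power: "P (Var v ^ n)" if "v \<in> V" for v n
    by (induction n) (use that in \<open>auto intro: one Var mult\<close>)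
  have prod: "P (\<Prod>v\<in>A. Var v ^ f v)" if "A \<subseteq> V" for A f
    using that
    by (induction A rule: infinite_finite_induct) (auto intro!: one power mult polys_prod polys_power polys_Var)
  have mon: "P (single \<mu> c)" if "keys \<mu> \<subseteq> V" for \<mu> c
  proof -
    have "P (Const c * (\<Prod>v\<in>keys \<mu>. Var v ^ lookup \<mu> v))"
      using that by (intro mult Const prod) (auto intro!: polys_prod polys_power)
    then show ?thesis
      by (simp add: single_eq_Const_mon[of \<mu> c] mon_eq_prod_Var)
  qed
  have "P (\<Sum>\<mu>\<in>A. single \<mu> (lookup p \<mu>))" if "A \<subseteq> keys p" for A
    using that assms(1)
  proof (induction A rule: infinite_finite_induct)
    case (insert x F)
    then show ?case
      by (auto simp: polys_def subset_eq intro!: add mon polys_single polys_sum)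
  qed (use Const[of 0] in simp_all)
  from this[of "keys p"] show ?thesis
    by (simp add: sum_keys_single)
qed

subsection \<open>Evaluation\<close>

definition mon_eval :: "('v \<Rightarrow> 'k::comm_ring_1) \<Rightarrow> ('v \<Rightarrow>\<^sub>0 nat) \<Rightarrow> 'k" where
  "mon_eval x \<mu> = (\<Prod>v\<in>keys \<mu>. x v ^ lookup \<mu> v)"

definition peval :: "('v \<Rightarrow> 'k::comm_ring_1) \<Rightarrow> ('v, 'k) mpoly \<Rightarrow> 'k" where
  "peval x p = (\<Sum>\<mu>\<in>keys p. mon_eval x \<mu> * lookup p \<mu>)"

lemma mon_eval_superset:
  "finite A \<Longrightarrow> keys \<mu> \<subseteq> A \<Longrightarrow> mon_eval x \<mu> = (\<Prod>v\<in>A. x v ^ lookup \<mu> v)"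
  unfolding mon_eval_def by (rule prod.mono_neutral_left) (auto simp: in_keys_iff)

lemma mon_eval_add: "mon_eval x (\<mu> + \<nu>) = mon_eval x \<mu> * mon_eval x \<nu>"
proof -
  have "mon_eval x \<rho> = (\<Prod>v\<in>keys \<mu> \<union> keys \<nu>. x v ^ lookup \<rho> v)"
    if "keys \<rho> \<subseteq> keys \<mu> \<union> keys \<nu>" for \<rho>
    using that by (intro mon_eval_superset) auto
  then show ?thesis
    using Poly_Mapping.keys_add[of \<mu> \<nu>]
    by (simp add: lookup_add power_add prod.distrib)
qed

lemma mon_eval_neq_0:
  fixes x :: "'v \<Rightarrow> 'k::idom"
  assumes "\<And>v. v \<in> keys \<mu> \<Longrightarrow> x v \<noteq> 0"
  shows "mon_eval x \<mu> \<noteq> 0"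
  using assms by (simp add: mon_eval_def)

lemma peval_0 [simp]: "peval x 0 = 0"
  by (simp add: peval_def)

lemma peval_single [simp]: "peval x (single \<mu> c) = c * mon_eval x \<mu>"
  by (simp add: peval_def mult.commute)

lemma peval_Const [simp]: "peval x (Const c) = c"
  by (simp add: Const_def mon_eval_def)

lemma peval_1 [simp]: "peval x 1 = 1"
  using peval_Const[of x 1] by simp

lemma peval_Var [simp]: "peval x (Var v) = x v"
  by (simp add: Var_def mon_eval_def)

lemma peval_add [simp]: "peval x (p + q) = peval x p + peval x q"
  unfolding peval_def by (rule setsum_keys_plus_distrib) (simp_all add: distrib_left)

lemma peval_uminus [simp]: "peval x (- p) = - peval x p"
  using peval_add[of x p "- p"] by (simp add: eq_neg_iff_add_eq_0 add.commute del: peval_add)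

lemma peval_diff [simp]: "peval x (p - q) = peval x p - peval x q"
  using peval_add[of x p "- q"] by (simp del: peval_add)

lemma peval_mult [simp]: "peval x (p * q) = peval x p * peval x q"
proof (induction p rule: additive_induct)
  case (single \<mu> c)
  show ?case
    by (induction q rule: additive_induct)
      (simp_all add: mult_single mon_eval_add algebra_simps)
qed (simp_all add: distrib_right)

lemma peval_sum [simp]: "peval x (sum f A) = (\<Sum>i\<in>A. peval x (f i))"
  by (induction A rule: infinite_finite_induct) simp_all

lemma peval_power [simp]: "peval x (p ^ n) = peval x p ^ n"
  by (induction n) simp_all

lemma peval_prod [simp]: "peval x (prod f A) = (\<Prod>i\<in>A. peval x (f i))"
  by (induction A rule: infinite_finite_induct) simp_all

subsection \<open>Polynomial vector fields\<close>

lemma pdiff_0 [simp]: "pdiff v 0 = 0"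
  by (simp add: pdiff_def)

lemma pdiff_single:
  "pdiff v (single \<mu> c) = single (\<mu> - single v 1) (of_nat (lookup \<mu> v) * c)"
  by (simp add: pdiff_def)

lemma pdiff_add: "pdiff v (p + q) = pdiff v p + pdiff v q"
  unfolding pdiff_def
  by (rule setsum_keys_plus_distrib) (simp_all add: distrib_left single_add)

text \<open>Subtraction of exponents is truncated, so regrouping it with an addition needs a
  positive exponent at \<open>v\<close>.\<close>

lemma minus_single_add:
  assumes "lookup \<mu> v \<noteq> (0::nat)"
  shows "\<mu> - single v 1 + \<nu> = \<mu> + \<nu> - single v 1"
  by (rule poly_mapping_eqI)
    (use assms in \<open>auto simp: lookup_add lookup_minus lookup_single when_def\<close>)

lemma pdiff_mult: "pdiff v (p * q) = pdiff v p * q + p * pdiff v q"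
proof (induction p rule: additive_induct)
  case (single \<mu> a)
  show ?case
  proof (induction q rule: additive_induct)
    case (single \<nu> b)
    \<comment> \<open>If \<open>v\<close> does not occur in \<open>\<mu>\<close>, truncation may
      make the two exponent vectors differ, but then the coefficient is zero.\<close>
    have 1: "single (\<mu> - single v 1 + \<nu>) (of_nat (lookup \<mu> v) * (a * b)) =
        single (\<mu> + \<nu> - single v 1) (of_nat (lookup \<mu> v) * (a * b))"
      using minus_single_add[of \<mu> v \<nu>] by (cases "lookup \<mu> v = 0") simp_all
    have 2: "single (\<mu> + (\<nu> - single v 1)) (of_nat (lookup \<nu> v) * (a * b)) =
        single (\<mu> + \<nu> - single v 1) (of_nat (lookup \<nu> v) * (a * b))"
      using minus_single_add[of \<nu> v \<mu>]
      by (cases "lookup \<nu> v = 0") (simp_all add: add.commute)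
    show ?case
      using 1 2
      by (simp add: mult_single pdiff_single lookup_add distrib_right distrib_left single_add mult.assoc
          mult.left_commute)
  qed (simp_all add: pdiff_add algebra_simps)
qed (simp_all add: pdiff_add algebra_simps)

lemma pdiff_Const [simp]: "pdiff v (Const c) = 0"
  by (simp add: Const_def pdiff_single)

lemma pdiff_Var: "pdiff v (Var w) = (if v = w then 1 else 0)"
  by (simp add: Var_def pdiff_single lookup_single when_def)

lemma pdiff_polys [simp]: "p \<in> polys V \<Longrightarrow> pdiff v p \<in> polys V"
  by (induction rule: polys_induct) (simp_all add: pdiff_Var pdiff_add pdiff_mult)

text \<open>The derivation sum of f_v d/dv of the polynomial ring. Derivations of the quotient are
  handled through such lifts, whose values on the variables can be prescribed freely.\<close>

definition vfield :: "'v set \<Rightarrow> ('v \<Rightarrow> ('v, 'k::comm_ring_1) mpoly) \<Rightarrow> ('v, 'k) mpoly \<Rightarrow> ('v, 'k) mpoly"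
  where "vfield V f p = (\<Sum>v\<in>V. f v * pdiff v p)"

lemma vfield_0 [simp]: "vfield V f 0 = 0"
  by (simp add: vfield_def)

lemma vfield_add: "vfield V f (p + q) = vfield V f p + vfield V f q"
  by (simp add: vfield_def pdiff_add distrib_left sum.distrib)

lemma vfield_mult: "vfield V f (p * q) = vfield V f p * q + p * vfield V f q"
  by (simp add: vfield_def pdiff_mult sum_distrib_left sum_distrib_right sum.distrib algebra_simps)

lemma vfield_Const [simp]: "vfield V f (Const c) = 0"
  by (simp add: vfield_def)

lemma vfield_1 [simp]: "vfield V f 1 = 0"
  using vfield_Const[of V f 1] by simp

lemma vfield_Const_mult: "vfield V f (Const c * p) = Const c * vfield V f p"
  by (simp add: vfield_mult)

lemma vfield_uminus: "vfield V f (- p) = - vfield V f p"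
  using vfield_add[of V f p "- p"] by (simp add: eq_neg_iff_add_eq_0 add.commute)

lemma vfield_diff: "vfield V f (p - q) = vfield V f p - vfield V f q"
  using vfield_add[of V f p "- q"] by (simp add: vfield_uminus)

lemma vfield_Var: "finite V \<Longrightarrow> vfield V f (Var v) = (if v \<in> V then f v else 0)"
  by (simp add: vfield_def pdiff_Var if_distrib[of "\<lambda>x. _ * x"] sum.delta' cong: if_cong)

lemma vfield_polys [simp]:
  "(\<And>v. v \<in> V \<Longrightarrow> f v \<in> polys W) \<Longrightarrow> p \<in> polys W \<Longrightarrow> vfield V f p \<in> polys W"
  by (simp add: vfield_def)

section \<open>Degree functions of locally nilpotent derivations modulo an ideal\<close>

section \<open>Locally nilpotent derivations on homogeneous elements\<close>

text \<open>The quotient by \<open>I\<close> is only known to have no zero divisors among homogeneous elements;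
  this suffices for the degree function of a homogeneous locally nilpotent derivation to be
  additive on products of such elements.\<close>

locale homogeneous_lnd =
  fixes P I Hom :: "'a::comm_ring_1 set" and \<Delta> :: "'a \<Rightarrow> 'a"
  assumes P_mult: "p \<in> P \<Longrightarrow> q \<in> P \<Longrightarrow> p * q \<in> P"
    and P_of_nat: "of_nat n \<in> P"
    and I_0: "0 \<in> I"
    and I_add: "p \<in> I \<Longrightarrow> q \<in> I \<Longrightarrow> p + q \<in> I"
    and I_uminus: "p \<in> I \<Longrightarrow> - p \<in> I"
    and I_mult: "p \<in> P \<Longrightarrow> q \<in> I \<Longrightarrow> p * q \<in> I"
    and Hom_P: "Hom \<subseteq> P"
    and Hom_mult: "p \<in> Hom \<Longrightarrow> q \<in> Hom \<Longrightarrow> p * q \<in> Hom"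
    and Hom_prime: "p \<in> Hom \<Longrightarrow> q \<in> Hom \<Longrightarrow> p * q \<in> I \<Longrightarrow> p \<in> I \<or> q \<in> I"
    and Hom_char: "p \<in> Hom \<Longrightarrow> of_nat n * p \<in> I \<Longrightarrow> n \<noteq> 0 \<Longrightarrow> p \<in> I"
    and D_add: "\<Delta> (p + q) = \<Delta> p + \<Delta> q"
    and D_mult: "\<Delta> (p * q) = \<Delta> p * q + p * \<Delta> q"
    and D_P: "p \<in> P \<Longrightarrow> \<Delta> p \<in> P"
    and D_I: "p \<in> I \<Longrightarrow> \<Delta> p \<in> I"
    and D_Hom: "p \<in> Hom \<Longrightarrow> \<Delta> p \<in> Hom"
    and D_nilpotent: "p \<in> Hom \<Longrightarrow> \<exists>n. (\<Delta> ^^ n) p \<in> I"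
begin

lemma I_diff: "p \<in> I \<Longrightarrow> q \<in> I \<Longrightarrow> p - q \<in> I"
  using I_add[of p "- q"] I_uminus[of q] by simp

lemma I_mult_right: "p \<in> I \<Longrightarrow> q \<in> P \<Longrightarrow> p * q \<in> I"
  using I_mult[of q p] by (simp add: mult.commute)

lemma I_cong: "p - q \<in> I \<Longrightarrow> p \<in> I \<longleftrightarrow> q \<in> I"
  using I_add[of "p - q" q] I_diff[of p "p - q"] by auto

lemma D_iter_add: "(\<Delta> ^^ n) (p + q) = (\<Delta> ^^ n) p + (\<Delta> ^^ n) q"
  by (induction n) (simp_all add: D_add)

lemma D_0: "\<Delta> 0 = 0"
  using D_add[of 0 0] by simp

lemma D_uminus: "\<Delta> (- p) = - \<Delta> p"
  using D_add[of p "- p"] by (simp add: D_0 eq_neg_iff_add_eq_0 add.commute)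

lemma D_diff: "\<Delta> (p - q) = \<Delta> p - \<Delta> q"
  using D_add[of p "- q"] by (simp add: D_uminus)

lemma D_iter_diff: "(\<Delta> ^^ n) (p - q) = (\<Delta> ^^ n) p - (\<Delta> ^^ n) q"
  by (induction n) (simp_all add: D_diff)

lemma D_iter_I: "p \<in> I \<Longrightarrow> (\<Delta> ^^ n) p \<in> I"
  by (induction n) (simp_all add: D_I)

lemma D_iter_P: "p \<in> P \<Longrightarrow> (\<Delta> ^^ n) p \<in> P"
  by (induction n) (simp_all add: D_P)

lemma D_iter_Hom: "p \<in> Hom \<Longrightarrow> (\<Delta> ^^ n) p \<in> Hom"
  by (induction n) (simp_all add: D_Hom)

text \<open>Modulo \<open>I\<close> one term of the Leibniz expansion survives: in every other term
  some factor is differentiated too often. The induction peels off one derivative and merges the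
  coefficients by Pascal's rule.\<close>

lemma D_iter_mult:
  assumes "p \<in> P" "q \<in> P" "(\<Delta> ^^ Suc m) p \<in> I" "(\<Delta> ^^ Suc n) q \<in> I"
  shows "(\<Delta> ^^ (m + n)) (p * q) - of_nat ((m + n) choose m) * ((\<Delta> ^^ m) p * (\<Delta> ^^ n) q) \<in> I"
  using assms
proof (induction "m + n" arbitrary: m n p q)
  case 0
  then show ?case by (simp add: I_0)
next
  case (Suc s)
  \<comment> \<open>The two summands of Pascal's rule. For \<open>m = 0\<close> the element
    \<open>\<Delta> p\<close> is already in \<open>I\<close>, so its coefficient has to be 0,
    whereas \<open>s choose (m - 1)\<close> would be 1 by truncation.\<close>
  define c1 c2 where "c1 = (if m = 0 then 0 else s choose (m - 1))"
    and "c2 = (if n = 0 then 0 else s choose m)"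
  have A: "(\<Delta> ^^ s) (\<Delta> p * q) - of_nat c1 * ((\<Delta> ^^ m) p * (\<Delta> ^^ n) q) \<in> I"
  proof (cases m)
    case 0
    then show ?thesis
      using Suc.prems by (simp add: c1_def D_iter_I I_mult_right)
  next
    case (Suc m')
    then show ?thesis
      using Suc.hyps(1)[of m' n "\<Delta> p" q] Suc.prems Suc.hyps(2)
      by (simp add: c1_def D_P funpow_swap1)
  qed
  have B: "(\<Delta> ^^ s) (p * \<Delta> q) - of_nat c2 * ((\<Delta> ^^ m) p * (\<Delta> ^^ n) q) \<in> I"
  proof (cases n)
    case 0
    then show ?thesis
      using Suc.prems by (simp add: c2_def D_iter_I I_mult)
  next
    case (Suc n')
    then show ?thesis
      using Suc.hyps(1)[of m n' p "\<Delta> q"] Suc.prems Suc.hyps(2)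
      by (simp add: c2_def D_P funpow_swap1)
  qed
  have c: "(m + n) choose m = c1 + c2"
  proof (cases m)
    case (Suc m')
    show ?thesis
    proof (cases n)
      case 0
      then have "s = m'" using Suc \<open>Suc s = m + n\<close> by simp
      then show ?thesis using Suc 0 by (simp add: c1_def c2_def)
    next
      case (Suc n')
      then have "s = m' + n" "m + n = Suc s" using \<open>m = Suc m'\<close> \<open>Suc s = m + n\<close> by simp_all
      then show ?thesis using Suc \<open>m = Suc m'\<close> by (simp add: c1_def c2_def)
    qed
  qed (use Suc.hyps(2) in \<open>auto simp: c1_def c2_def\<close>)
  have "(\<Delta> ^^ (m + n)) (p * q) = (\<Delta> ^^ s) (\<Delta> p * q) + (\<Delta> ^^ s) (p * \<Delta> q)"
    by (simp flip: Suc.hyps(2) add: funpow_swap1 D_mult D_iter_add)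
  then show ?case
    using I_add[OF A B] by (simp add: c algebra_simps)
qed

text \<open>The degree function of a locally nilpotent derivation, taken modulo \<open>I\<close>. It
  is a relation because elements of \<open>I\<close> have no degree.\<close>

definition lnd_degree :: "'a \<Rightarrow> nat \<Rightarrow> bool" where
  "lnd_degree p n \<longleftrightarrow> (\<Delta> ^^ n) p \<notin> I \<and> (\<Delta> ^^ Suc n) p \<in> I"

lemma lnd_degree_exists:
  assumes "p \<in> Hom" "p \<notin> I"
  obtains n where "lnd_degree p n"
proof -
  define n where "n = (LEAST n. (\<Delta> ^^ n) p \<in> I)"
  have "(\<Delta> ^^ n) p \<in> I"
    unfolding n_def using D_nilpotent[OF assms(1)] by (rule LeastI_ex)
  moreover from this have "n \<noteq> 0"
    using assms(2) by (intro notI) simp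
  moreover have "(\<Delta> ^^ (n - 1)) p \<notin> I"
    using not_less_Least[of "n - 1" "\<lambda>n. (\<Delta> ^^ n) p \<in> I"] \<open>n \<noteq> 0\<close> by (simp flip: n_def)
  ultimately show ?thesis
    by (intro that[of "n - 1"]) (simp add: lnd_degree_def del: funpow.simps)
qed

lemma lnd_degree_unique:
  assumes "lnd_degree p m" "lnd_degree p n"
  shows "m = n"
proof -
  have "m' \<le> n'" if "lnd_degree p m'" "lnd_degree p n'" for m' n'
  proof (rule ccontr)
    assume "\<not> m' \<le> n'"
    then have "(\<Delta> ^^ m') p = (\<Delta> ^^ (m' - Suc n')) ((\<Delta> ^^ Suc n') p)"
      by (metis funpow_add comp_apply not_less_eq_eq le_add_diff_inverse2)
    then show False
      using that by (simp add: lnd_degree_def D_iter_I del: funpow.simps)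
  qed
  then show ?thesis
    using assms by (simp add: le_antisym)
qed

lemma lnd_degree_cong:
  assumes "p - q \<in> I" "lnd_degree p n"
  shows "lnd_degree q n"
  using assms I_cong[of "(\<Delta> ^^ m) p" "(\<Delta> ^^ m) q" for m] D_iter_I[of "p - q"]
  unfolding lnd_degree_def D_iter_diff by blast

text \<open>The top term is a binomial coefficient times a product of homogeneous elements outside
  \<open>I\<close>; \<open>Hom_prime\<close> and \<open>Hom_char\<close> keep it outside
  \<open>I\<close>, and one more derivative lands in \<open>I\<close>.\<close>

lemma lnd_degree_mult:
  assumes "p \<in> Hom" "q \<in> Hom" "lnd_degree p m" "lnd_degree q n"
  shows "lnd_degree (p * q) (m + n)"
proof -
  let ?b = "of_nat ((m + n) choose m) :: 'a"
  let ?r = "(\<Delta> ^^ m) p * (\<Delta> ^^ n) q"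
  have cong: "(\<Delta> ^^ (m + n)) (p * q) - ?b * ?r \<in> I"
    using assms Hom_P by (intro D_iter_mult) (auto simp: lnd_degree_def)
  have "?r \<in> Hom" "?r \<notin> I"
    using Hom_prime[of "(\<Delta> ^^ m) p" "(\<Delta> ^^ n) q"] assms
    by (auto simp: lnd_degree_def D_iter_Hom Hom_mult)
  then have "?b * ?r \<notin> I"
    using Hom_char[of ?r "(m + n) choose m"] by (metis binomial_eq_0_iff le_add1 not_less)
  then have "(\<Delta> ^^ (m + n)) (p * q) \<notin> I"
    using I_cong[OF cong] by simp
  moreover have "\<Delta> (?b * ?r) \<in> I"
  proof -
    have "\<Delta> (of_nat k * x) = of_nat k * \<Delta> x" for k x
      by (induction k) (simp_all add: D_0 D_add distrib_right)
    moreover have "\<Delta> ?r \<in> I"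
      unfolding D_mult using assms Hom_P
      by (intro I_add I_mult_right[of "\<Delta> _"] I_mult[of "(\<Delta> ^^ m) p"])
        (auto simp: lnd_degree_def intro!: D_iter_P)
    ultimately show ?thesis
      by (simp add: I_mult P_of_nat)
  qed
  then have "(\<Delta> ^^ Suc (m + n)) (p * q) \<in> I"
    using I_cong[of "\<Delta> ((\<Delta> ^^ (m + n)) (p * q))" "\<Delta> (?b * ?r)"] D_I[OF cong]
    by (simp add: D_diff)
  ultimately show ?thesis
    by (simp add: lnd_degree_def)
qed

lemma lnd_degree_D:
  assumes "p \<in> Hom" "\<Delta> p \<notin> I" "lnd_degree (\<Delta> p) n"
  shows "lnd_degree p (Suc n)"
  using assms unfolding lnd_degree_def by (simp add: funpow_swap1)

text \<open>Degrees are nonnegative and add up, so a product of degree 0 has factors of degree 0: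
  the kernel is factorially closed among homogeneous elements.\<close>

lemma kernel_factor:
  assumes "p \<in> Hom" "q \<in> Hom" "p * q \<notin> I" "\<Delta> (p * q) \<in> I"
  shows "\<Delta> p \<in> I"
proof -
  have "p \<notin> I" "q \<notin> I"
    using assms Hom_P by (auto intro: I_mult I_mult_right)
  then obtain m n where mn: "lnd_degree p m" "lnd_degree q n"
    using assms lnd_degree_exists by metis
  have "lnd_degree (p * q) 0"
    using assms by (simp add: lnd_degree_def)
  then have "m = 0"
    using lnd_degree_unique[OF _ lnd_degree_mult[OF assms(1,2) mn], of 0] by simp
  then show ?thesis
    using mn by (simp add: lnd_degree_def)
qed

text \<open>Otherwise \<open>\<Delta> p\<close> has degree one less than \<open>p\<close>, while a
  homogeneous multiple of \<open>p\<close> outside \<open>I\<close> has at least the degree of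
  \<open>p\<close>.\<close>

lemma kernel_if_divides:
  assumes "p \<in> Hom" "b \<in> Hom" "\<Delta> p - p * b \<in> I"
  shows "\<Delta> p \<in> I"
proof (rule ccontr)
  assume D: "\<Delta> p \<notin> I"
  then have "p \<notin> I" "p * b \<notin> I"
    using D_I I_cong[OF assms(3)] by auto
  then have "b \<notin> I"
    using I_mult[of p b] assms Hom_P by auto
  obtain n where n: "lnd_degree (\<Delta> p) n"
    using lnd_degree_exists D_Hom D assms(1) by blast
  obtain m where m: "lnd_degree b m"
    using lnd_degree_exists \<open>b \<notin> I\<close> assms(2) by blast
  have "lnd_degree (p * b) (Suc n + m)"
    using lnd_degree_mult lnd_degree_D n m D assms by blast
  then show False
    using lnd_degree_unique[OF lnd_degree_cong[OF assms(3) n]] by fastforce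
qed

text \<open>If neither were killed, deg p - 1 would be at least deg q and deg q - 1 at least deg p.
  This is what limits the exponents different from 1.\<close>

lemma kernel_if_divides_crosswise:
  assumes "p \<in> Hom" "q \<in> Hom" "b \<in> Hom" "c \<in> Hom"
    and "\<Delta> p - q * b \<in> I" "\<Delta> q - p * c \<in> I"
  shows "\<Delta> p \<in> I \<or> \<Delta> q \<in> I"
proof (rule ccontr)
  assume "\<not> ?thesis"
  then have D: "\<Delta> p \<notin> I" "\<Delta> q \<notin> I" by auto
  then have "b \<notin> I" "c \<notin> I"
    using I_cong[OF assms(5)] I_cong[OF assms(6)] I_mult[of q b] I_mult[of p c] assms Hom_P by auto
  then obtain k l where kl: "lnd_degree b k" "lnd_degree c l"
    using lnd_degree_exists assms by metis
  obtain m n where mn: "lnd_degree (\<Delta> p) m" "lnd_degree (\<Delta> q) n"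
    using lnd_degree_exists D_Hom D assms by metis
  have "lnd_degree (q * b) (Suc n + k)" "lnd_degree (p * c) (Suc m + l)"
    using lnd_degree_mult lnd_degree_D mn kl D assms by blast+
  then have "m = Suc n + k" "n = Suc m + l"
    using lnd_degree_unique lnd_degree_cong assms(5,6) mn by metis+
  then show False by simp
qed

end

section \<open>Polynomials modulo the relations, with both types in one notation\<close>

section \<open>Trinomial algebras\<close>

lemma mpoly_ring_simps [simp]:
  "carrier (mpoly_ring V) = polys V"
  "p \<otimes>\<^bsub>mpoly_ring V\<^esub> q = p * q" "p \<oplus>\<^bsub>mpoly_ring V\<^esub> q = p + q"
  "\<one>\<^bsub>mpoly_ring V\<^esub> = 1" "\<zero>\<^bsub>mpoly_ring V\<^esub> = 0"
  by (simp_all add: mpoly_ring_def polys_def)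

lemma cring_mpoly_ring: "cring (mpoly_ring V :: ('a, 'b::comm_ring_1) mpoly ring)"
proof (rule cringI)
  show "abelian_group (mpoly_ring V :: ('a, 'b) mpoly ring)"
  proof (rule abelian_groupI)
    fix p assume "p \<in> carrier (mpoly_ring V :: ('a, 'b) mpoly ring)"
    then show "\<exists>q\<in>carrier (mpoly_ring V). q \<oplus>\<^bsub>mpoly_ring V\<^esub> p = \<zero>\<^bsub>mpoly_ring V\<^esub>"
      by (intro bexI[of _ "- p"]) simp_all
  qed (simp_all add: algebra_simps)
  show "comm_monoid (mpoly_ring V :: ('a, 'b) mpoly ring)"
    by (intro comm_monoidI) (simp_all add: algebra_simps)
qed (simp_all add: algebra_simps)

lemma a_minus_mpoly_ring:
  fixes p :: "('a, 'b::comm_ring_1) mpoly"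
  assumes "p \<in> polys V" "q \<in> polys V"
  shows "p \<ominus>\<^bsub>mpoly_ring V\<^esub> q = p - q"
proof -
  interpret cring "mpoly_ring V :: ('a, 'b) mpoly ring" by (rule cring_mpoly_ring)
  have "\<ominus>\<^bsub>mpoly_ring V\<^esub> q = - q"
    using minus_equality[of "- q" q] assms by simp
  then show ?thesis
    by (simp add: a_minus_def)
qed

text \<open>The block of \<open>Sv k\<close> is a dummy value: \<open>lvar\<close> is 0 there, so
  \<open>z (blk v) * int (lvar D v)\<close> vanishes on the S-variables.\<close>

fun blk :: "trinomial_var \<Rightarrow> nat" where
  "blk (Tv i j) = i"
| "blk (Sv k) = 0"

fun lvar :: "'k trinomial_data \<Rightarrow> trinomial_var \<Rightarrow> nat" where
  "lvar D (Tv i j) = tri_l D i j"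
| "lvar D (Sv k) = 0"

definition homogenizing :: "'k trinomial_data \<Rightarrow> bool" where
  "homogenizing D \<longleftrightarrow> (case tri_A D of Type1 _ \<Rightarrow> False | Type2 _ \<Rightarrow> True)"

text \<open>Both types as one matrix with two rows, the second being \<open>column2\<close>: modulo
  the relations T_i^{l_i} is \<open>column1\<close> times \<open>base1\<close> plus
  \<open>column2\<close> times \<open>base2\<close>. In type 1 all T_i^{l_i} + a_i agree, which
  gives the columns (1, -a_i) with \<open>base2 = 1\<close>.\<close>

fun column1 :: "'k::field coeff_matrix \<Rightarrow> nat \<Rightarrow> 'k" where
  "column1 (Type1 a) i = 1"
| "column1 (Type2 a) i = a i $ 1"

fun column2 :: "'k::field coeff_matrix \<Rightarrow> nat \<Rightarrow> 'k" where
  "column2 (Type1 a) i = - a i"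
| "column2 (Type2 a) i = a i $ 2"

locale trinomial =
  fixes D :: "'k::{alg_closed_field, field_char_0} trinomial_data"
  assumes data: "trinomial_data D"
begin

abbreviation V where "V \<equiv> tri_vars D"
abbreviation I where "I \<equiv> tri_ideal D"
abbreviation R where "R \<equiv> trinomial_algebra D"
abbreviation \<pi> where "\<pi> \<equiv> tri_class D"
abbreviation idx where "idx \<equiv> tri_idx D"
abbreviation n where "n \<equiv> tri_n D"
abbreviation l where "l \<equiv> tri_l D"
abbreviation Y where "Y \<equiv> T_monomial D"
abbreviation a1 where "a1 \<equiv> column1 (tri_A D)"
abbreviation a2 where "a2 \<equiv> column2 (tri_A D)"

lemma n_pos: "i \<in> idx \<Longrightarrow> n i > 0"
  and l_pos: "i \<in> idx \<Longrightarrow> j \<in> {1..n i} \<Longrightarrow> l i j > 0"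
  and r_pos: "tri_r D > 0"
  using data by (auto simp: trinomial_data_def)

lemma finite_V: "finite V"
proof -
  have "V = (\<lambda>(i, j). Tv i j) ` (SIGMA i:idx. {1..n i}) \<union> Sv ` {1..tri_m D}"
    by (auto simp: tri_vars_def image_iff)
  then show ?thesis by simp
qed

lemma Tv_V [simp]: "Tv i j \<in> V \<longleftrightarrow> i \<in> idx \<and> j \<in> {1..n i}"
  and Sv_V [simp]: "Sv k \<in> V \<longleftrightarrow> k \<in> {1..tri_m D}"
  by (auto simp: tri_vars_def)

lemma columns_independent:
  assumes "i \<in> idx" "j \<in> idx" "i \<noteq> j"
  shows "a1 i * a2 j - a1 j * a2 i \<noteq> 0"
proof (cases "tri_A D")
  case (Type1 a)
  then have "inj_on a {1..tri_r D}" "i \<in> {1..tri_r D}" "j \<in> {1..tri_r D}"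
    using data assms by (simp_all add: trinomial_data_def tri_iota_def)
  then have "a i \<noteq> a j"
    using assms(3) inj_onD by metis
  then show ?thesis
    by (simp add: Type1)
next
  case (Type2 a)
  have ind: "a i \<noteq> a j" "vec.independent {a i, a j}"
    using data assms Type2 by (simp_all add: trinomial_data_def tri_iota_def)
  show ?thesis
  proof
    assume "a1 i * a2 j - a1 j * a2 i = 0"
    then have eq: "a i $ 1 * a j $ 2 = a j $ 1 * a i $ 2"
      by (simp add: Type2)
    \<comment> \<open>Independence speaks of a set of vectors; distinctness of the two columns turns
      it into a statement about a pair of coefficients.\<close>
    have coeff0: "c = 0 \<and> d = 0" if "c *s a i + d *s a j = 0" for c d
    proof -
      have "(\<Sum>v\<in>{a i, a j}. (if v = a i then c else d) *s v) = 0"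
        using that ind(1) by simp
      then have "(if v = a i then c else d) = 0" if "v \<in> {a i, a j}" for v
        using vec.independentD[OF ind(2), of "{a i, a j}" "\<lambda>v. if v = a i then c else d" v] that
        by blast
      from this[of "a i"] this[of "a j"] show ?thesis
        using ind(1) by (auto split: if_splits)
    qed
    \<comment> \<open>A vanishing minor gives one linear relation for each coordinate of
      \<open>a j\<close>. If both are trivial, then \<open>a j = 0\<close>, which is itself a
      nontrivial relation.\<close>
    have "(a j $ 1) *s a i + (- (a i $ 1)) *s a j = 0" "(a j $ 2) *s a i + (- (a i $ 2)) *s a j = 0"
      using eq by (simp_all add: vec_eq_iff forall_2 mult.commute)
    then have "a j $ 1 = 0" "a j $ 2 = 0"
      using coeff0 by blast+
    then have "0 *s a i + 1 *s a j = 0"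
      by (simp add: vec_eq_iff forall_2)
    then show False
      using coeff0 by (metis zero_neq_one)
  qed
qed

subsection \<open>The ideal of relations\<close>

lemma Y_polys [simp]: "i \<in> idx \<Longrightarrow> Y i \<in> polys V"
  unfolding T_monomial_def by (intro polys_prod polys_power polys_Var) simp

lemma relations_Type1: "tri_A D = Type1 a \<Longrightarrow>
    tri_relations D = {Y i - Y (i+1) - Const (a (i+1) - a i) | i. 1 \<le> i \<and> i + 1 \<le> tri_r D}"
  by (simp add: tri_relations_def)

lemma relations_Type2: "tri_A D = Type2 a \<Longrightarrow>
    tri_relations D = {Y i * Const (a1 (i+1) * a2 (i+2) - a1 (i+2) * a2 (i+1))
      - Y (i+1) * Const (a1 i * a2 (i+2) - a1 (i+2) * a2 i)
      + Y (i+2) * Const (a1 i * a2 (i+1) - a1 (i+1) * a2 i) | i. i + 2 \<le> tri_r D}"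
proof -
  assume A: "tri_A D = Type2 a"
  have det: "det (vector [vector [x, y, z], vector [Const b1, Const b2, Const b3],
        vector [Const c1, Const c2, Const c3]] :: (trinomial_var, 'k) mpoly^3^3) =
      x * Const (b2 * c3 - b3 * c2) - y * Const (b1 * c3 - b3 * c1) + z * Const (b1 * c2 - b2 * c1)"
    for x y z b1 b2 b3 c1 c2 c3
    unfolding det_3 vector_3 Const_diff Const_mult by (simp only: algebra_simps)
  show ?thesis
    unfolding tri_relations_def A coeff_matrix.case det column1.simps column2.simps ..
qed

lemma idx_Type1: "tri_A D = Type1 a \<Longrightarrow> idx = {1..tri_r D}"
  by (simp add: tri_iota_def)

lemma idx_Type2: "tri_A D = Type2 a \<Longrightarrow> idx = {0..tri_r D}"
  by (simp add: tri_iota_def)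

lemma relations_polys: "tri_relations D \<subseteq> polys V"
proof (cases "tri_A D")
  case (Type1 a)
  then show ?thesis
    using relations_Type1[OF Type1] idx_Type1[OF Type1] by auto
next
  case (Type2 a)
  then show ?thesis
    using relations_Type2[OF Type2] idx_Type2[OF Type2] by auto
qed

lemma ideal_I: "ideal I (mpoly_ring V)"
  unfolding tri_ideal_def
  by (rule ring.genideal_ideal[OF cring.axioms(1)[OF cring_mpoly_ring]])
    (simp add: relations_polys)

lemma relations_I: "tri_relations D \<subseteq> I"
  unfolding tri_ideal_def
  by (rule ring.genideal_self[OF cring.axioms(1)[OF cring_mpoly_ring]])
    (simp add: relations_polys)

lemma I_polys: "p \<in> I \<Longrightarrow> p \<in> polys V"
  using ideal.Icarr[OF ideal_I] by simp

lemma I_0 [simp]: "0 \<in> I"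
  using additive_subgroup.zero_closed[OF ideal.axioms(1)[OF ideal_I]] by simp

lemma I_add: "p \<in> I \<Longrightarrow> q \<in> I \<Longrightarrow> p + q \<in> I"
  using additive_subgroup.a_closed[OF ideal.axioms(1)[OF ideal_I]] by simp

lemma I_mult: "p \<in> polys V \<Longrightarrow> q \<in> I \<Longrightarrow> p * q \<in> I"
  using ideal.I_l_closed[OF ideal_I] by simp

lemma I_mult_right: "q \<in> I \<Longrightarrow> p \<in> polys V \<Longrightarrow> q * p \<in> I"
  using I_mult[of p q] by (simp add: mult.commute)

lemma I_uminus: "p \<in> I \<Longrightarrow> - p \<in> I"
  using I_mult[of "- 1" p] by (simp add: polys_uminus del: mult_minus1)

lemma I_diff: "p \<in> I \<Longrightarrow> q \<in> I \<Longrightarrow> p - q \<in> I"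
  using I_add[of p "- q"] I_uminus[of q] by simp

lemma I_sum: "(\<And>i. i \<in> A \<Longrightarrow> f i \<in> I) \<Longrightarrow> sum f A \<in> I"
  by (induction A rule: infinite_finite_induct) (auto intro: I_add)

lemma I_cong: "p - q \<in> I \<Longrightarrow> p \<in> I \<longleftrightarrow> q \<in> I"
  using I_add[of "p - q" q] I_diff[of p "p - q"] by auto

lemma I_trans: "p - q \<in> I \<Longrightarrow> q - s \<in> I \<Longrightarrow> p - s \<in> I"
  using I_add[of "p - q" "q - s"] by simp

lemma I_mult_cong:
  assumes "p - p' \<in> I" "q - q' \<in> I" "p \<in> polys V" "q' \<in> polys V"
  shows "p * q - p' * q' \<in> I"
proof -
  have "p * (q - q') + (p - p') * q' \<in> I"
    using assms by (intro I_add I_mult I_mult_right)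
  then show ?thesis
    by (simp add: algebra_simps)
qed

text \<open>The polynomials with property \<open>P\<close> form an ideal, negatives coming from
  multiplication by -1, and \<open>I\<close> is the least ideal containing the relations.\<close>

lemma I_induct [consumes 1, case_names relation zero add mult]:
  assumes "p \<in> I" "\<And>g. g \<in> tri_relations D \<Longrightarrow> P g" "P 0"
    and "\<And>p q. P p \<Longrightarrow> P q \<Longrightarrow> p \<in> polys V \<Longrightarrow> q \<in> polys V \<Longrightarrow> P (p + q)"
    and mult: "\<And>p q. P p \<Longrightarrow> p \<in> polys V \<Longrightarrow> q \<in> polys V \<Longrightarrow> P (q * p)"
  shows "P p"
proof -
  interpret cring "mpoly_ring V :: (trinomial_var, 'k) mpoly ring" by (rule cring_mpoly_ring)
  let ?J = "{p \<in> polys V. P p}"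
  have uminus: "P (- p)" if "P p" "p \<in> polys V" for p
    using mult[of p "- 1"] that by (simp add: polys_uminus del: mult_minus1)
  have inv: "\<ominus>\<^bsub>mpoly_ring V\<^esub> p = - p" if "p \<in> polys V" for p :: "(trinomial_var, 'k) mpoly"
    using that minus_equality[of "- p" p] by simp
  have "ideal ?J (mpoly_ring V)"
  proof (rule idealI)
    show "subgroup ?J (add_monoid (mpoly_ring V))"
      using assms uminus by (intro add.subgroupI) (auto simp: inv intro: exI[of _ 0])
  qed (use mult in \<open>auto simp: ring_axioms mult.commute\<close>)
  then have "I \<subseteq> ?J"
    unfolding tri_ideal_def using relations_polys assms(2) by (intro genideal_minimal) auto
  then show ?thesis
    using assms(1) by auto
qed

subsection \<open>The quotient algebra\<close>

lemma class_eq_iff: "p \<in> polys V \<Longrightarrow> q \<in> polys V \<Longrightarrow> \<pi> p = \<pi> q \<longleftrightarrow> p - q \<in> I"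
  unfolding tri_class_def
  using ring.quotient_eq_iff_same_a_r_cos[OF cring.axioms(1)[OF cring_mpoly_ring] ideal_I, of p q]
  by (simp add: a_minus_mpoly_ring)

lemma carrier_R: "carrier R = \<pi> ` polys V"
  by (auto simp: trinomial_algebra_def Let_def FactRing_def A_RCOSETS_def RCOSETS_def
      tri_class_def a_r_coset_def)

lemma class_carrier [simp]: "p \<in> polys V \<Longrightarrow> \<pi> p \<in> carrier R"
  by (simp add: carrier_R)

lemma class_add: "p \<in> polys V \<Longrightarrow> q \<in> polys V \<Longrightarrow> \<pi> p \<oplus>\<^bsub>R\<^esub> \<pi> q = \<pi> (p + q)"
  unfolding trinomial_algebra_def Let_def tri_class_def
  using ideal.a_rcos_sum[OF ideal_I, of p q] by (simp add: FactRing_def)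

lemma class_mult: "p \<in> polys V \<Longrightarrow> q \<in> polys V \<Longrightarrow> \<pi> p \<otimes>\<^bsub>R\<^esub> \<pi> q = \<pi> (p * q)"
  unfolding trinomial_algebra_def Let_def tri_class_def
  using ideal.rcoset_mult_add[OF ideal_I, of p q] by (simp add: FactRing_def)

lemma class_smult: "p \<in> polys V \<Longrightarrow> c \<odot>\<^bsub>R\<^esub> \<pi> p = \<pi> (Const c * p)"
  using class_mult[of "Const c" p] by (simp add: trinomial_algebra_def Let_def)

lemma zero_R: "\<zero>\<^bsub>R\<^esub> = \<pi> 0"
proof -
  have "\<zero>\<^bsub>R\<^esub> = I"
    by (simp add: trinomial_algebra_def Let_def FactRing_def)
  moreover have "\<pi> 0 = I"
    unfolding tri_class_def
    using ring.a_rcos_zero[OF cring.axioms(1)[OF cring_mpoly_ring] ideal_I I_0] by simp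
  ultimately show ?thesis by simp
qed

lemma class_eq_zero_iff: "p \<in> polys V \<Longrightarrow> \<pi> p = \<zero>\<^bsub>R\<^esub> \<longleftrightarrow> p \<in> I"
  by (simp add: zero_R class_eq_iff)

end

subsection \<open>Degrees\<close>

text \<open>Degrees are represented by integer vectors modulo the lattice described by \<open>lat\<close>; the
  coordinates \<open>z\<close> are one per block, with coordinate sum zero in type 2.\<close>

definition ivec :: "('v \<Rightarrow>\<^sub>0 nat) \<Rightarrow> 'v \<Rightarrow> int" where
  "ivec \<mu> = (\<lambda>v. int (lookup \<mu> v))"

definition unit_vec :: "'v \<Rightarrow> 'v \<Rightarrow> int" where
  "unit_vec v = (\<lambda>w. if w = v then 1 else 0)"

definition scale :: "nat \<Rightarrow> ('v \<Rightarrow> int) \<Rightarrow> 'v \<Rightarrow> int" where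
  "scale e u = (\<lambda>v. int e * u v)"

lemma scale_0 [simp]: "scale 0 u = 0"
  and scale_Suc: "scale (Suc e) u = u + scale e u"
  by (auto simp: scale_def fun_eq_iff algebra_simps)

lemma ivec_add: "ivec (\<mu> + \<nu>) = ivec \<mu> + ivec \<nu>"
  by (simp add: ivec_def lookup_add fun_eq_iff)

lemma ivec_0 [simp]: "ivec 0 = 0"
  by (simp add: ivec_def fun_eq_iff)

lemma ivec_single_1 [simp]: "ivec (single v (Suc 0)) = unit_vec v"
  by (auto simp: ivec_def unit_vec_def lookup_single fun_eq_iff)

context trinomial
begin

definition lat :: "(trinomial_var \<Rightarrow> int) \<Rightarrow> bool" where
  "lat u \<longleftrightarrow> (\<exists>z. (homogenizing D \<longrightarrow> (\<Sum>i\<in>idx. z i) = 0) \<and>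
     (\<forall>v\<in>V. u v = z (blk v) * int (lvar D v)))"

lemma lat_0 [simp]: "lat 0"
  unfolding lat_def by (intro exI[of _ "\<lambda>_. 0"]) simp

lemma lat_add: "lat u \<Longrightarrow> lat u' \<Longrightarrow> lat (u + u')"
proof -
  assume "lat u" "lat u'"
  then obtain z z' where "homogenizing D \<longrightarrow> (\<Sum>i\<in>idx. z i) = 0" "homogenizing D \<longrightarrow> (\<Sum>i\<in>idx. z' i) = 0"
    "\<forall>v\<in>V. u v = z (blk v) * int (lvar D v)" "\<forall>v\<in>V. u' v = z' (blk v) * int (lvar D v)"
    unfolding lat_def by blast
  then show ?thesis
    unfolding lat_def
    by (intro exI[of _ "\<lambda>i. z i + z' i"]) (simp add: sum.distrib distrib_right)
qed

lemma lat_uminus: "lat u \<Longrightarrow> lat (- u)"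
proof -
  assume "lat u"
  then obtain z where "homogenizing D \<longrightarrow> (\<Sum>i\<in>idx. z i) = 0" "\<forall>v\<in>V. u v = z (blk v) * int (lvar D v)"
    unfolding lat_def by blast
  then show ?thesis
    unfolding lat_def by (intro exI[of _ "\<lambda>i. - z i"]) (simp add: sum_negf)
qed

lemma lat_diff: "lat u \<Longrightarrow> lat u' \<Longrightarrow> lat (u - u')"
  using lat_add[of u "- u'"] lat_uminus[of u'] by simp

text \<open>A homogeneous component lifted to polynomials. The index \<open>u\<close> is any integer
  vector representing the degree: by \<open>H_cong\<close> the representative is immaterial, and its
  values outside \<open>V\<close> do not count.\<close>

definition H :: "(trinomial_var \<Rightarrow> int) \<Rightarrow> (trinomial_var, 'k) mpoly set" where
  "H u = {p \<in> polys V. \<forall>\<mu>\<in>keys p. lat (ivec \<mu> - u)}"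

lemma H_polys: "p \<in> H u \<Longrightarrow> p \<in> polys V"
  by (simp add: H_def)

lemma H_lat: "p \<in> H u \<Longrightarrow> \<mu> \<in> keys p \<Longrightarrow> lat (ivec \<mu> - u)"
  by (simp add: H_def)

lemma H_0 [simp]: "0 \<in> H u"
  by (simp add: H_def)

lemma H_add: "p \<in> H u \<Longrightarrow> q \<in> H u \<Longrightarrow> p + q \<in> H u"
  using Poly_Mapping.keys_add[of p q] by (auto simp: H_def)

lemma H_uminus: "p \<in> H u \<Longrightarrow> - p \<in> H u"
  by (simp add: H_def keys_uminus_mpoly)

lemma H_diff: "p \<in> H u \<Longrightarrow> q \<in> H u \<Longrightarrow> p - q \<in> H u"
  using H_add[of p u "- q"] H_uminus by simp

lemma H_sum: "(\<And>i. i \<in> A \<Longrightarrow> f i \<in> H u) \<Longrightarrow> sum f A \<in> H u"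
  by (induction A rule: infinite_finite_induct) (auto intro: H_add)

lemma H_mult: "p \<in> H u \<Longrightarrow> q \<in> H u' \<Longrightarrow> p * q \<in> H (u + u')"
proof -
  assume *: "p \<in> H u" "q \<in> H u'"
  have "lat (ivec \<mu> - (u + u'))" if "\<mu> \<in> keys (p * q)" for \<mu>
  proof -
    from that obtain a b where ab: "\<mu> = a + b" "a \<in> keys p" "b \<in> keys q"
      using keys_mult[of p q] by blast
    then have "lat ((ivec a - u) + (ivec b - u'))"
      using * by (intro lat_add) (auto simp: H_def)
    also have "(ivec a - u) + (ivec b - u') = ivec \<mu> - (u + u')"
      by (simp add: ab ivec_add algebra_simps)
    finally show ?thesis .
  qed
  then show ?thesis
    using * by (simp add: H_def)
qed

lemma H_cong: "lat (u - u') \<Longrightarrow> p \<in> H u \<Longrightarrow> p \<in> H u'"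
proof -
  assume *: "lat (u - u')" "p \<in> H u"
  then have "lat ((ivec \<mu> - u) + (u - u'))" if "\<mu> \<in> keys p" for \<mu>
    using that by (intro lat_add) (auto simp: H_def)
  then show ?thesis
    using * by (simp add: H_def algebra_simps)
qed

lemma H_mon: "keys m \<subseteq> V \<Longrightarrow> mon m \<in> H (ivec m)"
  by (simp add: H_def polys_single)

lemma H_single: "keys m \<subseteq> V \<Longrightarrow> single m c \<in> H (ivec m)"
  by (simp add: H_def polys_single)

lemma H_Const [simp]: "Const c \<in> H 0"
  unfolding Const_def using H_single[of 0] by simp

lemma H_1 [simp]: "1 \<in> H 0"
  using H_Const[of 1] by simp

lemma H_Var: "v \<in> V \<Longrightarrow> Var v \<in> H (unit_vec v)"
  unfolding Var_def using H_mon[of "single v 1"] by simp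

lemma H_Const_mult: "p \<in> H u \<Longrightarrow> Const c * p \<in> H u"
  using H_mult[OF H_Const] by fastforce

lemma H_power: "p \<in> H u \<Longrightarrow> p ^ e \<in> H (scale e u)"
  by (induction e) (auto simp: scale_Suc intro: H_mult)

lemma ivec_minus_single:
  assumes "lookup \<mu> v \<noteq> 0"
  shows "ivec (\<mu> - single v 1) = ivec \<mu> - unit_vec v"
  using assms by (auto simp: ivec_def unit_vec_def lookup_minus lookup_single fun_eq_iff when_def of_nat_diff)

lemma H_pdiff: "p \<in> H u \<Longrightarrow> pdiff v p \<in> H (u - unit_vec v)"
  unfolding pdiff_def
proof (rule H_sum)
  fix \<mu> assume p: "p \<in> H u" and \<mu>: "\<mu> \<in> keys p"
  let ?q = "single (\<mu> - single v 1) (of_nat (lookup \<mu> v) * lookup p \<mu>)"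
  show "?q \<in> H (u - unit_vec v)"
  proof (cases "lookup \<mu> v = 0")
    case False
    have "keys (\<mu> - single v 1) \<subseteq> keys \<mu>"
      by (auto simp: in_keys_iff lookup_minus)
    also have "\<dots> \<subseteq> V"
      using p \<mu> by (auto simp: H_def polys_def)
    finally have "?q \<in> H (ivec \<mu> - unit_vec v)"
      using H_single ivec_minus_single[OF False] by metis
    moreover have "lat (ivec \<mu> - unit_vec v - (u - unit_vec v))"
      using p \<mu> by (simp add: H_def)
    ultimately show ?thesis
      by (rule H_cong[rotated])
  qed simp
qed

lemma H_vfield:
  assumes "\<And>v. v \<in> V \<Longrightarrow> f v \<in> H (unit_vec v + d)" "p \<in> H u"
  shows "vfield V f p \<in> H (u + d)"
  unfolding vfield_def
proof (rule H_sum)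
  fix v assume "v \<in> V"
  then have "f v * pdiff v p \<in> H ((unit_vec v + d) + (u - unit_vec v))"
    by (intro H_mult H_pdiff assms)
  then show "f v * pdiff v p \<in> H (u + d)"
    by (simp add: algebra_simps)
qed

subsection \<open>Reduced monomials\<close>

definition L :: "nat \<Rightarrow> trinomial_var \<Rightarrow>\<^sub>0 nat" where
  "L i = (\<Sum>j\<in>{1..n i}. single (Tv i j) (l i j))"

text \<open>Exponent vector of the product of the k_i-th powers of the T_i^{l_i}.\<close>

definition comb :: "(nat \<Rightarrow> nat) \<Rightarrow> trinomial_var \<Rightarrow>\<^sub>0 nat" where
  "comb k = (\<Sum>i\<in>idx. \<Sum>j\<in>{1..n i}. single (Tv i j) (k i * l i j))"

lemma lookup_L: "i \<in> idx \<Longrightarrow> lookup (L i) v = (if v \<in> V \<and> blk v = i then lvar D v else 0)"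
  by (cases v) (auto simp: L_def lookup_sum lookup_single when_def sum.delta')

lemma lookup_comb: "lookup (comb k) v = (if v \<in> V then k (blk v) * lvar D v else 0)"
proof (cases v)
  case (Tv i j)
  have "(\<Sum>j'\<in>{1..n i'}. lookup (single (Tv i' j') (k i' * l i' j')) v) =
      (if i' = i then if j \<in> {1..n i} then k i * l i j else 0 else 0)" for i'
    by (auto simp: Tv lookup_single when_def sum.delta')
  then show ?thesis
    by (simp add: comb_def lookup_sum Tv sum.delta')
qed (simp add: comb_def lookup_sum lookup_single)

lemma Y_eq_mon: "Y i = mon (L i)"
  by (simp add: T_monomial_def L_def mon_sum Var_power)

lemma pdiff_Y_other: "i \<in> idx \<Longrightarrow> v \<in> V \<Longrightarrow> blk v \<noteq> i \<or> lvar D v = 0 \<Longrightarrow> pdiff v (Y i) = 0"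
  by (auto simp: Y_eq_mon pdiff_single lookup_L)

lemma Y_power: "Y i ^ k = mon (\<Sum>j\<in>{1..n i}. single (Tv i j) (k * l i j))"
  by (simp add: T_monomial_def mon_sum prod_power_distrib mult.commute[of k] power_mult
      flip: Var_power)

lemma mon_comb: "mon (comb k) = (\<Prod>i\<in>idx. Y i ^ k i)"
  by (simp add: comb_def mon_sum Y_power)

lemma keys_L: "i \<in> idx \<Longrightarrow> keys (L i) \<subseteq> V"
  by (auto simp: in_keys_iff lookup_L split: if_splits)

text \<open>The common degree of all T_i^{l_i}; by \<open>lat_L\<close> any block could represent
  it, and the first one is taken.\<close>

definition wdeg :: "trinomial_var \<Rightarrow> int" where
  "wdeg = ivec (L (tri_iota D))"

lemma iota_idx [simp]: "tri_iota D \<in> idx"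
  using r_pos by (auto simp: tri_iota_def split: coeff_matrix.splits)

lemma lat_comb:
  assumes "homogenizing D \<longrightarrow> (\<Sum>i\<in>idx. k i) = e"
  shows "lat (ivec (comb k) - scale e wdeg)"
  unfolding lat_def
\<comment> \<open>Trading e copies of the first block for the blocks counted by \<open>k\<close>
  subtracts e from the first coordinate; the coordinates then sum to 0 since the k_i add up to
  e.\<close>
proof (intro exI[of _ "\<lambda>i. int (k i) - (if i = tri_iota D then int e else 0)"] conjI impI ballI)
  assume "homogenizing D"
  then have "(\<Sum>i\<in>idx. int (k i)) = int e"
    using assms by (metis of_nat_sum)
  then show "(\<Sum>i\<in>idx. int (k i) - (if i = tri_iota D then int e else 0)) = 0"
    using iota_idx by (simp only: sum_subtractf sum.delta finite_atLeastAtMost) simp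
next
  fix v assume "v \<in> V"
  then show "(ivec (comb k) - scale e wdeg) v =
      (int (k (blk v)) - (if blk v = tri_iota D then int e else 0)) * int (lvar D v)"
    by (simp add: ivec_def scale_def wdeg_def lookup_comb lookup_L[OF iota_idx] algebra_simps
        del: atLeastAtMost_iff)
qed

lemma lat_L: "i \<in> idx \<Longrightarrow> lat (ivec (L i) - wdeg)"
proof -
  assume i: "i \<in> idx"
  have "L i = comb (\<lambda>k. if k = i then 1 else 0)"
    by (rule poly_mapping_eqI) (simp add: lookup_L[OF i] lookup_comb)
  moreover have "(\<Sum>k\<in>idx. if k = i then 1 else 0) = (1::nat)"
    using i by (simp add: sum.delta' del: atLeastAtMost_iff)
  ultimately show ?thesis
    using lat_comb[of "\<lambda>k. if k = i then 1 else 0" 1] by (simp add: scale_def)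
qed

lemma H_Y: "i \<in> idx \<Longrightarrow> Y i \<in> H wdeg"
  unfolding Y_eq_mon using H_cong[OF lat_L H_mon[OF keys_L]] by blast

text \<open>Without a constraint on the coordinate sum a single block already lies in the lattice,
  so in type 1 the T_i^{l_i} have the degree of constants.\<close>

lemma lat_wdeg_Type1: "\<not> homogenizing D \<Longrightarrow> lat wdeg"
  using lat_comb[of "\<lambda>_. 0" 1] lat_uminus[of "- wdeg"]
  by (simp add: scale_def comb_def)

definition reduced :: "(trinomial_var \<Rightarrow>\<^sub>0 nat) \<Rightarrow> bool" where
  "reduced m \<longleftrightarrow> keys m \<subseteq> V \<and> (\<forall>i\<in>idx. \<exists>j\<in>{1..n i}. lookup m (Tv i j) < l i j)"

lemma reduced_exists:
  assumes "keys \<mu> \<subseteq> V"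
  obtains m k where "reduced m" "\<mu> = m + comb k"
proof -
  \<comment> \<open>The largest power of T_i^{l_i} dividing the monomial. Where the minimum is
    attained, the remaining exponent is a remainder modulo l_ij.\<close>
  define k where "k = (\<lambda>i. Min ((\<lambda>j. lookup \<mu> (Tv i j) div l i j) ` {1..n i}))"
  have le: "lookup (comb k) v \<le> lookup \<mu> v" for v
  proof (cases v)
    case (Tv i j)
    show ?thesis
    proof (cases "v \<in> V")
      case True
      then have "k i \<le> lookup \<mu> v div l i j"
        unfolding k_def Tv by (intro Min_le) auto
      then have "k i * l i j \<le> lookup \<mu> v div l i j * l i j"
        by simp
      also have "\<dots> \<le> lookup \<mu> v" by simp
      finally show ?thesis
        using True by (simp add: lookup_comb Tv)
    qed (simp add: lookup_comb)
  qed (simp add: lookup_comb)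
  have \<mu>: "\<mu> = (\<mu> - comb k) + comb k"
    by (rule poly_mapping_eqI) (simp add: lookup_add lookup_minus le)
  have "reduced (\<mu> - comb k)"
    unfolding reduced_def
  proof (intro conjI ballI)
    show "keys (\<mu> - comb k) \<subseteq> V"
      using assms by (auto simp: in_keys_iff lookup_minus)
    fix i assume i: "i \<in> idx"
    have "k i \<in> (\<lambda>j. lookup \<mu> (Tv i j) div l i j) ` {1..n i}"
      unfolding k_def using n_pos[OF i] by (intro Min_in) auto
    then obtain j where j: "j \<in> {1..n i}" "k i = lookup \<mu> (Tv i j) div l i j"
      by blast
    then have "lookup (\<mu> - comb k) (Tv i j) = lookup \<mu> (Tv i j) mod l i j"
      using i by (simp add: lookup_minus lookup_comb minus_div_mult_eq_mod)
    also have "\<dots> < l i j"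
      using l_pos i j by simp
    finally show "\<exists>j\<in>{1..n i}. lookup (\<mu> - comb k) (Tv i j) < l i j"
      using j by blast
  qed
  then show ?thesis
    using \<mu> that by blast
qed

text \<open>At a variable whose exponent in \<open>m\<close> is below l_ij, a negative coordinate
  would make the exponent of \<open>\<mu>\<close> negative. So a monomial of the same degree up to
  \<open>wdeg\<close> is \<open>m\<close> times powers of the T_i^{l_i}.\<close>

lemma reduced_decomp:
  assumes "reduced m" "keys \<mu> \<subseteq> V" "\<And>v. v \<in> V \<Longrightarrow> ivec \<mu> v - ivec m v = z (blk v) * int (lvar D v)"
  shows "\<mu> = m + comb (\<lambda>i. nat (z i))" "\<And>i. i \<in> idx \<Longrightarrow> z i \<ge> 0"
proof -
  show z: "z i \<ge> 0" if i: "i \<in> idx" for i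
  proof (rule ccontr)
    assume neg: "\<not> z i \<ge> 0"
    obtain j where j: "j \<in> {1..n i}" "lookup m (Tv i j) < l i j"
      using assms(1) i unfolding reduced_def by blast
    then have "ivec \<mu> (Tv i j) - ivec m (Tv i j) = z i * int (l i j)"
      using assms(3)[of "Tv i j"] i by simp
    moreover have "z i * int (l i j) \<le> (- 1) * int (l i j)"
      using neg by (intro mult_right_mono) auto
    ultimately show False
      using j(2) by (simp add: ivec_def)
  qed
  show "\<mu> = m + comb (\<lambda>i. nat (z i))"
  proof (rule poly_mapping_eqI)
    fix v
    show "lookup \<mu> v = lookup (m + comb (\<lambda>i. nat (z i))) v"
    proof (cases "v \<in> V")
      case True
      have "int (lookup \<mu> v) = int (lookup m v) + z (blk v) * int (lvar D v)"
        using assms(3)[OF True] by (simp add: ivec_def)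
      also have "z (blk v) * int (lvar D v) = int (nat (z (blk v)) * lvar D v)"
        using True z by (cases v) auto
      finally have "lookup \<mu> v = lookup m v + nat (z (blk v)) * lvar D v"
        unfolding of_nat_add[symmetric] of_nat_eq_iff .
      then show ?thesis
        using True by (simp add: lookup_add lookup_comb)
    next
      case False
      then have "lookup \<mu> v = 0" "lookup m v = 0"
        using assms(1,2) by (auto simp: reduced_def in_keys_iff)
      then show ?thesis
        using False by (simp add: lookup_add lookup_comb)
    qed
  qed
qed

text \<open>A set \<open>S\<close> instead of one polynomial, because the derivatives of the two
  basis members are later compared over the same \<open>m\<close> and \<open>e\<close>. In type 1
  the degree does not see the number of factors T_i^{l_i}, so \<open>e\<close> is only a
  bound.\<close>

lemma common_reduced:
  assumes "finite S" "S \<subseteq> H u" "p0 \<in> S" "p0 \<noteq> 0"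
  obtains m e where "reduced m" "lat (ivec m + scale e wdeg - u)"
    "\<And>p \<mu>. p \<in> S \<Longrightarrow> \<mu> \<in> keys p \<Longrightarrow>
      \<exists>k. \<mu> = m + comb k \<and> (\<Sum>i\<in>idx. k i) \<le> e \<and> (homogenizing D \<longrightarrow> (\<Sum>i\<in>idx. k i) = e)"
proof -
  obtain \<mu>0 where \<mu>0: "\<mu>0 \<in> keys p0"
    using assms(4) by fastforce
  have "keys \<mu>0 \<subseteq> V"
    using assms(2,3) \<mu>0 by (auto simp: H_def polys_def)
  then obtain m k0 where m: "reduced m" "\<mu>0 = m + comb k0"
    using reduced_exists by blast
  define e0 where "e0 = (\<Sum>i\<in>idx. k0 i)"
  let ?M = "\<Union>p\<in>S. keys p"
  have "\<exists>k. \<mu> = m + comb k \<and> (homogenizing D \<longrightarrow> (\<Sum>i\<in>idx. k i) = e0)" if "\<mu> \<in> ?M" for \<mu>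
  proof -
    from that obtain p where p: "p \<in> S" "\<mu> \<in> keys p"
      by blast
    then have "lat ((ivec \<mu> - u) - (ivec \<mu>0 - u))"
      using \<mu>0 assms(2,3) by (intro lat_diff[OF H_lat[of p] H_lat[of p0]]) auto
    then obtain z where z: "homogenizing D \<longrightarrow> (\<Sum>i\<in>idx. z i) = 0"
      "\<And>v. v \<in> V \<Longrightarrow> ivec \<mu> v - ivec \<mu>0 v = z (blk v) * int (lvar D v)"
      unfolding lat_def by auto
    define z' where "z' = (\<lambda>i. z i + int (k0 i))"
    have "ivec \<mu> v - ivec m v = z' (blk v) * int (lvar D v)" if "v \<in> V" for v
      using z(2)[OF that] that
      by (simp add: m(2) ivec_def lookup_add lookup_comb z'_def algebra_simps)
    moreover have "keys \<mu> \<subseteq> V"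
      using that assms(2) by (auto simp: H_def polys_def)
    ultimately have *: "\<mu> = m + comb (\<lambda>i. nat (z' i))" "\<And>i. i \<in> idx \<Longrightarrow> z' i \<ge> 0"
      using reduced_decomp[OF m(1)] by blast+
    have "(\<Sum>i\<in>idx. nat (z' i)) = e0" if "homogenizing D"
    proof -
      have "int (\<Sum>i\<in>idx. nat (z' i)) = (\<Sum>i\<in>idx. z' i)"
        unfolding of_nat_sum using *(2) by (intro sum.cong) auto
      also have "\<dots> = int e0"
        using z(1) that by (simp add: z'_def sum.distrib e0_def)
      finally show ?thesis
        unfolding of_nat_eq_iff .
    qed
    with * show ?thesis by blast
  qed
  then obtain K where K: "\<And>\<mu>. \<mu> \<in> ?M \<Longrightarrow> \<mu> = m + comb (K \<mu>)"
    "\<And>\<mu>. \<mu> \<in> ?M \<Longrightarrow> homogenizing D \<longrightarrow> (\<Sum>i\<in>idx. K \<mu> i) = e0"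
    by metis
  \<comment> \<open>In type 1 the sum over all occurring monomials is a crude common bound; in type
    2 all of them have the same total.\<close>
  define e where "e = (if homogenizing D then e0 else \<Sum>\<mu>\<in>?M. \<Sum>i\<in>idx. K \<mu> i)"
  show ?thesis
  proof (rule that)
    have "lat ((ivec \<mu>0 - u) - (ivec (comb k0) - scale e wdeg))"
      using \<mu>0 assms(2,3) by (intro lat_diff[OF H_lat lat_comb]) (auto simp: e_def e0_def)
    also have "(ivec \<mu>0 - u) - (ivec (comb k0) - scale e wdeg) = ivec m + scale e wdeg - u"
      by (simp add: m(2) ivec_add algebra_simps)
    finally show "lat (ivec m + scale e wdeg - u)" .
    fix p \<mu> assume "p \<in> S" "\<mu> \<in> keys p"
    then have \<mu>: "\<mu> \<in> ?M" by blast
    have "(\<Sum>i\<in>idx. K \<mu> i) \<le> (\<Sum>\<mu>\<in>?M. \<Sum>i\<in>idx. K \<mu> i)"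
      using \<mu> assms(1) by (intro member_le_sum) auto
    then show "\<exists>k. \<mu> = m + comb k \<and> (\<Sum>i\<in>idx. k i) \<le> e \<and> (homogenizing D \<longrightarrow> (\<Sum>i\<in>idx. k i) = e)"
      using K[OF \<mu>] by (intro exI[of _ "K \<mu>"]) (auto simp: e_def)
  qed (fact m)
qed

subsection \<open>Normal form of homogeneous elements\<close>

text \<open>For \<open>g\<close> of degree at most e, the homogenization q^e g(p/q).\<close>

definition form :: "(trinomial_var, 'k) mpoly \<Rightarrow> (trinomial_var, 'k) mpoly \<Rightarrow> nat \<Rightarrow> 'k poly
    \<Rightarrow> (trinomial_var, 'k) mpoly" where
  "form p q e g = (\<Sum>k\<le>e. Const (poly.coeff g k) * p ^ k * q ^ (e - k))"

lemma form_add: "form p q e (g + g') = form p q e g + form p q e g'"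
  by (simp add: form_def Const_add distrib_right sum.distrib)

lemma form_smult: "form p q e (Polynomial.smult c g) = Const c * form p q e g"
  by (simp add: form_def Const_mult sum_distrib_left mult.assoc)

lemma form_uminus: "form p q e (- g) = - form p q e g"
  by (simp add: form_def Const_uminus sum_negf)

lemma form_diff: "form p q e (g - g') = form p q e g - form p q e g'"
  using form_add[of p q e g "- g'"] by (simp add: form_uminus)

lemma form_0 [simp]: "form p q e 0 = 0"
  by (simp add: form_def)

lemma form_const: "form p q e [:c:] = Const c * q ^ e"
proof -
  have "form p q e [:c:] = (\<Sum>k\<le>e. if k = 0 then Const c * q ^ e else 0)"
    unfolding form_def by (intro sum.cong) (auto simp: coeff_pCons split: nat.splits)
  then show ?thesis by simp
qed

lemma form_pCons_0: "form p q (Suc e) (pCons 0 g) = p * form p q e g"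
  unfolding form_def by (subst sum.atMost_Suc_shift) (simp add: sum_distrib_left mult_ac)

text \<open>A homogenization of too high degree has a root at infinity and is divisible by
  \<open>q\<close>. For \<open>q = 1\<close> raising the degree changes nothing.\<close>

lemma form_Suc:
  assumes "Polynomial.degree g \<le> e"
  shows "form p q (Suc e) g = q * form p q e g"
proof -
  have "poly.coeff g (Suc e) = 0"
    using assms by (intro coeff_eq_0) simp
  then show ?thesis
    by (simp add: form_def sum_distrib_left mult_ac Suc_diff_le)
qed

lemma form_linear_mult:
  assumes "Polynomial.degree g \<le> e"
  shows "form p q (Suc e) ([:b, c:] * g) = (Const c * p + Const b * q) * form p q e g"
proof -
  have "[:b, c:] * g = Polynomial.smult b g + pCons 0 (Polynomial.smult c g)"
    by simp
  then show ?thesis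
    by (simp only: form_add form_smult form_pCons_0 form_Suc[OF assms]) (simp add: algebra_simps)
qed

lemma peval_form:
  assumes "peval x p = s" "peval x q = 1" "Polynomial.degree g \<le> e"
  shows "peval x (form p q e g) = poly g s"
proof -
  have "peval x (form p q e g) = (\<Sum>k\<le>e. poly.coeff g k * s ^ k)"
    by (simp add: form_def assms)
  also have "\<dots> = (\<Sum>k\<le>Polynomial.degree g. poly.coeff g k * s ^ k)"
    using assms(3) by (intro sum.mono_neutral_right) (auto simp: coeff_eq_0)
  finally show ?thesis
    by (simp add: poly_altdef)
qed

text \<open>A generating pair \<open>p\<close>, \<open>q\<close> with the coordinates
  \<open>b i\<close>, \<open>c i\<close> of the T_i^{l_i}. Pairs other than \<open>base1\<close>,
  \<open>base2\<close> occur because the killed member is to become \<open>q\<close>; in type 1 that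
  is the constant 1.\<close>

definition pencil :: "(trinomial_var, 'k) mpoly \<Rightarrow> (trinomial_var, 'k) mpoly
    \<Rightarrow> (nat \<Rightarrow> 'k) \<Rightarrow> (nat \<Rightarrow> 'k) \<Rightarrow> bool" where
  "pencil p q b c \<longleftrightarrow> p \<in> H wdeg \<and> q \<in> H wdeg \<and> (\<not> homogenizing D \<longrightarrow> q = 1) \<and>
     (\<forall>i\<in>idx. Y i - (Const (b i) * p + Const (c i) * q) \<in> I)"

lemma H_form:
  assumes "pencil p q b c"
  shows "form p q e g \<in> H (scale e wdeg)"
  unfolding form_def
proof (rule H_sum)
  fix k assume "k \<in> {..e}"
  then have *: "scale k wdeg + scale (e - k) wdeg = scale e wdeg"
    by (simp add: scale_def fun_eq_iff flip: distrib_right of_nat_add)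
  have "(Const (poly.coeff g k) * p ^ k) * q ^ (e - k) \<in> H (scale k wdeg + scale (e - k) wdeg)"
    using assms by (intro H_mult[OF H_Const_mult[OF H_power] H_power]) (auto simp: pencil_def)
  then show "Const (poly.coeff g k) * p ^ k * q ^ (e - k) \<in> H (scale e wdeg)"
    by (simp only: *)
qed

text \<open>Each T_i^{l_i} is congruent to a linear form, so a product of them is congruent to the
  homogenization of a product of linear polynomials.\<close>

lemma prod_Y_form:
  assumes pen: "pencil p q b c"
  shows "\<exists>g. Polynomial.degree g \<le> (\<Sum>i\<in>idx. k i) \<and>
    (\<Prod>i\<in>idx. Y i ^ k i) - form p q (\<Sum>i\<in>idx. k i) g \<in> I"
proof -
  let ?P = "\<lambda>e x. x \<in> polys V \<and> (\<exists>g. Polynomial.degree g \<le> e \<and> x - form p q e g \<in> I)"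
  have step: "?P (Suc e) (Y i * x)" if i: "i \<in> idx" and x: "?P e x" for i e x
  proof -
    from x obtain g where g: "Polynomial.degree g \<le> e" "x - form p q e g \<in> I" and "x \<in> polys V"
      by blast
    have "Y i * x - (Const (b i) * p + Const (c i) * q) * form p q e g \<in> I"
      using pen i g by (intro I_mult_cong H_polys[OF H_form[OF pen]]) (auto simp: pencil_def)
    then have "Y i * x - form p q (Suc e) ([:c i, b i:] * g) \<in> I"
      by (simp only: form_linear_mult[OF g(1)])
    moreover have "Polynomial.degree ([:c i, b i:] * g) \<le> Suc e"
      using degree_mult_le[of "[:c i, b i:]" g] g(1) by (simp split: if_splits)
    ultimately show ?thesis
      using i \<open>x \<in> polys V\<close> by (auto simp del: mult_pCons_left)
  qed
  have power: "?P (k + e) (Y i ^ k * x)" if "i \<in> idx" "?P e x" for i e k x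
    using that(2)
  proof (induction k)
    case (Suc k)
    then show ?case
      using step[OF that(1), of "Y i ^ k * x" "k + e"] by (simp add: mult.assoc)
  qed simp
  have "?P (\<Sum>i\<in>A. k i) (\<Prod>i\<in>A. Y i ^ k i)" if "A \<subseteq> idx" for A
    using finite_subset[OF that finite_atLeastAtMost] that
  proof (induction A rule: finite_induct)
    case empty
    then show ?case by (auto intro!: exI[of _ 1] simp: form_def)
  next
    case (insert i A)
    then show ?case
      using power[of i "\<Prod>i\<in>A. Y i ^ k i" "\<Sum>i\<in>A. k i" "k i"] by auto
  qed
  then show ?thesis by blast
qed

lemma normal_form:
  assumes pen: "pencil p q b c" and m: "reduced m" and x: "x \<in> polys V"
    and k: "\<And>\<mu>. \<mu> \<in> keys x \<Longrightarrow>
      \<exists>k. \<mu> = m + comb k \<and> (\<Sum>i\<in>idx. k i) \<le> e \<and> (homogenizing D \<longrightarrow> (\<Sum>i\<in>idx. k i) = e)"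
  obtains g where "Polynomial.degree g \<le> e" "x - mon m * form p q e g \<in> I"
proof -
  let ?P = "\<lambda>x. \<exists>g. Polynomial.degree g \<le> e \<and> x - mon m * form p q e g \<in> I"
  have monV: "(mon m :: (trinomial_var, 'k) mpoly) \<in> polys V"
    using m by (simp add: reduced_def polys_single)
  have single: "?P (single \<mu> a)" if "\<mu> \<in> keys x" for \<mu> a
  proof -
    from k[OF that] obtain k where \<mu>: "\<mu> = m + comb k" and le: "(\<Sum>i\<in>idx. k i) \<le> e"
      and eq: "homogenizing D \<longrightarrow> (\<Sum>i\<in>idx. k i) = e"
      by blast
    obtain g where g: "Polynomial.degree g \<le> (\<Sum>i\<in>idx. k i)"
      "mon (comb k) - form p q (\<Sum>i\<in>idx. k i) g \<in> I"
      using prod_Y_form[OF pen] unfolding mon_comb by blast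
    \<comment> \<open>In type 1 the total may stay below \<open>e\<close>, and there
      \<open>q = 1\<close> makes the form independent of the degree of homogenization.\<close>
    have stable: "form p q e' g = form p q (\<Sum>i\<in>idx. k i) g"
      if "(\<Sum>i\<in>idx. k i) \<le> e'" "q = 1" for e'
      using that(1)
    proof (induction e' rule: dec_induct)
      case (step e')
      then show ?case
        using form_Suc[of g e' p q] g(1) that(2) by simp
    qed simp
    have "form p q e g = form p q (\<Sum>i\<in>idx. k i) g"
    proof (cases "homogenizing D")
      case False
      then show ?thesis
        using pen by (intro stable[OF le]) (simp add: pencil_def)
    qed (use eq in simp)
    then have "mon (comb k) - form p q e g \<in> I"
      using g(2) by simp
    then have "Const a * mon m * (mon (comb k) - form p q e g) \<in> I"
      using monV by (intro I_mult) auto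
    also have "Const a * mon m * (mon (comb k) - form p q e g) =
        single \<mu> a - mon m * form p q e (Polynomial.smult a g)"
      by (simp add: \<mu> single_eq_Const_mon[of _ a] mon_add form_smult algebra_simps)
    finally show ?thesis
      using g(1) le by (intro exI[of _ "Polynomial.smult a g"]) auto
  qed
  have "?P (\<Sum>\<mu>\<in>A. single \<mu> (lookup x \<mu>))" if "A \<subseteq> keys x" for A
    using finite_subset[OF that finite_keys] that
  proof (induction A rule: finite_induct)
    case empty
    then show ?case by (auto intro!: exI[of _ 0])
  next
    case (insert \<mu> A)
    then obtain g g' where g: "Polynomial.degree g \<le> e" "single \<mu> (lookup x \<mu>) - mon m * form p q e g \<in> I"
      "Polynomial.degree g' \<le> e" "(\<Sum>\<mu>\<in>A. single \<mu> (lookup x \<mu>)) - mon m * form p q e g' \<in> I"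
      using single[of \<mu> "lookup x \<mu>"] by auto
    then have "Polynomial.degree (g + g') \<le> e"
      "(\<Sum>\<mu>\<in>insert \<mu> A. single \<mu> (lookup x \<mu>)) - mon m * form p q e (g + g') \<in> I"
      using I_add[OF g(2,4)] insert(1,2)
      by (auto intro: degree_add_le simp: form_add algebra_simps)
    then show ?case by blast
  qed
  from this[of "keys x"] show ?thesis
    using that by (auto simp: sum_keys_single)
qed

subsection \<open>The pencil of the trinomials\<close>

text \<open>In type 2 \<open>base1\<close> and \<open>base2\<close> solve the two equations for
  \<open>Y 0\<close> and \<open>Y 1\<close> by Cramer's rule; in type 1 \<open>base1\<close>
  represents the common value of the T_i^{l_i} + a_i.\<close>

definition base1 :: "(trinomial_var, 'k) mpoly" where
  "base1 = (case tri_A D of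
     Type1 a \<Rightarrow> Y 1 + Const (a 1)
   | Type2 a \<Rightarrow> Const (inverse (a1 0 * a2 1 - a1 1 * a2 0)) * (Const (a2 1) * Y 0 - Const (a2 0) * Y 1))"

definition base2 :: "(trinomial_var, 'k) mpoly" where
  "base2 = (case tri_A D of
     Type1 a \<Rightarrow> 1
   | Type2 a \<Rightarrow> Const (inverse (a1 0 * a2 1 - a1 1 * a2 0)) * (Const (a1 0) * Y 1 - Const (a1 1) * Y 0))"

lemma homogenizing_simps:
  "tri_A D = Type1 a \<Longrightarrow> \<not> homogenizing D"
  "tri_A D = Type2 a' \<Longrightarrow> homogenizing D"
  by (auto simp: homogenizing_def)

lemma pencil_Type1:
  assumes "tri_A D = Type1 a"
  shows "pencil base1 base2 a1 a2"
proof -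
  have idx: "idx = {1..tri_r D}"
    using idx_Type1[OF assms] .
  have "Y i - (base1 + Const (- a i)) \<in> I" if "1 \<le> i" "i \<le> tri_r D" for i
    using that
  proof (induction i rule: dec_induct)
    case base
    then show ?case by (simp add: base1_def assms Const_uminus)
  next
    case (step i)
    have rel: "Y i - Y (i+1) - Const (a (i+1) - a i) \<in> I"
      using relations_I relations_Type1[OF assms] step by fastforce
    have "(Y i - (base1 + Const (- a i))) - (Y i - Y (i+1) - Const (a (i+1) - a i)) \<in> I"
      using step by (intro I_diff[OF _ rel]) auto
    then show ?case
      by (simp add: Const_uminus Const_diff algebra_simps)
  qed
  moreover have "base1 \<in> H wdeg"
  proof -
    have "Const (a 1) \<in> H wdeg"
      using lat_uminus[OF lat_wdeg_Type1] homogenizing_simps(1)[OF assms]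
      by (intro H_cong[OF _ H_Const]) simp
    then show ?thesis
      using r_pos by (auto simp: base1_def assms idx intro!: H_add H_Y)
  qed
  moreover have "(1 :: (trinomial_var, 'k) mpoly) \<in> H wdeg"
    using lat_uminus[OF lat_wdeg_Type1] homogenizing_simps(1)[OF assms]
    by (intro H_cong[OF _ H_1]) simp
  ultimately show ?thesis
    by (auto simp: pencil_def base2_def assms idx)
qed

lemma pencil_Type2:
  assumes "tri_A D = Type2 a"
  shows "pencil base1 base2 a1 a2"
proof -
  have idx: "idx = {0..tri_r D}"
    using idx_Type2[OF assms] .
  define w where "w = a1 0 * a2 1 - a1 1 * a2 0"
  have w: "w \<noteq> 0"
    unfolding w_def using r_pos by (intro columns_independent) (auto simp: idx)
  define b c where "b = Const (inverse w) * Const (a2 1)" and "c = Const (inverse w) * Const (a2 0)"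
  have comb: "Const s * base1 + Const t * base2 =
      Const (inverse w * (s * a2 1 - t * a1 1)) * Y 0 + Const (inverse w * (t * a1 0 - s * a2 0)) * Y 1" for s t
    by (simp add: base1_def base2_def assms w_def Const_mult Const_diff algebra_simps)
  have Y0: "Y 0 - (Const (a1 0) * base1 + Const (a2 0) * base2) = 0"
    using w unfolding comb by (simp add: w_def mult.commute)
  have Y1: "Y 1 - (Const (a1 1) * base1 + Const (a2 1) * base2) = 0"
    using w unfolding comb by (simp add: w_def mult.commute)
  \<comment> \<open>Each relation links three consecutive blocks, so the induction carries two of
    them.\<close>
  have "Y i - (Const (a1 i) * base1 + Const (a2 i) * base2) \<in> I \<and>
    (i + 1 \<le> tri_r D \<longrightarrow> Y (i + 1) - (Const (a1 (i + 1)) * base1 + Const (a2 (i + 1)) * base2) \<in> I)"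
    if "i \<le> tri_r D" for i
    using that
  proof (induction i)
    case 0
    show ?case using Y0 Y1 by simp
  next
    case (Suc i)
    define Z where "Z = (\<lambda>k. Y k - (Const (a1 k) * base1 + Const (a2 k) * base2))"
    have Z: "Z i \<in> I" "Z (i + 1) \<in> I"
      using Suc by (auto simp: Z_def)
    have "Z (i + 2) \<in> I" if r: "i + 2 \<le> tri_r D"
    proof -
      define d1 d2 d3 where "d1 = a1 (i+1) * a2 (i+2) - a1 (i+2) * a2 (i+1)"
        and "d2 = a1 i * a2 (i+2) - a1 (i+2) * a2 i" and "d3 = a1 i * a2 (i+1) - a1 (i+1) * a2 i"
      have "d3 \<noteq> 0"
        unfolding d3_def using r by (intro columns_independent) (auto simp: idx)
      have "Y i * Const d1 - Y (i+1) * Const d2 + Y (i+2) * Const d3 \<in> I"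
        using relations_I relations_Type2[OF assms] r unfolding d1_def d2_def d3_def by blast
      \<comment> \<open>The linear parts cancel: their coefficients are 3x3 determinants with a
        repeated row.\<close>
      moreover have "Y i * Const d1 - Y (i+1) * Const d2 + Y (i+2) * Const d3 =
          Z i * Const d1 - Z (i+1) * Const d2 + Z (i+2) * Const d3"
        unfolding Z_def d1_def d2_def d3_def Const_diff Const_mult
        by (simp only: algebra_simps)
      ultimately have "Z i * Const d1 - Z (i+1) * Const d2 + Z (i+2) * Const d3
          - (Z i * Const d1 - Z (i+1) * Const d2) \<in> I"
        using Z by (intro I_diff I_mult_right) auto
      then have "Const d3 * Z (i+2) \<in> I"
        by (simp add: mult.commute)
      from I_mult[OF polys_Const this, of "inverse d3"] show ?thesis
        using \<open>d3 \<noteq> 0\<close> by (simp flip: mult.assoc Const_mult)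
    qed
    then show ?case
      using Z by (simp add: Z_def)
  qed
  moreover have "base1 \<in> H wdeg" "base2 \<in> H wdeg"
    using r_pos by (auto simp: base1_def base2_def assms idx intro!: H_Const_mult H_diff H_Y)
  ultimately show ?thesis
    using homogenizing_simps(2)[OF assms] by (auto simp: pencil_def idx)
qed

lemma pencil_base: "pencil base1 base2 a1 a2"
  using pencil_Type1 pencil_Type2 by (cases "tri_A D") auto

text \<open>The first variable of block i is set to an l_{i1}-th root of the required value of
  T_i^{l_i}, all other variables to 1. The hypothesis keeps every coordinate nonzero, so no monomial
  vanishes at the point.\<close>

lemma point_exists:
  assumes s: "\<And>i. i \<in> idx \<Longrightarrow> a1 i * s + a2 i \<noteq> 0"
  shows "\<exists>x. (\<forall>v. x v \<noteq> 0) \<and> (\<forall>p\<in>I. peval x p = 0) \<and> peval x base1 = s \<and> peval x base2 = 1"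
proof -
  have "\<exists>t. i \<in> idx \<longrightarrow> t ^ l i 1 = a1 i * s + a2 i" for i
    using nth_root_exists[of "l i 1" "a1 i * s + a2 i"] l_pos[of i 1] n_pos[of i] by (cases "i \<in> idx") auto
  then obtain t where t: "\<And>i. i \<in> idx \<Longrightarrow> t i ^ l i 1 = a1 i * s + a2 i"
    by metis
  define x where "x = (\<lambda>v. case v of Tv i j \<Rightarrow> if j = 1 \<and> i \<in> idx then t i else 1 | Sv k \<Rightarrow> 1)"
  have "t i \<noteq> 0" if "i \<in> idx" for i
    using t[OF that] s[OF that] l_pos[of i 1] n_pos[OF that] that by (auto simp: power_0_left)
  then have x0: "x v \<noteq> 0" for v
    by (auto simp: x_def split: trinomial_var.split)
  have Y: "peval x (Y i) = a1 i * s + a2 i" if "i \<in> idx" for i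
  proof -
    have "peval x (Y i) = (\<Prod>j\<in>{1..n i}. x (Tv i j) ^ l i j)"
      unfolding T_monomial_def by simp
    also have "\<dots> = (\<Prod>j\<in>{1..n i}. if j = 1 then t i ^ l i 1 else 1)"
      by (rule prod.cong) (use that in \<open>auto simp: x_def\<close>)
    finally show ?thesis
      using n_pos[OF that] t[OF that] by (simp add: prod.delta')
  qed
  have I: "peval x p = 0" if "p \<in> I" for p
    using that
  proof (induction rule: I_induct)
    case (relation g)
    show ?case
    proof (cases "tri_A D")
      case (Type1 a)
      then show ?thesis
        using relation Y relations_Type1[OF Type1] idx_Type1[OF Type1] by auto
    next
      case (Type2 a)
      then obtain i where i: "i + 2 \<le> tri_r D"
        "g = Y i * Const (a1 (i+1) * a2 (i+2) - a1 (i+2) * a2 (i+1))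
          - Y (i+1) * Const (a1 i * a2 (i+2) - a1 (i+2) * a2 i)
          + Y (i+2) * Const (a1 i * a2 (i+1) - a1 (i+1) * a2 i)"
        using relation relations_Type2[OF Type2] by blast
      have "{i, i+1, i+2} \<subseteq> idx"
        using i(1) idx_Type2[OF Type2] by auto
      then have "peval x (Y i) = a1 i * s + a2 i" "peval x (Y (i+1)) = a1 (i+1) * s + a2 (i+1)"
        "peval x (Y (i+2)) = a1 (i+2) * s + a2 (i+2)"
        using Y by auto
      then show ?thesis
        unfolding i(2) peval_add peval_diff peval_mult peval_Const by (simp add: algebra_simps)
    qed
  qed simp_all
  have "peval x base1 = s \<and> peval x base2 = 1"
  proof (cases "tri_A D")
    case (Type1 a)
    then show ?thesis
      using Y[of 1] r_pos idx_Type1[OF Type1] by (simp add: base1_def base2_def)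
  next
    case (Type2 a)
    have idx: "0 \<in> idx" "1 \<in> idx"
      using r_pos idx_Type2[OF Type2] by auto
    have w: "a1 0 * a2 1 - a1 1 * a2 0 \<noteq> 0"
      using idx by (intro columns_independent) auto
    show ?thesis
      unfolding base1_def base2_def Type2 coeff_matrix.case peval_mult peval_diff peval_Const
        Y[OF idx(1)] Y[OF idx(2)]
      using w unfolding Type2 by (simp add: field_simps)
  qed
  then show ?thesis
    using x0 I by blast
qed

lemma finite_bad_parameters: "finite {s. \<exists>i\<in>idx. a1 i * s + a2 i = 0}"
proof -
  have "finite {s. a1 i * s + a2 i = 0}" if "i \<in> idx" for i
  proof (cases "a1 i = 0")
    case True
    \<comment> \<open>A zero in the first row occurs only in type 2, where r > 0 supplies a second
      block. Type 1 may have a single block, but its first row is constantly 1.\<close>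
    obtain j where "j \<in> idx \<and> j \<noteq> i \<or> \<not> homogenizing D"
      using r_pos idx_Type2 that
      by (cases "tri_A D"; cases "i = 0") (auto simp: homogenizing_def)
    then have "a2 i \<noteq> 0"
      using columns_independent[of i j] True that
      by (cases "tri_A D") (auto simp: homogenizing_def)
    then show ?thesis using True by simp
  next
    case False
    then have "{s. a1 i * s + a2 i = 0} \<subseteq> {- a2 i / a1 i}"
      by (auto simp: field_simps eq_neg_iff_add_eq_0)
    then show ?thesis
      using finite_subset by blast
  qed
  moreover have "{s. \<exists>i\<in>idx. a1 i * s + a2 i = 0} = (\<Union>i\<in>idx. {s. a1 i * s + a2 i = 0})"
    by auto
  ultimately show ?thesis by simp
qed

text \<open>Both elements are monomials times forms with nonzero \<open>g\<close>,
  \<open>g'\<close>. For a parameter \<open>s\<close> that is a root of neither and not a bad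
  parameter, there is a zero of \<open>I\<close> at which neither element vanishes, hence nor does
  their product.\<close>

lemma H_prime:
  assumes p: "p \<in> H u" and q: "q \<in> H u'" and pq: "p * q \<in> I"
  shows "p \<in> I \<or> q \<in> I"
proof (rule ccontr)
  have nf: "\<exists>m e g. keys m \<subseteq> V \<and> Polynomial.degree g \<le> e \<and> x - mon m * form base1 base2 e g \<in> I \<and> g \<noteq> 0"
    if x: "x \<in> H u" "x \<notin> I" for x u
  proof -
    have "x \<noteq> 0" using x by auto
    then obtain m e where m: "reduced m" "\<And>\<mu>. \<mu> \<in> keys x \<Longrightarrow>
      \<exists>k. \<mu> = m + comb k \<and> (\<Sum>i\<in>idx. k i) \<le> e \<and> (homogenizing D \<longrightarrow> (\<Sum>i\<in>idx. k i) = e)"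
      using common_reduced[of "{x}" u x] x(1) by (metis finite.emptyI finite.insertI insert_subset
        empty_subsetI singletonI)
    obtain g where g: "Polynomial.degree g \<le> e" "x - mon m * form base1 base2 e g \<in> I"
      using normal_form[OF pencil_base m(1) H_polys[OF x(1)] m(2)] by blast
    then have "g \<noteq> 0"
      using x(2) by auto
    then show ?thesis
      using g m(1) by (auto simp: reduced_def)
  qed
  assume "\<not> ?thesis"
  then obtain m e g m' e' g' where g: "Polynomial.degree g \<le> e" "p - mon m * form base1 base2 e g \<in> I" "g \<noteq> 0"
    and g': "Polynomial.degree g' \<le> e'" "q - mon m' * form base1 base2 e' g' \<in> I" "g' \<noteq> 0"
    using nf[OF p] nf[OF q] by blast
  let ?B = "{s. \<exists>i\<in>idx. a1 i * s + a2 i = 0} \<union> {s. poly g s = 0} \<union> {s. poly g' s = 0}"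
  have "finite ?B"
    using finite_bad_parameters poly_roots_finite g(3) g'(3) by auto
  from ex_new_if_finite[OF infinite_UNIV_char_0 this] obtain s where s: "s \<notin> ?B" ..
  then have ok: "a1 i * s + a2 i \<noteq> 0" if "i \<in> idx" for i
    using that by blast
  obtain x where x: "\<And>v. x v \<noteq> 0" "\<And>p. p \<in> I \<Longrightarrow> peval x p = 0"
    "peval x base1 = s" "peval x base2 = 1"
    using point_exists[OF ok] by auto
  have "peval x p = mon_eval x m * poly g s" "peval x q = mon_eval x m' * poly g' s"
    using x(2)[OF g(2)] x(2)[OF g'(2)] peval_form[OF x(3,4) g(1)] peval_form[OF x(3,4) g'(1)] by simp_all
  moreover have "peval x p * peval x q = 0"
    using x(2)[OF pq] by simp
  moreover have "mon_eval x m \<noteq> 0" "mon_eval x m' \<noteq> 0"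
    by (rule mon_eval_neq_0, rule x(1))+
  ultimately show False
    using s by auto
qed

lemma mon_notin_I: "mon m \<notin> I"
proof
  assume m: "mon m \<in> I"
  have mon0: "mon_eval x m \<noteq> 0" if "\<And>v. x v \<noteq> 0" for x :: "trinomial_var \<Rightarrow> 'k"
    using that by (intro mon_eval_neq_0)
  from ex_new_if_finite[OF infinite_UNIV_char_0 finite_bad_parameters]
  obtain s where "s \<notin> {s. \<exists>i\<in>idx. a1 i * s + a2 i = 0}" ..
  then have ok: "a1 i * s + a2 i \<noteq> 0" if "i \<in> idx" for i
    using that by blast
  obtain x where x: "\<And>v. x v \<noteq> 0" "\<And>p. p \<in> I \<Longrightarrow> peval x p = 0"
    "peval x base1 = s" "peval x base2 = 1"
    using point_exists[OF ok] by auto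
  show False
    using x(2)[OF m] mon0[OF x(1)] by simp
qed

end

section \<open>Lifts of homogeneous locally nilpotent derivations to polynomials\<close>

section \<open>Homogeneous locally nilpotent vector fields\<close>

context trinomial
begin

lemma divide_by_Var:
  assumes "p \<in> H (unit_vec v + u)" "v \<in> V" "\<And>\<mu>. \<mu> \<in> keys p \<Longrightarrow> lookup \<mu> v \<noteq> 0"
  obtains b where "b \<in> H u" "p = Var v * b"
proof
  let ?b = "\<Sum>\<mu>\<in>keys p. single (\<mu> - single v 1) (lookup p \<mu>)"
  show "?b \<in> H u"
  proof (rule H_sum)
    fix \<mu> assume \<mu>: "\<mu> \<in> keys p"
    have "keys (\<mu> - single v 1) \<subseteq> keys \<mu>"
      by (auto simp: in_keys_iff lookup_minus)
    also have "\<dots> \<subseteq> V"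
      using assms(1) \<mu> by (auto simp: H_def polys_def)
    finally have "single (\<mu> - single v 1) (lookup p \<mu>) \<in> H (ivec \<mu> - unit_vec v)"
      using H_single ivec_minus_single[OF assms(3)[OF \<mu>]] by metis
    moreover have "lat (ivec \<mu> - unit_vec v - u)"
      using H_lat[OF assms(1) \<mu>] by (simp add: algebra_simps)
    ultimately show "single (\<mu> - single v 1) (lookup p \<mu>) \<in> H u"
      by (rule H_cong[rotated])
  qed
  have "Var v * ?b = (\<Sum>\<mu>\<in>keys p. single \<mu> (lookup p \<mu>))"
    unfolding sum_distrib_left
  proof (rule sum.cong)
    fix \<mu> assume \<mu>: "\<mu> \<in> keys p"
    have "\<mu> - single v 1 + single v 1 = \<mu>"
      using minus_single_add[OF assms(3)[OF \<mu>], of "single v 1"] by simp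
    then show "Var v * single (\<mu> - single v 1) (lookup p \<mu>) = single \<mu> (lookup p \<mu>)"
      by (simp add: Var_def mult_single add.commute)
  qed simp
  then show "p = Var v * ?b"
    by (simp add: sum_keys_single)
qed

lemma H_prod: "(\<And>i. i \<in> A \<Longrightarrow> p i \<in> H (u i)) \<Longrightarrow> prod p A \<in> H (sum u A)"
  by (induction A rule: infinite_finite_induct) (auto intro: H_mult)

text \<open>A root of \<open>g\<close> splits off the linear form p - \<rho> q; this is how a member
  of the pencil comes to divide its derivative.\<close>

lemma form_root:
  assumes "poly g \<rho> = 0" "Polynomial.degree g \<le> e"
  obtains g' e' where "form p q e g = (p - Const \<rho> * q) * form p q e' g'"
proof (cases "g = 0")
  case True
  then show ?thesis
    using that[of 0 0] by simp
next
  case False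
  from assms(1) obtain g' where g': "g = [:- \<rho>, 1:] * g'"
    unfolding poly_eq_0_iff_dvd by (elim dvdE)
  with False have "g' \<noteq> 0" by auto
  then have "Polynomial.degree g = Suc (Polynomial.degree g')"
    unfolding g' by (subst degree_mult_eq) auto
  with assms(2) obtain e' where e': "e = Suc e'" "Polynomial.degree g' \<le> e'"
    by (cases e) auto
  show ?thesis
    using that[of e' g'] form_linear_mult[OF e'(2), of p q "- \<rho>" 1]
    by (simp only: e'(1) g') (simp add: Const_uminus del: mult_pCons_left)
qed

text \<open>Since \<open>lvar\<close> vanishes on the S-variables, a degree in K_0 determines the
  exponents of the S_k as integers.\<close>

lemma lat_Sv: "lat u \<Longrightarrow> Sv k \<in> V \<Longrightarrow> u (Sv k) = 0"
  unfolding lat_def by fastforce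

end

text \<open>\<open>f\<close> collects polynomial representatives of the values of the derivation on
  the variables, \<open>d\<close> represents its degree. Preserving \<open>I\<close> makes the lift
  induce a map on the quotient.\<close>

locale trinomial_lnd = trinomial D for D :: "'k::{alg_closed_field, field_char_0} trinomial_data" +
  fixes f :: "trinomial_var \<Rightarrow> (trinomial_var, 'k) mpoly" and d :: "trinomial_var \<Rightarrow> int"
  assumes f_H: "v \<in> V \<Longrightarrow> f v \<in> H (unit_vec v + d)"
    and vfield_I: "p \<in> I \<Longrightarrow> vfield V f p \<in> I"
    and vfield_nilpotent: "p \<in> polys V \<Longrightarrow> \<exists>n. (vfield V f ^^ n) p \<in> I"
begin

abbreviation \<Delta> where "\<Delta> \<equiv> vfield V f"

abbreviation Hom where "Hom \<equiv> \<Union>u. H u"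

sublocale homogeneous_lnd "polys V" I Hom \<Delta>
proof
  fix p q
  show "p \<in> Hom \<Longrightarrow> q \<in> Hom \<Longrightarrow> p * q \<in> Hom"
    using H_mult by blast
  show "p \<in> Hom \<Longrightarrow> \<Delta> p \<in> Hom"
    using H_vfield[OF f_H] by blast
  show "p \<in> polys V \<Longrightarrow> \<Delta> p \<in> polys V"
    using H_polys[OF f_H] by simp
  show "Hom \<subseteq> polys V"
    using H_polys by blast
  show "p \<in> Hom \<Longrightarrow> \<exists>n. (\<Delta> ^^ n) p \<in> I"
    using H_polys vfield_nilpotent by blast
  show "p \<in> I" if "of_nat k * p \<in> I" "k \<noteq> 0" for k
  proof -
    have "Const (inverse (of_nat k)) * (of_nat k * p) \<in> I"
      by (rule I_mult[OF polys_Const that(1)])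
    also have "Const (inverse (of_nat k)) * (of_nat k * p) = p"
      using that(2) by (simp flip: Const_of_nat Const_mult mult.assoc)
    finally show ?thesis .
  qed
qed (use H_prime in \<open>auto simp: I_add I_uminus I_mult vfield_I vfield_add vfield_mult\<close>)

lemma Delta_Var [simp]: "v \<in> V \<Longrightarrow> \<Delta> (Var v) = f v"
  by (simp add: vfield_Var finite_V)

lemma Hom_Var: "v \<in> V \<Longrightarrow> Var v \<in> Hom"
  using H_Var by blast

lemma f_kernel_if_divisible:
  assumes "v \<in> V" "\<And>\<mu>. \<mu> \<in> keys (f v) \<Longrightarrow> lookup \<mu> v \<noteq> 0"
  shows "f v \<in> I"
proof -
  obtain b where "b \<in> H d" "f v = Var v * b"
    using divide_by_Var[OF f_H[OF assms(1)] assms] .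
  then show ?thesis
    using kernel_if_divides[of "Var v" b] Hom_Var[OF assms(1)] assms(1) by auto
qed

text \<open>All l_ij are positive, so each variable of the block divides T_i^{l_i}, and homogeneous
  factors of a killed nonzero element are killed.\<close>

lemma block_kernel:
  assumes "i \<in> idx" "\<Delta> (Y i) \<in> I" "j \<in> {1..n i}"
  shows "f (Tv i j) \<in> I"
proof -
  let ?v = "Tv i j"
  have v: "?v \<in> V" using assms by simp
  have "lookup (L i) ?v \<noteq> 0"
    using assms(1,3) v l_pos[OF assms(1,3)] by (simp add: lookup_L)
  then have "L i = single ?v 1 + (L i - single ?v 1)"
    using minus_single_add[of "L i" ?v "single ?v 1"] by (simp add: add.commute)
  then have Y: "Y i = Var ?v * mon (L i - single ?v 1)"
    unfolding Y_eq_mon Var_def by (metis mon_add)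
  have "keys (L i - single ?v 1) \<subseteq> V"
    using keys_L[OF assms(1)] by (auto simp: in_keys_iff lookup_minus)
  then have "mon (L i - single ?v 1) \<in> Hom"
    using H_mon by blast
  then have "\<Delta> (Var ?v) \<in> I"
    using kernel_factor[OF Hom_Var[OF v]] assms(2) mon_notin_I unfolding Y_eq_mon[symmetric]
    by (metis Y Y_eq_mon)
  then show ?thesis using v by simp
qed

lemma Delta_Y_pencil:
  assumes "pencil p q b c" "i \<in> idx"
  shows "\<Delta> (Y i) - (Const (b i) * \<Delta> p + Const (c i) * \<Delta> q) \<in> I"
proof -
  have "Y i - (Const (b i) * p + Const (c i) * q) \<in> I"
    using assms by (simp add: pencil_def)
  then show ?thesis
    using vfield_I by (fastforce simp: vfield_diff vfield_add vfield_Const_mult)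
qed

subsection \<open>All trinomials are killed\<close>

lemma kernel_contains_T:
  assumes "\<Delta> base1 \<in> I" "\<Delta> base2 \<in> I"
  shows "(\<forall>v\<in>V. f v \<in> I) \<or>
    (\<exists>p\<in>{1..tri_m D}. f (Sv p) \<in> H (unit_vec (Sv p) + d) \<and> vfield V (S_values p) (f (Sv p)) = 0 \<and>
      (\<forall>v\<in>V. f v - f (Sv p) * S_values p v \<in> I))"
proof (rule disjCI)
  assume "\<not> (\<exists>p\<in>{1..tri_m D}. f (Sv p) \<in> H (unit_vec (Sv p) + d) \<and> vfield V (S_values p) (f (Sv p)) = 0 \<and>
      (\<forall>v\<in>V. f v - f (Sv p) * S_values p v \<in> I))"
  note no_S = this[simplified]
  have T: "f (Tv i j) \<in> I" if "Tv i j \<in> V" for i j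
  proof -
    have ij: "i \<in> idx" "j \<in> {1..n i}" using that by auto
    have "Const (a1 i) * \<Delta> base1 + Const (a2 i) * \<Delta> base2 \<in> I"
      using assms by (intro I_add I_mult) auto
    then have "\<Delta> (Y i) \<in> I"
      using I_cong[OF Delta_Y_pencil[OF pencil_base ij(1)]] by blast
    then show ?thesis
      using block_kernel ij by blast
  qed
  have S: "f (Sv p) \<in> I" if p: "p \<in> {1..tri_m D}" for p
  proof (rule ccontr)
    assume notI: "f (Sv p) \<notin> I"
    have pV: "Sv p \<in> V" using p by simp
    have exponent: "int (lookup \<mu> (Sv p)) = (if k = p then 1 else 0) + d (Sv p)"
      if "\<mu> \<in> keys (f (Sv k))" "Sv k \<in> V" for k \<mu>
      using lat_Sv[OF H_lat[OF f_H[OF that(2)] that(1)] pV]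
      by (auto simp: ivec_def unit_vec_def split: if_splits)
    \<comment> \<open>Otherwise S_p would divide its own derivative. A monomial of
      \<open>f (Sv p)\<close> without S_p shows that the derivation lowers the S_p-degree by exactly
      1.\<close>
    obtain \<mu> where \<mu>: "\<mu> \<in> keys (f (Sv p))" "lookup \<mu> (Sv p) = 0"
      using f_kernel_if_divisible[OF pV] notI by blast
    have dp: "d (Sv p) = - 1"
      using exponent[OF \<mu>(1) pV] \<mu>(2) by simp
    \<comment> \<open>A nonzero value on another S_k would have S_p-exponent -1.\<close>
    have f0: "f (Sv k) = 0" if "k \<noteq> p" "Sv k \<in> V" for k
    proof -
      have "keys (f (Sv k)) = {}"
        using exponent[of _ k] that dp by fastforce
      then show ?thesis by simp
    qed
    have "pdiff (Sv p) (f (Sv p)) = 0"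
      unfolding pdiff_def using exponent[OF _ pV] dp by (intro sum.neutral) auto
    moreover have "S_values p v * q = (if v = Sv p then q else 0)"
      for v and q :: "(trinomial_var, 'k) mpoly"
      by (cases v) auto
    ultimately have "vfield V (S_values p) (f (Sv p)) = 0"
      by (simp add: vfield_def finite_V sum.delta')
    moreover have "f v - f (Sv p) * S_values p v \<in> I" if "v \<in> V" for v
      using that T f0 by (cases v) auto
    ultimately show False
      using no_S p f_H[OF pV] by auto
  qed
  show "\<forall>v\<in>V. f v \<in> I"
  proof
    fix v assume "v \<in> V"
    then show "f v \<in> I"
      using S T by (cases v) auto
  qed
qed

subsection \<open>An eigenvector in the pencil\<close>

text \<open>A linear form \<open>base1 - \<rho> base2\<close> divides its own derivative, hence is killed, as soon as
  \<open>\<rho>\<close> is a root of \<open>X G - F\<close>, where \<open>F\<close> and \<open>G\<close> are the dehomogenized derivatives of the basis.\<close>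

lemma kernel_in_pencil_aux:
  "\<Delta> base2 \<in> I \<or> (\<exists>\<rho>. \<Delta> (base1 - Const \<rho> * base2) \<in> I)"
proof (cases "\<Delta> base2 \<in> I")
  case False
  have base: "base1 \<in> H wdeg" "base2 \<in> H wdeg"
    using pencil_base by (simp_all add: pencil_def)
  \<comment> \<open>Both derivatives have degree \<open>wdeg + d\<close>, so treating them together
    gives the same reduced monomial and the same \<open>e\<close>.\<close>
  let ?S = "{\<Delta> base1, \<Delta> base2}"
  have S: "?S \<subseteq> H (wdeg + d)"
    using H_vfield[OF f_H] base by simp
  have "\<Delta> base2 \<noteq> 0" using False by auto
  from common_reduced[OF _ S _ this] obtain m e where m: "reduced m"
    and k: "\<And>p \<mu>. p \<in> ?S \<Longrightarrow> \<mu> \<in> keys p \<Longrightarrow>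
      \<exists>k. \<mu> = m + comb k \<and> (\<Sum>i\<in>idx. k i) \<le> e \<and> (homogenizing D \<longrightarrow> (\<Sum>i\<in>idx. k i) = e)"
    by (metis finite.emptyI finite.insertI insertI1 insertI2)
  have nf: "\<exists>g. Polynomial.degree g \<le> e \<and> x - mon m * form base1 base2 e g \<in> I" if "x \<in> ?S" for x
  proof -
    have "x \<in> polys V" using S that H_polys by blast
    from normal_form[OF pencil_base m this k[OF that]] show ?thesis by blast
  qed
  obtain F G where F: "Polynomial.degree F \<le> e" "\<Delta> base1 - mon m * form base1 base2 e F \<in> I"
    and G: "Polynomial.degree G \<le> e" "\<Delta> base2 - mon m * form base1 base2 e G \<in> I"
    using nf[of "\<Delta> base1"] nf[of "\<Delta> base2"] by auto
  have mV: "keys m \<subseteq> V" using m by (simp add: reduced_def)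
  have Hom_mf: "mon m * form base1 base2 e' g \<in> Hom" for e' g
    using H_mult[OF H_mon[OF mV] H_form[OF pencil_base]] by blast
  show ?thesis
  proof (cases "Polynomial.degree (pCons 0 G - F) = 0")
    \<comment> \<open>Here deg G < e, so \<open>base2\<close> divides its own derivative: the killed
      member lies at infinity.\<close>
    case True
    then obtain c where "pCons 0 G - F = [:c:]"
      by (elim degree_eq_zeroE)
    then have "F = pCons 0 G - [:c:]"
      by (simp add: algebra_simps)
    then have F_eq: "F = pCons (- c) G"
      by simp
    have "G \<noteq> 0" using G(2) False by auto
    then have "Suc (Polynomial.degree G) \<le> e"
      using F(1) by (simp add: F_eq)
    then obtain e' where e': "e = Suc e'" "Polynomial.degree G \<le> e'"
      by (cases e) auto
    have "\<Delta> base2 - base2 * (mon m * form base1 base2 e' G) \<in> I"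
      using G(2) unfolding e'(1) form_Suc[OF e'(2)] by (simp add: mult_ac)
    then have "\<Delta> base2 \<in> I"
      using kernel_if_divides[OF _ Hom_mf] base(2) by blast
    then show ?thesis ..
  next
    case deg: False
    then obtain \<rho> where \<rho>: "poly (pCons 0 G - F) \<rho> = 0"
      using alg_closed_imp_poly_has_root by blast
    let ?lam = "base1 - Const \<rho> * base2"
    have "\<Delta> ?lam - mon m * form base1 base2 e (F - Polynomial.smult \<rho> G) \<in> I"
      using I_diff[OF F(2) I_mult[OF polys_Const G(2), of \<rho>]]
      by (simp add: vfield_diff vfield_Const_mult form_diff form_smult algebra_simps)
    moreover have "poly (F - Polynomial.smult \<rho> G) \<rho> = 0"
      using \<rho> by simp
    moreover have "Polynomial.degree (F - Polynomial.smult \<rho> G) \<le> e"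
      using F(1) G(1) by (intro degree_diff_le) auto
    ultimately obtain g' e' where
      "\<Delta> ?lam - mon m * (?lam * form base1 base2 e' g') \<in> I"
      using form_root by metis
    then have "\<Delta> ?lam - ?lam * (mon m * form base1 base2 e' g') \<in> I"
      by (simp only: mult.left_commute)
    moreover have "?lam \<in> Hom"
      using H_diff[OF base(1) H_Const_mult[OF base(2)]] by blast
    ultimately have "\<Delta> ?lam \<in> I"
      using kernel_if_divides[OF _ Hom_mf] by blast
    then show ?thesis by blast
  qed
qed simp

text \<open>The killed member becomes \<open>q\<close>. If it is \<open>base2\<close>, as always in
  type 1, the pair is kept; otherwise \<open>base2\<close> is the complement, and substituting q +
  \<rho> \<open>base2\<close> for \<open>base1\<close> gives
  \<open>b i = \<rho> * a1 i + a2 i\<close>. The row-space form is recorded because \<open>b\<close>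
  becomes the vector \<beta>.\<close>

lemma kernel_in_pencil:
  assumes "\<not> (\<Delta> base1 \<in> I \<and> \<Delta> base2 \<in> I)"
  obtains p q b c x y where "pencil p q b c" "\<Delta> p \<notin> I" "\<Delta> q \<in> I"
    "\<And>i. b i = x * a1 i + y * a2 i" "\<not> homogenizing D \<Longrightarrow> b = a1"
    "\<And>i j. i \<in> idx \<Longrightarrow> j \<in> idx \<Longrightarrow> i \<noteq> j \<Longrightarrow> b i * c j - b j * c i \<noteq> 0"
proof (cases "\<Delta> base2 \<in> I")
  case True
  show ?thesis
    using assms True by (intro that[OF pencil_base, of 1 0] columns_independent) auto
next
  case False
  then obtain \<rho> where \<rho>: "\<Delta> (base1 - Const \<rho> * base2) \<in> I"
    using kernel_in_pencil_aux by blast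
  have "homogenizing D"
    using False pencil_base by (auto simp: pencil_def)
  let ?b = "\<lambda>i. \<rho> * a1 i + 1 * a2 i"
  have "Y i - (Const (?b i) * base2 + Const (a1 i) * (base1 - Const \<rho> * base2)) \<in> I" if "i \<in> idx" for i
  proof -
    have "Y i - (Const (a1 i) * base1 + Const (a2 i) * base2) \<in> I"
      using pencil_base that by (simp add: pencil_def)
    then show ?thesis
      by (simp add: Const_add Const_mult algebra_simps)
  qed
  then have "pencil base2 (base1 - Const \<rho> * base2) ?b a1"
    using pencil_base \<open>homogenizing D\<close> by (auto simp: pencil_def intro!: H_diff H_Const_mult)
  moreover have "?b i * a1 j - ?b j * a1 i \<noteq> 0" if "i \<in> idx" "j \<in> idx" "i \<noteq> j" for i j
    using columns_independent[OF that(2,1)] that(3) by (auto simp: algebra_simps)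
  ultimately show ?thesis
    using that[of base2 _ ?b a1 \<rho> 1] False \<rho> \<open>homogenizing D\<close> by blast
qed

text \<open>If \<open>g\<close> had positive degree, a root \<rho> would make p - \<rho> q divide
  its derivative, which is that of \<open>p\<close> because \<open>q\<close> is killed; then
  \<open>p\<close> would be killed too. So \<open>g\<close> is constant, leaving only the power of
  \<open>q\<close>.\<close>

lemma Delta_pencil:
  assumes pen: "pencil p q b c" and "\<Delta> p \<notin> I" "\<Delta> q \<in> I"
  obtains m e a where "reduced m" "lat (ivec m + scale e wdeg - (wdeg + d))" "a \<noteq> 0"
    "\<Delta> p - Const a * mon m * q ^ e \<in> I"
proof -
  have pq: "p \<in> H wdeg" "q \<in> H wdeg" using pen by (simp_all add: pencil_def)
  have S: "{\<Delta> p} \<subseteq> H (wdeg + d)"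
    using H_vfield[OF f_H pq(1)] by simp
  have "\<Delta> p \<noteq> 0" using assms(2) by auto
  from common_reduced[OF _ S _ this] obtain m e where m: "reduced m"
    and lat: "lat (ivec m + scale e wdeg - (wdeg + d))"
    and k: "\<And>\<mu>. \<mu> \<in> keys (\<Delta> p) \<Longrightarrow>
      \<exists>k. \<mu> = m + comb k \<and> (\<Sum>i\<in>idx. k i) \<le> e \<and> (homogenizing D \<longrightarrow> (\<Sum>i\<in>idx. k i) = e)"
    by (metis finite.emptyI finite.insertI insertI1)
  have "\<Delta> p \<in> polys V" using S H_polys by blast
  from normal_form[OF pen m this k] obtain g where g: "Polynomial.degree g \<le> e"
    "\<Delta> p - mon m * form p q e g \<in> I" by blast
  have "Polynomial.degree g = 0"
  proof (rule ccontr)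
    assume "Polynomial.degree g \<noteq> 0"
    then obtain \<rho> where "poly g \<rho> = 0"
      using alg_closed_imp_poly_has_root by blast
    then obtain g' e' where form: "form p q e g = (p - Const \<rho> * q) * form p q e' g'"
      using form_root g(1) by blast
    let ?r = "p - Const \<rho> * q"
    have kq: "Const \<rho> * \<Delta> q \<in> I"
      using assms(3) by (intro I_mult) auto
    have "\<Delta> p - ?r * (mon m * form p q e' g') \<in> I"
      using g(2) unfolding form by (simp only: mult.left_commute)
    moreover have "\<Delta> ?r - B = (\<Delta> p - B) - Const \<rho> * \<Delta> q" for B
      unfolding vfield_diff vfield_Const_mult by (simp add: algebra_simps)
    ultimately have "\<Delta> ?r - ?r * (mon m * form p q e' g') \<in> I"
      using I_diff[OF _ kq] by presburger
    moreover have "?r \<in> Hom"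
      using H_diff[OF pq(1) H_Const_mult[OF pq(2)]] by blast
    moreover have "mon m * form p q e' g' \<in> Hom"
      using H_mult[OF H_mon H_form[OF pen]] m by (auto simp: reduced_def)
    ultimately have "\<Delta> ?r \<in> I"
      using kernel_if_divides by blast
    then have "\<Delta> p \<in> I"
      using I_add[OF _ kq] by (fastforce simp: vfield_diff vfield_Const_mult)
    then show False using assms(2) by simp
  qed
  then obtain a where a: "g = [:a:]"
    by (elim degree_eq_zeroE)
  have nf: "\<Delta> p - Const a * mon m * q ^ e \<in> I"
    using g(2) by (simp add: a form_const mult_ac)
  then have "a \<noteq> 0" using assms(2) by auto
  then show ?thesis
    using that m lat nf by blast
qed

text \<open>If \<open>m\<close> times \<open>v\<close> were still reduced, every monomial of
  \<open>f v\<close> would be a multiple of it by comparison of degrees, and \<open>v\<close> would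
  divide its own derivative. So \<open>v\<close> completes some T_i^{l_i}, which fixes the
  off-by-one in the exponents of \<open>m\<close>.\<close>

lemma nonkernel_variable:
  assumes m: "reduced m" and lat: "lat (ivec m + scale e wdeg - (wdeg + d))"
    and v: "v \<in> V" "f v \<notin> I"
  obtains i j where "v = Tv i j" "lookup m (Tv i j) + 1 = l i j"
    "\<And>j'. j' \<in> {1..n i} \<Longrightarrow> j' \<noteq> j \<Longrightarrow> lookup m (Tv i j') \<ge> l i j'"
proof -
  have "\<not> reduced (m + single v 1)"
  proof
    assume red: "reduced (m + single v 1)"
    have "lookup \<mu> v \<noteq> 0" if \<mu>: "\<mu> \<in> keys (f v)" for \<mu>
    proof -
      obtain z1 where z1: "\<And>w. w \<in> V \<Longrightarrow> (ivec \<mu> - (unit_vec v + d)) w = z1 (blk w) * int (lvar D w)"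
        using H_lat[OF f_H[OF v(1)] \<mu>] unfolding lat_def by blast
      obtain z2 where z2: "\<And>w. w \<in> V \<Longrightarrow>
          (ivec m + scale e wdeg - (wdeg + d)) w = z2 (blk w) * int (lvar D w)"
        using lat unfolding lat_def by blast
      \<comment> \<open>The degree of \<open>f v\<close> is that of \<open>m\<close> times
        \<open>v\<close> plus (e - 1) times \<open>wdeg\<close>. For e = 0 the shift is -1, hence
        the integer coordinates.\<close>
      define z where "z = (\<lambda>i. z1 i - z2 i + (int e - 1) * (if i = tri_iota D then 1 else 0))"
      have "ivec \<mu> w - ivec (m + single v 1) w = z (blk w) * int (lvar D w)" if w: "w \<in> V" for w
      proof -
        have "wdeg w = (if blk w = tri_iota D then 1 else 0) * int (lvar D w)"
          using w by (simp add: wdeg_def ivec_def lookup_L[OF iota_idx])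
        then have "ivec \<mu> w - ivec (m + single v 1) w =
            (z1 (blk w) * int (lvar D w)) - (z2 (blk w) * int (lvar D w)) +
            (int e - 1) * ((if blk w = tri_iota D then 1 else 0) * int (lvar D w))"
          using z1[OF w] z2[OF w] by (simp add: ivec_add scale_def algebra_simps)
        then show ?thesis
          by (simp add: z_def algebra_simps)
      qed
      moreover have "keys \<mu> \<subseteq> V"
        using f_H[OF v(1)] \<mu> by (auto simp: H_def polys_def)
      ultimately have "\<mu> = m + single v 1 + comb (\<lambda>i. nat (z i))"
        using reduced_decomp(1)[OF red] by blast
      then show ?thesis by (simp add: lookup_add)
    qed
    then show False
      using f_kernel_if_divisible v by blast
  qed
  moreover have "keys (m + single v 1) \<subseteq> V"
    using m v(1) Poly_Mapping.keys_add[of m "single v 1"] by (auto simp: reduced_def)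
  ultimately obtain i where i: "i \<in> idx"
    "\<And>j. j \<in> {1..n i} \<Longrightarrow> l i j \<le> lookup (m + single v 1) (Tv i j)"
    unfolding reduced_def by (meson not_less)
  obtain j where j: "j \<in> {1..n i}" "lookup m (Tv i j) < l i j"
    using m i(1) unfolding reduced_def by blast
  have vj: "v = Tv i j"
    using i(2)[OF j(1)] j(2) by (auto simp: lookup_add lookup_single when_def split: if_splits)
  show ?thesis
  proof (rule that[OF vj])
    show "lookup m (Tv i j) + 1 = l i j"
      using i(2)[OF j(1)] j(2) by (simp add: vj lookup_add)
    show "lookup m (Tv i j') \<ge> l i j'" if "j' \<in> {1..n i}" "j' \<noteq> j" for j'
      using i(2)[OF that(1)] that(2) by (simp add: vj lookup_add lookup_single)
  qed
qed

end

section \<open>Distinguished variables, the multiplier and the basic derivation\<close>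

subsection \<open>The shape of the derivation\<close>

locale trinomial_lnd_pencil = trinomial_lnd D f d
  for D :: "'k::{alg_closed_field, field_char_0} trinomial_data" and f d +
  fixes p q :: "(trinomial_var, 'k) mpoly" and b c :: "nat \<Rightarrow> 'k"
    and m :: "trinomial_var \<Rightarrow>\<^sub>0 nat" and e :: nat and a :: 'k
  assumes pen: "pencil p q b c"
    and Dp: "\<Delta> p \<notin> I" and Dq: "\<Delta> q \<in> I"
    and bc: "\<And>i j. i \<in> idx \<Longrightarrow> j \<in> idx \<Longrightarrow> i \<noteq> j \<Longrightarrow> b i * c j - b j * c i \<noteq> 0"
    and m: "reduced m" and lat_m: "lat (ivec m + scale e wdeg - (wdeg + d))"
    and a: "a \<noteq> 0" and Dp_eq: "\<Delta> p - Const a * mon m * q ^ e \<in> I"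
begin

text \<open>The support of \<beta>. The T_i^{l_i} of the remaining blocks are killed, and by
  \<open>card_complement\<close> there is at most one such block.\<close>

definition J :: "nat set" where
  "J = {i \<in> idx. b i \<noteq> 0}"

lemma J_idx: "i \<in> J \<Longrightarrow> i \<in> idx"
  and finite_J: "finite J"
  by (auto simp: J_def)

lemma Delta_Y: "i \<in> idx \<Longrightarrow> \<Delta> (Y i) - Const (b i) * \<Delta> p \<in> I"
proof -
  assume i: "i \<in> idx"
  have "Const (c i) * \<Delta> q \<in> I"
    using Dq by (intro I_mult) auto
  from I_add[OF Delta_Y_pencil[OF pen i] this] show ?thesis
    by simp
qed

text \<open>The default 1 is a valid index because every n_i is positive; it keeps \<open>C\<close>
  an index tuple on blocks that are killed entirely.\<close>

definition C :: "nat \<Rightarrow> nat" where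
  "C i = (if \<exists>j\<in>{1..n i}. f (Tv i j) \<notin> I then SOME j. j \<in> {1..n i} \<and> f (Tv i j) \<notin> I else 1)"

lemma C_nonkernel:
  assumes "\<exists>j\<in>{1..n i}. f (Tv i j) \<notin> I"
  shows "C i \<in> {1..n i} \<and> f (Tv i (C i)) \<notin> I"
proof -
  from assms have "\<exists>j. j \<in> {1..n i} \<and> f (Tv i j) \<notin> I" by blast
  from someI_ex[OF this] show ?thesis
    unfolding C_def if_P[OF assms] .
qed

text \<open>If every variable of the block were killed, T_i^{l_i} would be killed; but its
  derivative is b_i times that of \<open>p\<close>, with b_i nonzero.\<close>

lemma C:
  assumes "i \<in> J"
  shows "C i \<in> {1..n i}" "f (Tv i (C i)) \<notin> I"
proof -
  have i: "i \<in> idx" "b i \<noteq> 0" using assms by (auto simp: J_def)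
  have "\<exists>j\<in>{1..n i}. f (Tv i j) \<notin> I"
  proof (rule ccontr)
    assume "\<not> ?thesis"
    then have "f v * pdiff v (Y i) \<in> I" if "v \<in> V" for v
      using that i(1) pdiff_Y_other[OF i(1) that]
      by (cases v; cases "blk v = i") (auto intro!: I_mult_right)
    then have "\<Delta> (Y i) \<in> I"
      unfolding vfield_def by (rule I_sum)
    then have "Const (b i) * \<Delta> p \<in> I"
      using I_cong[OF Delta_Y[OF i(1)]] by simp
    from I_mult[OF polys_Const this, of "inverse (b i)"] have "\<Delta> p \<in> I"
      using i(2) by (simp flip: Const_mult mult.assoc)
    then show False using Dp by simp
  qed
  then have "C i \<in> {1..n i} \<and> f (Tv i (C i)) \<notin> I"
    by (rule C_nonkernel)
  then show "C i \<in> {1..n i}" "f (Tv i (C i)) \<notin> I" by auto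
qed

lemma Tv_C_V: "i \<in> J \<Longrightarrow> Tv i (C i) \<in> V"
  using C(1) J_idx by simp

lemma index_tuple_C: "index_tuple D C"
  unfolding index_tuple_def
proof
  fix i assume i: "i \<in> idx"
  show "C i \<in> {1..n i}"
  proof (cases "\<exists>j\<in>{1..n i}. f (Tv i j) \<notin> I")
    case True
    then show ?thesis
      using C_nonkernel by blast
  next
    case False
    then show ?thesis using n_pos[OF i] by (auto simp: C_def)
  qed
qed

lemma m_C:
  assumes "i \<in> J"
  shows "lookup m (Tv i (C i)) + 1 = l i (C i)"
    and "j \<in> {1..n i} \<Longrightarrow> j \<noteq> C i \<Longrightarrow> lookup m (Tv i j) \<ge> l i j"
  using nonkernel_variable[OF m lat_m Tv_C_V[OF assms] C(2)[OF assms]]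
  by (metis trinomial_var.inject(1))+

text \<open>Blocks outside \<open>J\<close> are killed entirely. In a block of \<open>J\<close> a
  second such variable would have exponent l_ij - 1 in \<open>m\<close>, whereas \<open>m_C\<close>
  forces at least l_ij.\<close>

lemma f_notin_I:
  assumes "v \<in> V" "f v \<notin> I"
  obtains i where "i \<in> J" "v = Tv i (C i)"
proof -
  obtain i j where ij: "v = Tv i j" "lookup m (Tv i j) + 1 = l i j"
    using nonkernel_variable[OF m lat_m assms] .
  have i: "i \<in> idx" "j \<in> {1..n i}"
    using assms(1) ij(1) by auto
  have "i \<in> J"
  proof (rule ccontr)
    assume "i \<notin> J"
    then have "\<Delta> (Y i) \<in> I"
      using Delta_Y[OF i(1)] i(1) by (simp add: J_def)
    then show False
      using block_kernel i assms(2) ij(1) by blast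
  qed
  moreover have "j = C i"
    using m_C(2)[OF \<open>i \<in> J\<close> i(2)] ij(2) by fastforce
  ultimately show ?thesis
    using that ij(1) by blast
qed

text \<open>For i in \<open>J\<close>, \<open>mon (E i)\<close> is, up to the factor l_{iC_i}, the
  derivative of T_i^{l_i} by its distinguished variable.\<close>

definition E :: "nat \<Rightarrow> trinomial_var \<Rightarrow>\<^sub>0 nat" where
  "E i = L i - single (Tv i (C i)) 1"

definition N :: "trinomial_var \<Rightarrow>\<^sub>0 nat" where
  "N = m - (\<Sum>i\<in>J. E i)"

text \<open>The denominator cancels the exponents produced by the partial derivatives, so that
  \<open>h\<close> times their product is exactly \<open>Const a * mon m * q ^ e\<close>.\<close>

definition h :: "(trinomial_var, 'k) mpoly" where
  "h = Const (a / (\<Prod>i\<in>J. of_nat (l i (C i)))) * mon N * q ^ e"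

abbreviation pd :: "nat \<Rightarrow> (trinomial_var, 'k) mpoly" where
  "pd i \<equiv> pdiff (Tv i (C i)) (Y i)"

lemma pd_eq: "i \<in> J \<Longrightarrow> pd i = Const (of_nat (l i (C i))) * mon (E i)"
  using lookup_L[OF J_idx, of i "Tv i (C i)"] Tv_C_V[of i]
  by (simp add: Y_eq_mon pdiff_single E_def single_eq_Const_mon[of _ "of_nat _"])

lemma lookup_E:
  "i \<in> J \<Longrightarrow> lookup (E i) v = (if v \<in> V \<and> blk v = i then lvar D v - (if v = Tv i (C i) then 1 else 0) else 0)"
  using lookup_L[OF J_idx, of i v] Tv_C_V[of i]
  by (auto simp: E_def lookup_minus lookup_single when_def)

lemma lookup_sum_E:
  "lookup (\<Sum>i\<in>J. E i) v =
    (if v \<in> V \<and> blk v \<in> J then lvar D v - (if v = Tv (blk v) (C (blk v)) then 1 else 0) else 0)"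
proof -
  have "lookup (\<Sum>i\<in>J. E i) v = (\<Sum>i\<in>J. if blk v = i then
      (if v \<in> V then lvar D v - (if v = Tv (blk v) (C (blk v)) then 1 else 0) else 0) else 0)"
    unfolding lookup_sum by (rule sum.cong) (auto simp: lookup_E)
  then show ?thesis
    using finite_J by (simp add: sum.delta')
qed

lemma m_eq: "m = N + (\<Sum>i\<in>J. E i)"
proof (rule poly_mapping_eqI)
  fix v
  have "lookup (\<Sum>i\<in>J. E i) v \<le> lookup m v"
  proof (cases v)
    case (Tv i j)
    show ?thesis
      using m_C[of i] m_C(2)[of i j] by (auto simp: lookup_sum_E Tv)
  qed (simp add: lookup_sum_E)
  then show "lookup m v = lookup (N + (\<Sum>i\<in>J. E i)) v"
    by (simp add: N_def lookup_add lookup_minus)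
qed

text \<open>In \<open>m\<close> this exponent is l_{iC_i} - 1, and \<open>E i\<close> uses up all of
  it. Hence \<open>mon N\<close> contains only killed variables.\<close>

lemma lookup_N_C: "i \<in> J \<Longrightarrow> lookup N (Tv i (C i)) = 0"
  using m_C(1)[of i] Tv_C_V[of i] by (simp add: N_def lookup_minus lookup_sum_E)

lemma keys_N: "keys N \<subseteq> V"
  using m by (auto simp: N_def in_keys_iff lookup_minus reduced_def)

lemma keys_E: "i \<in> J \<Longrightarrow> keys (E i) \<subseteq> V"
  by (auto simp: in_keys_iff lookup_E split: if_splits)

lemma H_q: "q \<in> H wdeg"
  using pen by (simp add: pencil_def)

definition hdeg :: "trinomial_var \<Rightarrow> int" where
  "hdeg = ivec N + scale e wdeg"

lemma H_h: "h \<in> H hdeg"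
  unfolding h_def hdeg_def by (intro H_mult H_Const_mult H_mon keys_N H_power H_q)

lemma H_pd: "i \<in> J \<Longrightarrow> pd i \<in> H (ivec (E i))"
  by (simp add: pd_eq H_Const_mult H_mon keys_E)

lemma of_nat_l: "i \<in> J \<Longrightarrow> of_nat (l i (C i)) \<noteq> (0 :: 'k)"
  using l_pos[OF J_idx C(1)] by simp

lemma pd_notin_I: "i \<in> J \<Longrightarrow> pd i \<notin> I"
proof
  assume i: "i \<in> J" "pd i \<in> I"
  have "Const (inverse (of_nat (l i (C i)))) * pd i \<in> I"
    using i(2) by (rule I_mult[OF polys_Const])
  then show False
    using of_nat_l[OF i(1)] mon_notin_I
    by (simp add: pd_eq[OF i(1)] flip: mult.assoc Const_mult)
qed

lemma h_prod_pd: "h * (\<Prod>i\<in>J. pd i) = Const a * mon m * q ^ e"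
proof -
  let ?P = "\<Prod>i\<in>J. of_nat (l i (C i)) :: 'k"
  have "?P \<noteq> 0"
    using of_nat_l finite_J by simp
  have "(\<Prod>i\<in>J. pd i) = Const ?P * mon (\<Sum>i\<in>J. E i)"
    by (simp add: pd_eq prod.distrib mon_sum Const_prod)
  then have "h * (\<Prod>i\<in>J. pd i) = (Const (a / ?P) * Const ?P) * (mon N * mon (\<Sum>i\<in>J. E i)) * q ^ e"
    by (simp add: h_def mult_ac)
  also have "Const (a / ?P) * Const ?P = Const a"
    using \<open>?P \<noteq> 0\<close> by (simp flip: Const_mult)
  also have "(mon N :: (trinomial_var, 'k) mpoly) * mon (\<Sum>i\<in>J. E i) = mon (N + (\<Sum>i\<in>J. E i))"
    by (simp only: mon_add)
  also have "N + (\<Sum>i\<in>J. E i) = m"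
    by (simp only: m_eq[symmetric])
  finally show ?thesis .
qed

lemma h_notin_I: "h \<notin> I"
proof
  assume "h \<in> I"
  then have "h * (\<Prod>i\<in>J. pd i) \<in> I"
    using H_polys[OF H_pd] by (intro I_mult_right) auto
  then show False
    using Dp I_cong[OF Dp_eq] by (simp add: h_prod_pd)
qed

lemma T_values_J: "i \<in> J \<Longrightarrow> T_values D J C b (Tv i (C i)) = Const (b i) * (\<Prod>k\<in>J - {i}. pd k)"
  by simp

lemma T_values_other:
  assumes "v \<in> V" "\<nexists>i. i \<in> J \<and> v = Tv i (C i)"
  shows "T_values D J C b v = 0"
proof (cases v)
  case (Tv i j)
  then show ?thesis
    using assms by (auto simp: J_def)
qed simp

text \<open>The basic derivation has degree \<open>d - hdeg\<close>: on T_{iC_i} its value lacks the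
  factor \<open>pd i\<close>, and \<open>E i\<close> together with that variable makes up T_i^{l_i},
  of degree \<open>wdeg\<close>. Homogeneity is what permits the later cancellations.\<close>

lemma H_T_values: "v \<in> V \<Longrightarrow> T_values D J C b v \<in> H (unit_vec v + (d - hdeg))"
proof (cases "\<exists>i. i \<in> J \<and> v = Tv i (C i)")
  case True
  then obtain i where i: "i \<in> J" "v = Tv i (C i)" by blast
  have "T_values D J C b v \<in> H (\<Sum>k\<in>J - {i}. ivec (E k))"
    unfolding i(2) T_values_J[OF i(1)] by (intro H_Const_mult H_prod H_pd) auto
  moreover have "lat ((\<Sum>k\<in>J - {i}. ivec (E k)) - (unit_vec v + (d - hdeg)))"
  proof -
    have sum_ivec: "ivec (\<Sum>k\<in>A. E k) = (\<Sum>k\<in>A. ivec (E k))" for A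
      by (induction A rule: infinite_finite_induct) (simp_all add: ivec_add)
    have "ivec m = ivec N + (\<Sum>k\<in>J. ivec (E k))"
      using arg_cong[OF m_eq, of ivec] by (simp only: ivec_add sum_ivec)
    also have "(\<Sum>k\<in>J. ivec (E k)) = ivec (E i) + (\<Sum>k\<in>J - {i}. ivec (E k))"
      using finite_J i(1) by (rule sum.remove)
    finally have ivec_m: "ivec m = ivec N + (ivec (E i) + (\<Sum>k\<in>J - {i}. ivec (E k)))" .
    have 1: "(\<Sum>k\<in>J - {i}. ivec (E k)) = ivec m - ivec N - ivec (E i)"
      unfolding ivec_m by (simp only: add_diff_cancel_left')
    have "lookup (L i) v \<noteq> 0"
      using i Tv_C_V[OF i(1)] l_pos[OF J_idx[OF i(1)] C(1)[OF i(1)]] J_idx[OF i(1)]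
      by (simp add: lookup_L del: atLeastAtMost_iff)
    then have 2: "ivec (E i) = ivec (L i) - unit_vec v"
      unfolding E_def i(2) by (rule ivec_minus_single)
    have 3: "(\<Sum>k\<in>J - {i}. ivec (E k)) - (unit_vec v + (d - hdeg)) =
        (ivec m + scale e wdeg - (wdeg + d)) - (ivec (L i) - wdeg)"
      unfolding 1 2 hdeg_def by (simp add: algebra_simps)
    show ?thesis
      unfolding 3 by (rule lat_diff[OF lat_m lat_L[OF J_idx[OF i(1)]]])
  qed
  ultimately show ?thesis
    by (rule H_cong[rotated])
qed (simp add: T_values_other)

text \<open>Only one variable of block i is not killed, so \<open>\<Delta> (Y i)\<close> reduces to
  \<open>f v * pd i\<close>. It is also b_i times the derivative of \<open>p\<close>, that is,
  \<open>h\<close> times the basic value times \<open>pd i\<close>; the homogeneous factor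
  \<open>pd i\<close> cancels by \<open>H_prime\<close>.\<close>

lemma f_eq:
  assumes v: "v \<in> V"
  shows "f v - h * T_values D J C b v \<in> I"
proof (cases "\<exists>i. i \<in> J \<and> v = Tv i (C i)")
  case True
  then obtain i where i: "i \<in> J" "v = Tv i (C i)" by blast
  let ?r = "f v - h * T_values D J C b v"
  have other: "f w * pdiff w (Y i) \<in> I" if w: "w \<in> V - {v}" for w
  proof (cases "f w \<in> I")
    case True
    then show ?thesis
      using J_idx[OF i(1)] by (intro I_mult_right) auto
  next
    case False
    then obtain i' where "w = Tv i' (C i')"
      using f_notin_I w by blast
    then have "pdiff w (Y i) = 0"
      using w i(2) by (intro pdiff_Y_other J_idx[OF i(1)]) auto
    then show ?thesis by simp
  qed
  have "\<Delta> (Y i) = f v * pd i + (\<Sum>w\<in>V - {v}. f w * pdiff w (Y i))"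
    unfolding vfield_def using sum.remove[OF finite_V v] i(2) by simp
  moreover have "(\<Sum>w\<in>V - {v}. f w * pdiff w (Y i)) \<in> I"
    by (intro I_sum other)
  ultimately have "f v * pd i - \<Delta> (Y i) \<in> I"
    using I_uminus by fastforce
  then have "f v * pd i - Const (b i) * \<Delta> p \<in> I"
    using Delta_Y[OF J_idx[OF i(1)]] by (rule I_trans)
  moreover have "Const (b i) * \<Delta> p - Const (b i) * (Const a * mon m * q ^ e) \<in> I"
    using I_mult[OF polys_Const Dp_eq, of "b i"] by (simp only: right_diff_distrib)
  ultimately have "f v * pd i - Const (b i) * (Const a * mon m * q ^ e) \<in> I"
    by (rule I_trans)
  also have "Const (b i) * (Const a * mon m * q ^ e) = h * T_values D J C b v * pd i"
    unfolding h_prod_pd[symmetric] prod.remove[OF finite_J i(1)] i(2) T_values_J[OF i(1)]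
    by (simp only: mult_ac)
  finally have "?r * pd i \<in> I"
    by (simp only: left_diff_distrib)
  moreover have "?r \<in> H (unit_vec v + d)"
    using H_diff[OF f_H[OF v]] H_mult[OF H_h H_T_values[OF v]] by (simp add: algebra_simps)
  ultimately show ?thesis
    using H_prime[OF _ H_pd[OF i(1)]] pd_notin_I[OF i(1)] by blast
next
  case False
  then show ?thesis
    using f_notin_I[OF v] T_values_other[OF v False] by auto
qed

lemma h_T_values_vfield:
  assumes "x \<in> polys V"
  shows "h * vfield V (T_values D J C b) x - \<Delta> x \<in> I"
proof -
  have "(\<Sum>v\<in>V. (f v - h * T_values D J C b v) * pdiff v x) \<in> I"
    using assms by (intro I_sum I_mult_right f_eq) auto
  from I_uminus[OF this] show ?thesis
    unfolding vfield_def by (simp add: sum_distrib_left left_diff_distrib sum_subtractf mult.assoc)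
qed

lemma Delta_h: "\<Delta> h \<in> I"
proof -
  have "\<Delta> (mon N) \<in> I"
    unfolding vfield_def
  proof (rule I_sum)
    fix v assume v: "v \<in> V"
    show "f v * pdiff v (mon N) \<in> I"
    proof (cases "f v \<in> I")
      case True
      then show ?thesis
        by (intro I_mult_right pdiff_polys) (auto simp: polys_single keys_N)
    next
      case False
      then obtain i where "i \<in> J" "v = Tv i (C i)"
        using f_notin_I v by blast
      then show ?thesis
        by (simp add: pdiff_single lookup_N_C)
    qed
  qed
  moreover have "\<Delta> (q ^ k) \<in> I" for k
  proof (induction k)
    case (Suc k)
    then show ?case
      unfolding power_Suc vfield_mult using Dq H_polys[OF H_q]
      by (intro I_add I_mult_right[of "\<Delta> q"] I_mult[of q]) auto
  qed simp
  moreover have "mon N \<in> polys V" "q ^ e \<in> polys V"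
    using keys_N H_polys[OF H_q] by (auto simp: polys_single)
  ultimately show ?thesis
    unfolding h_def vfield_mult[of _ _ "_ * _"] vfield_Const_mult
    by (intro I_add I_mult_right[of "Const _ * \<Delta> _"] I_mult[OF polys_Const]
        I_mult[of "Const _ * mon N"] polys_mult polys_Const)
qed

text \<open>Multiplied by \<open>h\<close> this becomes congruent to \<open>\<Delta> h\<close>,
  which is in \<open>I\<close> because \<open>mon N\<close> and \<open>q\<close> are killed; the
  homogeneous factor \<open>h\<close> cancels.\<close>

lemma T_values_h: "vfield V (T_values D J C b) h \<in> I"
proof -
  have "h * vfield V (T_values D J C b) h \<in> I"
    using I_cong[OF h_T_values_vfield[OF H_polys[OF H_h]]] Delta_h by simp
  moreover have "vfield V (T_values D J C b) h \<in> H (hdeg + (d - hdeg))"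
    using H_vfield[OF H_T_values H_h] .
  ultimately show ?thesis
    using H_prime[OF H_h] h_notin_I by blast
qed

text \<open>Two zeros of \<open>b\<close> would annihilate the minor b_i c_j - b_j c_i.\<close>

lemma card_complement: "i \<in> idx - J \<Longrightarrow> j \<in> idx - J \<Longrightarrow> i = j"
  using bc[of i j] by (auto simp: J_def)

text \<open>With exponent at least 2 the distinguished variable survives in \<open>pd i\<close>,
  which is a factor of the value on the distinguished variable of every other block in
  \<open>J\<close>.\<close>

lemma Var_dvd_f:
  assumes i: "i \<in> J" "l i (C i) \<noteq> 1" and j: "j \<in> J" "i \<noteq> j"
  obtains x where "x \<in> Hom" "f (Tv j (C j)) - Var (Tv i (C i)) * x \<in> I"
proof -
  let ?v = "Tv i (C i)"
  have "lookup (E i) ?v \<noteq> 0"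
    using i l_pos[OF J_idx[OF i(1)] C(1)[OF i(1)]] Tv_C_V[OF i(1)] by (simp add: lookup_E)
  then have nz: "lookup \<mu> ?v \<noteq> 0" if "\<mu> \<in> keys (pd i)" for \<mu>
    using that unfolding pd_eq[OF i(1)] single_eq_Const_mon[symmetric]
    by (simp split: if_splits)
  have "pd i \<in> H (unit_vec ?v + (ivec (E i) - unit_vec ?v))"
    using H_pd[OF i(1)] by simp
  from divide_by_Var[OF this Tv_C_V[OF i(1)] nz] obtain y where
    "y \<in> H (ivec (E i) - unit_vec ?v)" and y: "pd i = Var ?v * y" .
  then have y_Hom: "y \<in> Hom" by blast
  have "(\<Prod>k\<in>J - {j}. pd k) = pd i * (\<Prod>k\<in>J - {j} - {i}. pd k)"
    using i(1) j finite_J by (intro prod.remove) auto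
  then have eq: "h * T_values D J C b (Tv j (C j)) =
      Var ?v * (h * Const (b j) * y * (\<Prod>k\<in>J - {j} - {i}. pd k))"
    unfolding T_values_J[OF j(1)] y by (simp only: mult_ac)
  have "h * Const (b j) * y * (\<Prod>k\<in>J - {j} - {i}. pd k) \<in> Hom"
  proof (intro Hom_mult y_Hom)
    show "h \<in> Hom" using H_h by blast
    show "Const (b j) \<in> Hom" using H_Const by blast
    have "(\<Prod>k\<in>J - {j} - {i}. pd k) \<in> H (\<Sum>k\<in>J - {j} - {i}. ivec (E k))"
      by (intro H_prod H_pd) auto
    then show "(\<Prod>k\<in>J - {j} - {i}. pd k) \<in> Hom" by blast
  qed
  moreover have "f (Tv j (C j)) - Var ?v * (h * Const (b j) * y * (\<Prod>k\<in>J - {j} - {i}. pd k)) \<in> I"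
    using f_eq[OF Tv_C_V[OF j(1)]] unfolding eq .
  ultimately show ?thesis
    by (rule that)
qed

text \<open>Two exceptional variables would divide each other's derivatives, although neither is
  killed.\<close>

lemma exponents_C: "exponents_one_but_one D J C"
proof -
  have "i = j" if ij: "i \<in> J" "l i (C i) \<noteq> 1" "j \<in> J" "l j (C j) \<noteq> 1" for i j
  proof (rule ccontr)
    assume "i \<noteq> j"
    then obtain x y where "x \<in> Hom" "f (Tv j (C j)) - Var (Tv i (C i)) * x \<in> I"
      "y \<in> Hom" "f (Tv i (C i)) - Var (Tv j (C j)) * y \<in> I"
      using Var_dvd_f[OF ij(1,2,3)] Var_dvd_f[OF ij(3,4,1)] by metis
    then show False
      using kernel_if_divides_crosswise[of "Var (Tv i (C i))" "Var (Tv j (C j))" y x]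
        Hom_Var[OF Tv_C_V[OF ij(1)]] Hom_Var[OF Tv_C_V[OF ij(3)]] Tv_C_V[OF ij(1)] Tv_C_V[OF ij(3)]
        C(2)[OF ij(1)] C(2)[OF ij(3)]
      by simp
  qed
  then have "card {i \<in> J. l i (C i) \<noteq> 1} \<le> Suc 0"
    using finite_J by (subst card_le_Suc0_iff_eq) auto
  then show ?thesis
    by (simp add: exponents_one_but_one_def)
qed

end

section \<open>Transfer from polynomials back to the quotient algebra and its degree group\<close>

section \<open>Elementary derivations\<close>

context trinomial
begin

subsection \<open>The degree group\<close>

lemma carrier_lattice: "u \<in> carrier (tri_lattice D) \<longleftrightarrow> keys u \<subseteq> V"
  and mult_lattice: "u \<otimes>\<^bsub>tri_lattice D\<^esub> u' = u + u'"
  by (simp_all add: tri_lattice_def free_Abelian_group_def)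

lemma sum_P0:
  assumes "v \<in> V"
  shows "(\<Sum>i=1..tri_r D. tri_P0 D i v * z i) =
    (if blk v = 0 then - (\<Sum>i=1..tri_r D. z i) else z (blk v)) * int (lvar D v)"
proof (cases v)
  case (Tv i j)
  show ?thesis
  proof (cases "i = 0")
    case True
    have "(\<Sum>k=1..tri_r D. tri_P0 D k v * z k) = (\<Sum>k=1..tri_r D. - int (l 0 j) * z k)"
      by (rule sum.cong) (auto simp: Tv True)
    then show ?thesis
      by (simp add: Tv True sum_distrib_left sum_negf mult.commute)
  next
    case False
    have "(\<Sum>k=1..tri_r D. tri_P0 D k v * z k) = (\<Sum>k=1..tri_r D. if k = i then z i * int (l i j) else 0)"
      by (rule sum.cong) (auto simp: Tv False)
    then show ?thesis
      using assms False by (simp add: Tv)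
  qed
qed simp

text \<open>Row i of P_0 carries -l_0 in block 0, so the coordinate of block 0 is minus the sum of
  the others; this is the zero-sum condition in \<open>lat\<close>.\<close>

lemma im_P0_transpose_iff: "u \<in> im_P0_transpose D \<longleftrightarrow> keys u \<subseteq> V \<and> lat (lookup u)"
proof -
  have "(\<exists>z. \<forall>v\<in>V. lookup u v = (\<Sum>i=1..tri_r D. tri_P0 D i v * z i)) \<longleftrightarrow> lat (lookup u)"
  proof
    assume "\<exists>z. \<forall>v\<in>V. lookup u v = (\<Sum>i=1..tri_r D. tri_P0 D i v * z i)"
    then obtain z where z: "\<forall>v\<in>V. lookup u v = (\<Sum>i=1..tri_r D. tri_P0 D i v * z i)" by blast
    let ?z = "\<lambda>i. if i = 0 then - (\<Sum>i=1..tri_r D. z i) else z i"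
    have "(\<Sum>i\<in>idx. ?z i) = 0" if "homogenizing D"
    proof -
      have "idx = insert 0 {1..tri_r D}"
        using that by (auto simp: homogenizing_def tri_iota_def split: coeff_matrix.splits)
      moreover have "(\<Sum>i=1..tri_r D. ?z i) = (\<Sum>i=1..tri_r D. z i)"
        by (rule sum.cong) auto
      ultimately show ?thesis by simp
    qed
    then show "lat (lookup u)"
      unfolding lat_def using z sum_P0[of _ z] by (intro exI[of _ ?z]) simp
  next
    assume "lat (lookup u)"
    then obtain z where z: "homogenizing D \<Longrightarrow> (\<Sum>i\<in>idx. z i) = 0"
      "\<And>v. v \<in> V \<Longrightarrow> lookup u v = z (blk v) * int (lvar D v)"
      unfolding lat_def by blast
    have eq: "(if blk v = 0 then - (\<Sum>i=1..tri_r D. z i) else z (blk v)) * int (lvar D v) =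
        z (blk v) * int (lvar D v)" if v: "v \<in> V" for v
    proof (cases v)
      case (Tv i j)
      show ?thesis
      proof (cases "i = 0")
        case True
        then have hom: "homogenizing D"
          using v Tv by (auto simp: homogenizing_def tri_iota_def split: coeff_matrix.splits)
        then have "idx = insert 0 {1..tri_r D}"
          by (auto simp: homogenizing_def tri_iota_def split: coeff_matrix.splits)
        then have "z 0 + (\<Sum>i=1..tri_r D. z i) = 0"
          using z(1)[OF hom] by simp
        then show ?thesis
          by (simp add: Tv True add_eq_0_iff2)
      qed (simp add: Tv)
    qed simp
    have "lookup u v = (\<Sum>i=1..tri_r D. tri_P0 D i v * z i)" if v: "v \<in> V" for v
      unfolding sum_P0[OF v] eq[OF v] by (rule z(2)[OF v])
    then show "\<exists>z. \<forall>v\<in>V. lookup u v = (\<Sum>i=1..tri_r D. tri_P0 D i v * z i)" by blast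
  qed
  then show ?thesis
    unfolding im_P0_transpose_def mem_Collect_eq carrier_lattice by blast
qed

lemma keys_plus_subset: "keys u \<subseteq> V \<Longrightarrow> keys u' \<subseteq> V \<Longrightarrow> keys (u + u' :: _ \<Rightarrow>\<^sub>0 int) \<subseteq> V"
  and keys_minus_subset: "keys u \<subseteq> V \<Longrightarrow> keys u' \<subseteq> V \<Longrightarrow> keys (u - u' :: _ \<Rightarrow>\<^sub>0 int) \<subseteq> V"
  by (auto simp: in_keys_iff lookup_add lookup_minus subset_iff) (metis add.right_neutral diff_self)+

lemma lookup_plus_fun: "lookup (u + u') = lookup u + lookup (u' :: _ \<Rightarrow>\<^sub>0 int)"
  and lookup_minus_fun: "lookup (u - u') = lookup u - lookup (u' :: _ \<Rightarrow>\<^sub>0 int)"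
  by (simp_all add: fun_eq_iff lookup_add lookup_minus)

lemma im_add: "u \<in> im_P0_transpose D \<Longrightarrow> u' \<in> im_P0_transpose D \<Longrightarrow> u + u' \<in> im_P0_transpose D"
  and im_diff: "u \<in> im_P0_transpose D \<Longrightarrow> u' \<in> im_P0_transpose D \<Longrightarrow> u - u' \<in> im_P0_transpose D"
  by (simp_all add: im_P0_transpose_iff keys_plus_subset keys_minus_subset lookup_plus_fun
      lookup_minus_fun lat_add lat_diff)

lemma im_0: "0 \<in> im_P0_transpose D"
proof -
  have "lookup (0 :: trinomial_var \<Rightarrow>\<^sub>0 int) = 0"
    by (simp add: fun_eq_iff)
  then show ?thesis
    by (simp add: im_P0_transpose_iff)
qed

lemma tri_Q_eq: "tri_Q D u = (\<lambda>w. w + u) ` im_P0_transpose D"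
  by (auto simp: tri_Q_def r_coset_def mult_lattice)

lemma tri_Q_eq_iff: "tri_Q D u = tri_Q D u' \<longleftrightarrow> u - u' \<in> im_P0_transpose D"
proof
  assume "tri_Q D u = tri_Q D u'"
  then have "0 + u \<in> (\<lambda>w. w + u') ` im_P0_transpose D"
    using im_0 unfolding tri_Q_eq by blast
  then show "u - u' \<in> im_P0_transpose D" by auto
next
  assume *: "u - u' \<in> im_P0_transpose D"
  have "w + u \<in> tri_Q D u'" if "w \<in> im_P0_transpose D" for w
    unfolding tri_Q_eq using im_add[OF that *] by (intro image_eqI[of _ _ "w + (u - u')"]) simp_all
  moreover have "w + u' \<in> tri_Q D u" if "w \<in> im_P0_transpose D" for w
    unfolding tri_Q_eq using im_diff[OF that *] by (intro image_eqI[of _ _ "w - (u - u')"]) simp_all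
  ultimately show "tri_Q D u = tri_Q D u'"
    unfolding tri_Q_eq by blast
qed

lemma carrier_K0: "carrier (tri_K0 D) = tri_Q D ` {u. keys u \<subseteq> V}"
  by (auto simp: tri_K0_def FactGroup_def RCOSETS_def tri_Q_def carrier_lattice)

lemma mult_K0: "tri_Q D u \<otimes>\<^bsub>tri_K0 D\<^esub> tri_Q D u' = tri_Q D (u + u')"
proof -
  have "tri_Q D u \<otimes>\<^bsub>tri_K0 D\<^esub> tri_Q D u' = {x + y | x y. x \<in> tri_Q D u \<and> y \<in> tri_Q D u'}"
    by (auto simp: tri_K0_def FactGroup_def set_mult_def mult_lattice)
  also have "\<dots> = tri_Q D (u + u')"
  proof (intro equalityI subsetI)
    fix x assume "x \<in> {x + y | x y. x \<in> tri_Q D u \<and> y \<in> tri_Q D u'}"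
    then obtain w w' where w: "w \<in> im_P0_transpose D" "w' \<in> im_P0_transpose D" "x = (w + u) + (w' + u')"
      unfolding tri_Q_eq by blast
    then have "x = (w + w') + (u + u')" by simp
    then show "x \<in> tri_Q D (u + u')"
      unfolding tri_Q_eq using im_add[OF w(1,2)] by blast
  next
    fix x assume "x \<in> tri_Q D (u + u')"
    then obtain w where w: "w \<in> im_P0_transpose D" "x = w + (u + u')"
      unfolding tri_Q_eq by blast
    then have "x = (w + u) + (0 + u')" by (simp add: add.assoc)
    then show "x \<in> {x + y | x y. x \<in> tri_Q D u \<and> y \<in> tri_Q D u'}"
      unfolding tri_Q_eq using w(1) im_0 by blast
  qed
  finally show ?thesis .
qed

lemma lookup_map_int: "lookup (Poly_Mapping.map int \<mu>) = ivec \<mu>"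
  by (auto simp: fun_eq_iff ivec_def Poly_Mapping.map.rep_eq when_def)

lemma component_eq:
  assumes "keys u \<subseteq> V"
  shows "tri_component D (tri_Q D u) = \<pi> ` H (lookup u)"
proof -
  have "tri_Q D (Poly_Mapping.map int \<mu>) = tri_Q D u \<longleftrightarrow> lat (ivec \<mu> - lookup u)"
    if "keys \<mu> \<subseteq> V" for \<mu>
  proof -
    have "keys (Poly_Mapping.map int \<mu>) \<subseteq> V"
      using that by (auto simp: in_keys_iff lookup_map_int ivec_def)
    then show ?thesis
      using assms
      by (simp add: tri_Q_eq_iff im_P0_transpose_iff lookup_minus_fun keys_minus_subset lookup_map_int)
  qed
  then have "p \<in> polys V \<and> (\<forall>\<mu>\<in>keys p. tri_Q D (Poly_Mapping.map int \<mu>) = tri_Q D u) \<longleftrightarrow> p \<in> H (lookup u)" for p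
    by (auto simp: H_def polys_def)
  then show ?thesis
    by (auto simp: tri_component_def)
qed

lemma homogeneous_element_class:
  assumes "p \<in> H u"
  shows "homogeneous_element (tri_K0 D) (tri_component D) (\<pi> p)"
proof -
  \<comment> \<open>Degrees in \<open>H\<close> are arbitrary functions; restriction to the finite
    set \<open>V\<close> gives an element of the free abelian group with the same component.\<close>
  define u0 where "u0 = Abs_poly_mapping (\<lambda>v. if v \<in> V then u v else 0)"
  have "finite {v. (if v \<in> V then u v else 0) \<noteq> 0}"
    by (rule finite_subset[OF _ finite_V]) auto
  then have u0: "lookup u0 = (\<lambda>v. if v \<in> V then u v else 0)"
    unfolding u0_def by simp
  then have keys: "keys u0 \<subseteq> V"
    by (auto simp: in_keys_iff split: if_splits)
  have "lat (u - lookup u0)"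
    unfolding lat_def by (intro exI[of _ "\<lambda>_. 0"]) (simp add: u0)
  then have "p \<in> H (lookup u0)"
    using assms by (rule H_cong)
  then show ?thesis
    unfolding homogeneous_element_def carrier_K0 using component_eq[OF keys] keys by blast
qed

subsection \<open>Derivations of the quotient\<close>

lemma derivation_class:
  "derivation ring_of_type_algebra R \<delta> \<longleftrightarrow>
    (\<forall>p\<in>polys V. \<delta> (\<pi> p) \<in> \<pi> ` polys V) \<and>
    (\<forall>p\<in>polys V. \<forall>q\<in>polys V. \<delta> (\<pi> (p + q)) = \<delta> (\<pi> p) \<oplus>\<^bsub>R\<^esub> \<delta> (\<pi> q)) \<and>
    (\<forall>c. \<forall>p\<in>polys V. \<delta> (\<pi> (Const c * p)) = c \<odot>\<^bsub>R\<^esub> \<delta> (\<pi> p)) \<and>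
    (\<forall>p\<in>polys V. \<forall>q\<in>polys V. \<delta> (\<pi> (p * q)) =
      (\<delta> (\<pi> p) \<otimes>\<^bsub>R\<^esub> \<pi> q) \<oplus>\<^bsub>R\<^esub> (\<pi> p \<otimes>\<^bsub>R\<^esub> \<delta> (\<pi> q)))"
proof -
  have "carrier (ring_of_type_algebra :: 'k ring) = UNIV"
    by (simp add: ring_of_type_algebra_def)
  then show ?thesis
    unfolding derivation_def carrier_R by (simp add: Pi_iff class_add class_mult class_smult)
qed

lemma derivation_eq_vfield:
  assumes \<delta>: "derivation ring_of_type_algebra R \<delta>"
    and f: "\<And>v. v \<in> V \<Longrightarrow> f v \<in> polys V" "\<And>v. v \<in> V \<Longrightarrow> \<delta> (\<pi> (Var v)) = \<pi> (f v)"
    and p: "p \<in> polys V"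
  shows "\<delta> (\<pi> p) = \<pi> (vfield V f p)"
  using p
proof (induction rule: polys_induct)
  case (Const c)
  obtain x where x: "x \<in> polys V" "\<delta> (\<pi> 1) = \<pi> x"
    using \<delta> unfolding derivation_class by (metis imageE polys_1)
  \<comment> \<open>Constants are killed because \<delta>(1) = 2 \<delta>(1).\<close>
  have "\<delta> (\<pi> (1 * 1)) = (\<delta> (\<pi> 1) \<otimes>\<^bsub>R\<^esub> \<pi> 1) \<oplus>\<^bsub>R\<^esub> (\<pi> 1 \<otimes>\<^bsub>R\<^esub> \<delta> (\<pi> 1))"
    using \<delta> unfolding derivation_class by (metis polys_1)
  then have "\<pi> x = \<pi> (x + x)"
    using x by (simp add: class_mult class_add)
  then have "x - (x + x) \<in> I"
    using class_eq_iff[OF x(1) polys_add[OF x(1) x(1)]] by blast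
  then have "x \<in> I"
    using I_uminus[of "x - (x + x)"] by simp
  have "\<delta> (\<pi> (Const c * 1)) = c \<odot>\<^bsub>R\<^esub> \<delta> (\<pi> 1)"
    using \<delta> unfolding derivation_class by (metis polys_1)
  also have "\<dots> = \<pi> (Const c * x)"
    using x by (simp add: class_smult)
  also have "\<dots> = \<pi> 0"
    using x(1) \<open>x \<in> I\<close> by (simp add: class_eq_iff I_mult)
  finally show ?case by simp
next
  case (Var v)
  then show ?case by (simp add: f vfield_Var finite_V)
next
  case (add p q)
  then show ?case
    using \<delta> f(1) by (simp add: derivation_class class_add vfield_add)
next
  case (mult p q)
  then show ?case
    using \<delta> f(1) by (simp add: derivation_class class_add class_mult vfield_mult)
qed

text \<open>By the product rule a vector field mapping the relations into \<open>I\<close> preserves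
  \<open>I\<close>; its effect on classes is then independent of the chosen representative.\<close>

lemma vfield_class_derivation:
  assumes g: "\<And>v. v \<in> V \<Longrightarrow> g v \<in> polys V" and rel: "\<And>x. x \<in> tri_relations D \<Longrightarrow> vfield V g x \<in> I"
  obtains \<delta> where "derivation ring_of_type_algebra R \<delta>"
    "\<And>p. p \<in> polys V \<Longrightarrow> \<delta> (\<pi> p) = \<pi> (vfield V g p)"
proof -
  have I: "x \<in> I \<and> vfield V g x \<in> I" if "x \<in> I" for x
    using that
  proof (induction rule: I_induct)
    case (mult p q)
    moreover have "vfield V g q \<in> polys V"
      using mult g by simp
    ultimately show ?case
      by (auto simp: vfield_mult intro!: I_add I_mult[of "vfield V g q"] I_mult[of q])
  qed (use rel relations_I in \<open>auto simp: vfield_add intro: I_add\<close>)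
  define \<delta> where "\<delta> A = \<pi> (vfield V g (SOME p. p \<in> polys V \<and> \<pi> p = A))" for A
  have eq: "\<delta> (\<pi> p) = \<pi> (vfield V g p)" if p: "p \<in> polys V" for p
  proof -
    define x where "x = (SOME x. x \<in> polys V \<and> \<pi> x = \<pi> p)"
    have x: "x \<in> polys V" "\<pi> x = \<pi> p"
      using someI[of "\<lambda>x. x \<in> polys V \<and> \<pi> x = \<pi> p" p] p unfolding x_def by auto
    then have "vfield V g (x - p) \<in> I"
      using p I by (simp add: class_eq_iff)
    then show ?thesis
      using x(1) p g unfolding \<delta>_def x_def[symmetric] by (simp add: class_eq_iff vfield_diff)
  qed
  have "derivation ring_of_type_algebra R \<delta>"
    using g by (auto simp: derivation_class eq class_add class_mult class_smult vfield_add
        vfield_mult vfield_Const_mult)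
  then show ?thesis
    using that eq by blast
qed

text \<open>Moves all conditions to polynomial representatives. Comparing \<open>f\<close> with
  \<open>h\<close> times \<open>g\<close> on the variables suffices, since both sides act as vector
  fields.\<close>

lemma elementary_derivationI:
  assumes \<delta>: "derivation ring_of_type_algebra R \<delta>" "\<And>p. p \<in> polys V \<Longrightarrow> \<delta> (\<pi> p) = \<pi> (vfield V f p)"
    and f: "\<And>v. v \<in> V \<Longrightarrow> f v \<in> polys V"
    and g: "\<And>v. v \<in> V \<Longrightarrow> g v \<in> polys V" "\<And>x. x \<in> tri_relations D \<Longrightarrow> vfield V g x \<in> I"
    and h: "h \<in> H u" "vfield V g h \<in> I" "\<And>v. v \<in> V \<Longrightarrow> f v - h * g v \<in> I"
    and basic: "\<And>\<delta>'. derivation ring_of_type_algebra R \<delta>' \<Longrightarrow> values_on_generators D \<delta>' g \<Longrightarrow>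
      basic_derivation D \<delta>'"
  shows "elementary_derivation D \<delta>"
proof -
  obtain \<delta>' where \<delta>': "derivation ring_of_type_algebra R \<delta>'"
    "\<And>p. p \<in> polys V \<Longrightarrow> \<delta>' (\<pi> p) = \<pi> (vfield V g p)"
    using vfield_class_derivation[OF g] by blast
  have "values_on_generators D \<delta>' g"
    by (simp add: values_on_generators_def \<delta>'(2) vfield_Var finite_V)
  then have "basic_derivation D \<delta>'"
    using basic \<delta>'(1) by blast
  moreover have hV: "h \<in> polys V"
    using h(1) H_polys by blast
  moreover have "\<delta>' (\<pi> h) = \<zero>\<^bsub>R\<^esub>"
    using hV h(2) g(1) by (simp add: \<delta>'(2) class_eq_zero_iff)
  moreover have "\<delta> x = \<pi> h \<otimes>\<^bsub>R\<^esub> \<delta>' x" if "x \<in> carrier R" for x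
  proof -
    obtain p where p: "p \<in> polys V" "x = \<pi> p"
      using \<open>x \<in> carrier R\<close> unfolding carrier_R by blast
    have "(\<Sum>v\<in>V. (f v - h * g v) * pdiff v p) \<in> I"
      using p(1) by (intro I_sum I_mult_right h(3)) auto
    then have "vfield V f p - h * vfield V g p \<in> I"
      by (simp add: vfield_def sum_distrib_left left_diff_distrib sum_subtractf mult.assoc)
    then show ?thesis
      using p hV f g(1) by (simp add: \<delta>(2) \<delta>'(2) class_mult class_eq_iff)
  qed
  ultimately show ?thesis
    unfolding elementary_derivation_def using \<delta>(1) homogeneous_element_class[OF h(1)] class_carrier
    by blast
qed

subsection \<open>The basic derivations\<close>

text \<open>In type 2 the field turns the first row of the determinant into \<open>P\<close> times
  entries of \<open>b\<close>, a combination of the other two rows. In type 1 \<open>b\<close> is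
  constant, so differences of the T_i^{l_i} are killed.\<close>

lemma vfield_relations:
  assumes Y: "\<And>i. i \<in> idx \<Longrightarrow> vfield V g (Y i) = Const (b i) * P"
    and b: "\<And>i. b i = x * a1 i + y * a2 i" "\<not> homogenizing D \<Longrightarrow> y = 0"
    and z: "z \<in> tri_relations D"
  shows "vfield V g z = 0"
proof (cases "tri_A D")
  case (Type1 a)
  then obtain i where "1 \<le> i" "i + 1 \<le> tri_r D" "z = Y i - Y (i+1) - Const (a (i+1) - a i)"
    using z relations_Type1[OF Type1] by blast
  moreover from this have "i \<in> idx" "i + 1 \<in> idx"
    using idx_Type1[OF Type1] by auto
  moreover have "b i = x" for i
    using b homogenizing_simps(1)[OF Type1] by (simp add: Type1)
  ultimately show ?thesis
    by (simp add: vfield_diff Y)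
next
  case (Type2 a)
  then obtain i where i: "i + 2 \<le> tri_r D"
    "z = Y i * Const (a1 (i+1) * a2 (i+2) - a1 (i+2) * a2 (i+1))
      - Y (i+1) * Const (a1 i * a2 (i+2) - a1 (i+2) * a2 i)
      + Y (i+2) * Const (a1 i * a2 (i+1) - a1 (i+1) * a2 i)"
    using z relations_Type2[OF Type2] by blast
  then have "i \<in> idx" "i + 1 \<in> idx" "i + 2 \<in> idx"
    using idx_Type2[OF Type2] by auto
  then have "vfield V g z = Const (b i * (a1 (i+1) * a2 (i+2) - a1 (i+2) * a2 (i+1))
      - b (i+1) * (a1 i * a2 (i+2) - a1 (i+2) * a2 i)
      + b (i+2) * (a1 i * a2 (i+1) - a1 (i+1) * a2 i)) * P"
    unfolding i(2)
    by (simp only: vfield_add vfield_diff vfield_mult vfield_Const Y Const_add Const_diff Const_mult)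
      (simp add: algebra_simps)
  also have "b i * (a1 (i+1) * a2 (i+2) - a1 (i+2) * a2 (i+1))
      - b (i+1) * (a1 i * a2 (i+2) - a1 (i+2) * a2 i)
      + b (i+2) * (a1 i * a2 (i+1) - a1 (i+1) * a2 i) = 0"
    unfolding b(1) by (simp only: algebra_simps) (simp add: algebra_simps)
  finally show ?thesis by simp
qed

lemma S_values_relations:
  assumes "p \<in> {1..tri_m D}" "z \<in> tri_relations D"
  shows "vfield V (S_values p) z = 0"
proof (rule vfield_relations[where b = "\<lambda>_. 0" and P = 0 and x = 0 and y = 0, OF _ _ _ assms(2)])
  fix i assume i: "i \<in> idx"
  have "S_values p v * pdiff v (Y i) = 0" if "v \<in> V" for v
    using pdiff_Y_other[OF i that] by (cases v) auto
  then show "vfield V (S_values p) (Y i) = Const 0 * 0"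
    by (simp add: vfield_def)
qed simp_all

lemma T_values_Y:
  assumes C: "index_tuple D C" and J: "J \<subseteq> idx" "\<And>i. i \<in> idx - J \<Longrightarrow> b i = 0" and i: "i \<in> idx"
  shows "vfield V (T_values D J C b) (Y i) = Const (b i) * (\<Prod>k\<in>J. pdiff (Tv k (C k)) (Y k))"
proof -
  let ?v = "Tv i (C i)"
  have v: "?v \<in> V"
    using C i by (simp add: index_tuple_def)
  have "T_values D J C b w * pdiff w (Y i) = 0" if w: "w \<in> V - {?v}" for w
    using pdiff_Y_other[OF i, of w] w by (cases w; cases "blk w = i") auto
  then have "vfield V (T_values D J C b) (Y i) = T_values D J C b ?v * pdiff ?v (Y i)"
    unfolding vfield_def using sum.remove[OF finite_V v, of "\<lambda>w. T_values D J C b w * pdiff w (Y i)"]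
    by simp
  also have "\<dots> = Const (b i) * (\<Prod>k\<in>J. pdiff (Tv k (C k)) (Y k))"
  proof (cases "i \<in> J")
    case True
    have "finite J" using J(1) finite_subset by blast
    then show ?thesis
      using prod.remove[OF _ True, of "\<lambda>k. pdiff (Tv k (C k)) (Y k)"] by (simp add: mult_ac)
  qed (use J(2) i in simp)
  finally show ?thesis .
qed

lemma T_values_polys:
  assumes "index_tuple D C" "J \<subseteq> idx"
  shows "T_values D J C b v \<in> polys V"
  using assms by (cases v) (auto intro!: polys_mult polys_prod pdiff_polys Y_polys)

lemma S_values_polys: "S_values p v \<in> polys V"
  by (cases v) auto

end

theorem theorem1:
  fixes D :: "'k::{alg_closed_field, field_char_0} trinomial_data"
    and \<delta> :: "(trinomial_var, 'k) mpoly set \<Rightarrow> (trinomial_var, 'k) mpoly set"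
  assumes "trinomial_data D"
    and "derivation ring_of_type_algebra (trinomial_algebra D) \<delta>"
    and "locally_nilpotent (trinomial_algebra D) \<delta>"
    and "homogeneous_derivation (tri_K0 D) (tri_component D) \<delta>"
  shows "elementary_derivation D \<delta>"
proof -
  interpret trinomial D
    by unfold_locales (fact assms(1))
  obtain d0 where d0: "keys d0 \<subseteq> V"
    "\<And>u. keys u \<subseteq> V \<Longrightarrow> \<delta> ` tri_component D (tri_Q D u) \<subseteq> tri_component D (tri_Q D (u + d0))"
    using assms(4) unfolding homogeneous_derivation_def carrier_K0 by (auto simp: mult_K0)
  define d where "d = lookup d0"
  \<comment> \<open>Homogeneity lets the representative of the value on a variable be chosen
    homogeneous already as a polynomial.\<close>
  have "\<exists>x. x \<in> H (unit_vec v + d) \<and> \<delta> (\<pi> (Var v)) = \<pi> x" if v: "v \<in> V" for v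
  proof -
    let ?u = "single v (1::int)"
    have u: "keys ?u \<subseteq> V" "lookup ?u = unit_vec v"
      using v by (auto simp: lookup_single unit_vec_def fun_eq_iff when_def)
    have "\<pi> (Var v) \<in> tri_component D (tri_Q D ?u)"
      unfolding component_eq[OF u(1)] u(2) using H_Var[OF v] by blast
    then have "\<delta> (\<pi> (Var v)) \<in> tri_component D (tri_Q D (?u + d0))"
      using d0(2)[OF u(1)] by blast
    also have "\<dots> = \<pi> ` H (unit_vec v + d)"
      using component_eq[OF keys_plus_subset[OF u(1) d0(1)]] by (simp only: lookup_plus_fun u(2) d_def)
    finally show ?thesis by blast
  qed
  then obtain f where f_H: "\<And>v. v \<in> V \<Longrightarrow> f v \<in> H (unit_vec v + d)"
    and f: "\<And>v. v \<in> V \<Longrightarrow> \<delta> (\<pi> (Var v)) = \<pi> (f v)"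
    by metis
  have f_polys: "\<And>v. v \<in> V \<Longrightarrow> f v \<in> polys V"
    using f_H H_polys by blast
  have \<delta>: "\<delta> (\<pi> p) = \<pi> (vfield V f p)" if "p \<in> polys V" for p
    using derivation_eq_vfield[OF assms(2) f_polys f that] .
  have \<delta>_iter: "(\<delta> ^^ k) (\<pi> p) = \<pi> ((vfield V f ^^ k) p) \<and> (vfield V f ^^ k) p \<in> polys V"
    if "p \<in> polys V" for p k
    by (induction k) (use that \<delta> f_polys in auto)
  interpret trinomial_lnd D f d
  proof
    show "vfield V f p \<in> I" if "p \<in> I" for p
    proof -
      have p: "p \<in> polys V" using that by (rule I_polys)
      have "\<pi> p = \<pi> 0"
        using that p by (simp add: class_eq_iff)
      then have "\<pi> (vfield V f p) = \<pi> 0"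
        using \<delta>[OF p] \<delta>[of 0] by simp
      then show ?thesis
        using p f_polys by (simp add: class_eq_iff)
    qed
    show "\<exists>k. (vfield V f ^^ k) p \<in> I" if p: "p \<in> polys V" for p
      using assms(3) \<delta>_iter[OF p] class_carrier[OF p] class_eq_zero_iff
      unfolding locally_nilpotent_def by metis
  qed (fact f_H)
  show ?thesis
  proof (cases "\<Delta> base1 \<in> I \<and> \<Delta> base2 \<in> I")
    case True
    then consider "\<forall>v\<in>V. f v \<in> I" | p where "p \<in> {1..tri_m D}"
      "vfield V (S_values p) (f (Sv p)) = 0" "\<forall>v\<in>V. f v - f (Sv p) * S_values p v \<in> I"
      using kernel_contains_T by blast
    then show ?thesis
    proof cases
      case 1
      have "\<delta> x = \<zero>\<^bsub>R\<^esub>" if "x \<in> carrier R" for x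
      proof -
        obtain p where p: "p \<in> polys V" "x = \<pi> p"
          using \<open>x \<in> carrier R\<close> unfolding carrier_R by blast
        have "\<Delta> p \<in> I"
          unfolding vfield_def using 1 p(1) by (intro I_sum I_mult_right) auto
        then show ?thesis
          using p f_polys by (simp add: \<delta> class_eq_zero_iff)
      qed
      then show ?thesis
        using assms(2) by (simp add: elementary_derivation_def)
    next
      case (2 p)
      show ?thesis
      proof (rule elementary_derivationI[OF assms(2) \<delta> f_polys])
        show "f (Sv p) \<in> H (unit_vec (Sv p) + d)"
          using 2(1) by (intro f_H) simp
        show "basic_derivation D \<delta>'"
          if "derivation ring_of_type_algebra R \<delta>'" "values_on_generators D \<delta>' (S_values p)" for \<delta>'
          using that 2(1) unfolding basic_derivation_def by blast
      qed (use 2 in \<open>simp_all add: S_values_polys S_values_relations\<close>)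
    qed
  next
    case False
    then obtain p q b c x y where pen: "pencil p q b c" and Dp: "\<Delta> p \<notin> I" and Dq: "\<Delta> q \<in> I"
      and b: "\<And>i. b i = x * a1 i + y * a2 i" and b1: "\<not> homogenizing D \<Longrightarrow> b = a1"
      and bc: "\<And>i j. i \<in> idx \<Longrightarrow> j \<in> idx \<Longrightarrow> i \<noteq> j \<Longrightarrow> b i * c j - b j * c i \<noteq> 0"
      by (rule kernel_in_pencil) blast
    obtain m e a where "reduced m" "lat (ivec m + scale e wdeg - (wdeg + d))" "a \<noteq> 0"
      "\<Delta> p - Const a * mon m * q ^ e \<in> I"
      using Delta_pencil[OF pen Dp Dq] .
    then interpret trinomial_lnd_pencil D f d p q b c m e a
      using pen Dp Dq bc by unfold_locales
    have J: "J \<subseteq> idx" "\<And>i. i \<in> idx - J \<Longrightarrow> b i = 0"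
      by (auto simp: J_def)
    have basic: "basic_derivation D \<delta>'"
      if \<delta>': "derivation ring_of_type_algebra R \<delta>'" "values_on_generators D \<delta>' (T_values D J C b)" for \<delta>'
    proof (cases "tri_A D")
      case (Type1 A)
      \<comment> \<open>In type 1 \<open>b\<close> is the first row, constantly 1, so no block drops
        out.\<close>
      then have b1': "b = (\<lambda>_. 1)"
        using b1 homogenizing_simps(1) by (auto simp: fun_eq_iff)
      have "b i \<noteq> 0" for i
        by (simp add: b1')
      then have J_eq: "J = idx"
        by (auto simp: J_def)
      have "values_on_generators D \<delta>' (T_values D idx C (\<lambda>_. 1))"
        using \<delta>'(2) unfolding J_eq unfolding b1' .
      then show ?thesis
        using \<delta>'(1) index_tuple_C exponents_C unfolding J_eq basic_derivation_def Type1
          coeff_matrix.case by blast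
    next
      case (Type2 A)
      have row: "in_row_space (tri_r D) A b"
        using b unfolding in_row_space_def Type2 by auto
      \<comment> \<open>Blocks 0 and 1 both exist because r > 0, and at most one block lies outside
        \<open>J\<close>.\<close>
      obtain i where "i \<in> J"
        using card_complement[of 0 1] idx_Type2[OF Type2] r_pos by force
      then have nz: "\<exists>i\<in>idx. b i \<noteq> 0"
        by (auto simp: J_def)
      show ?thesis
      proof (cases "J = idx")
        case True
        then have "\<forall>i\<in>idx. b i \<noteq> 0" by (auto simp: J_def)
        then show ?thesis
          using \<delta>' index_tuple_C exponents_C row nz True unfolding basic_derivation_def Type2
            coeff_matrix.case by metis
      next
        case False
        then obtain i0 where i0: "i0 \<in> idx - J"
          using J(1) by blast
        then have J_eq: "J = idx - {i0}"
          using card_complement[OF i0] J(1) by blast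
        have "b i0 = 0" "\<forall>i\<in>J. b i \<noteq> 0"
          using i0 by (simp_all add: J_def)
        then show ?thesis
          using \<delta>' index_tuple_C exponents_C row nz i0 unfolding basic_derivation_def Type2
            coeff_matrix.case J_eq by blast
      qed
    qed
    have rel: "vfield V (T_values D J C b) z = 0" if "z \<in> tri_relations D" for z
    proof -
      have Y: "vfield V (T_values D J C b) (Y i) = Const (b i) * (\<Prod>k\<in>J. pd k)" if "i \<in> idx" for i
        using index_tuple_C J that by (rule T_values_Y)
      note relations = vfield_relations[where g = "T_values D J C b" and b = b and z = z
          and P = "\<Prod>k\<in>J. pd k", OF _ _ _ that]
      show ?thesis
      proof (cases "homogenizing D")
        case True
        then show ?thesis
          using relations[of x y] Y b by blast
      next
        case False
        \<comment> \<open>In type 1 the coefficient of the second row has to vanish, so 1 and 0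
          replace the given \<open>x\<close> and \<open>y\<close>.\<close>
        have "b i = 1 * a1 i + 0 * a2 i" for i
          using b1[OF False] by simp
        then show ?thesis
          using relations[of 1 0] Y by blast
      qed
    qed
    show ?thesis
      by (rule elementary_derivationI[OF assms(2) \<delta> f_polys _ _ H_h T_values_h f_eq basic])
        (simp_all add: T_values_polys[OF index_tuple_C J(1)] rel)
  qed
qed

end
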